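(* Let $K$ be a field, let $L$ be a finite distributive lattice with at least two elements, and let $A$ be the incidence algebra of $L$ over $K$. Then for each $x\in L$ the simple $A$-module $S_x$ corresponding to $x$ satisfies $$\operatorname{grade}S_x=\operatorname{pdim}S_x=|\operatorname{cov}(x)|\quad\text{and}\quad\operatorname{cograde}S_x=\operatorname{idim}S_x=|\operatorname{cocov}(x)|.$$
   Context: The incidence algebra of a finite poset $P$ over a field $K$ is the $K$-algebra with $K$-basis $\{p_y^x \mid x,y\in P,\ x\le y\}$ and multiplication $p_{x_2}^{x_1}p_{y_2}^{y_1}=p_{y_2}^{x_1}$ if $x_2=y_1$ and $0$ otherwise. Write $e_x=p_x^x$. All modules are finitely generated right modules. $S_x$ is the simple $A$-module corresponding to $x$, i.e. the top of $e_xA$. $D=\operatorname{Hom}_K(-,K)$, and $\operatorname{pdim}$, $\operatorname{idim}$ denote projective and injective dimension. For an $A$-module $N$, $\operatorname{grade}N=\inf\{\ell\ge0\mid\operatorname{Ext}_A^\ell(N,A)\neq0\}$ and $\operatorname{cograde}N=\inf\{\ell\ge0\mid\operatorname{Ext}_A^\ell(D(A),N)\ne0\}$. For $x\in L$, $\operatorname{cov}(x)$ is the set of elements of $L$ covering $x$ and $\operatorname{cocov}(x)$ is the set of elements of $L$ covered by $x$. *)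

theory Defs
  imports "HOL-Algebra.AbelCoset" "HOL-Algebra.Elementary_Groups" "HOL-Library.Extended_Nat"
    "HOL.Vector_Spaces"
begin

section \<open>The incidence algebra\<close>

text \<open>An element is stored as its coordinate family \<open>f\<close> with respect to the basis \<open>ia_basis x y\<close>
  (\<open>x \<le> y\<close>); \<open>ia_basis x y\<close> is written $p^x_y$ on paper.\<close>

typedef (overloaded) ('l, 'k) incidence_algebra =
    "{f :: 'l::{finite,order} \<Rightarrow> 'l \<Rightarrow> 'k::field. \<forall>x y. \<not> x \<le> y \<longrightarrow> f x y = 0}"
  morphisms coord Abs_ia
  by (rule exI[of _ "\<lambda>_ _. 0"]) simp

setup_lifting type_definition_incidence_algebra

lemma coord_eq_0: "\<not> x \<le> y \<Longrightarrow> coord a x y = 0"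
  by transfer auto

lemma ia_eqI: "(\<And>x y. coord a x y = coord b x y) \<Longrightarrow> a = b"
  by transfer (auto simp: fun_eq_iff)

instantiation incidence_algebra :: ("{finite,order}", field) ring_1
begin

lift_definition zero_incidence_algebra :: "('a, 'b) incidence_algebra" is "\<lambda>_ _. 0" by simp
lift_definition one_incidence_algebra :: "('a, 'b) incidence_algebra"
  is "\<lambda>x y. if x = y then 1 else 0" by simp
lift_definition plus_incidence_algebra ::
    "('a, 'b) incidence_algebra \<Rightarrow> ('a, 'b) incidence_algebra \<Rightarrow> ('a, 'b) incidence_algebra"
  is "\<lambda>f g x y. f x y + g x y" by simp
lift_definition minus_incidence_algebra ::
    "('a, 'b) incidence_algebra \<Rightarrow> ('a, 'b) incidence_algebra \<Rightarrow> ('a, 'b) incidence_algebra"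
  is "\<lambda>f g x y. f x y - g x y" by simp
lift_definition uminus_incidence_algebra ::
    "('a, 'b) incidence_algebra \<Rightarrow> ('a, 'b) incidence_algebra"
  is "\<lambda>f x y. - f x y" by simp
lift_definition times_incidence_algebra ::
    "('a, 'b) incidence_algebra \<Rightarrow> ('a, 'b) incidence_algebra \<Rightarrow> ('a, 'b) incidence_algebra"
  is "\<lambda>f g x y. \<Sum>z\<in>UNIV. f x z * g z y"
  by (rule sum.neutral) (metis mult_eq_0_iff order_trans)

instance
proof
  fix a b c :: "('a, 'b) incidence_algebra"
  show "a * b * c = a * (b * c)"
  proof (transfer, intro ext)
    fix f g h :: "'a \<Rightarrow> 'a \<Rightarrow> 'b" and x y
    have "(\<Sum>z\<in>UNIV. (\<Sum>w\<in>UNIV. f x w * g w z) * h z y)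
        = (\<Sum>z\<in>UNIV. \<Sum>w\<in>UNIV. f x w * (g w z * h z y))"
      by (simp add: sum_distrib_right mult.assoc)
    also have "\<dots> = (\<Sum>w\<in>UNIV. \<Sum>z\<in>UNIV. f x w * (g w z * h z y))"
      by (rule sum.swap)
    finally show "(\<Sum>z\<in>UNIV. (\<Sum>w\<in>UNIV. f x w * g w z) * h z y)
        = (\<Sum>z\<in>UNIV. f x z * (\<Sum>w\<in>UNIV. g z w * h w y))"
      by (simp add: sum_distrib_left)
  qed
  show "1 * a = a"
    by transfer (auto simp: fun_eq_iff if_distrib[of "\<lambda>t. t * _"] cong: if_cong)
  show "a * 1 = a"
    by transfer (auto simp: fun_eq_iff if_distrib[of "\<lambda>t. _ * t"] cong: if_cong)
  show "(a + b) * c = a * c + b * c"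
    by transfer (auto simp: fun_eq_iff distrib_right sum.distrib)
  show "a * (b + c) = a * b + a * c"
    by transfer (auto simp: fun_eq_iff distrib_left sum.distrib)
  show "(0::('a, 'b) incidence_algebra) \<noteq> 1"
    by transfer (auto simp: fun_eq_iff)
qed (transfer; simp add: fun_eq_iff algebra_simps)+

end

lift_definition ia_scale ::
    "'k \<Rightarrow> ('l::{finite,order}, 'k::field) incidence_algebra \<Rightarrow> ('l, 'k) incidence_algebra"
  is "\<lambda>c f x y. c * f x y" by simp

lift_definition ia_basis ::
    "'l \<Rightarrow> 'l \<Rightarrow> ('l::{finite,order}, 'k::field) incidence_algebra"
  is "\<lambda>x y u v. if x \<le> y \<and> u = x \<and> v = y then 1 else 0" by auto

lemmas coord_simps = zero_incidence_algebra.rep_eq one_incidence_algebra.rep_eq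
  plus_incidence_algebra.rep_eq times_incidence_algebra.rep_eq ia_scale.rep_eq ia_basis.rep_eq

lemma vector_space_ia: "vector_space ia_scale"
  by unfold_locales (rule ia_eqI; simp add: coord_simps algebra_simps)+

lemma ia_scale_mult: "ia_scale c (a * b) = ia_scale c a * b" "ia_scale c (a * b) = a * ia_scale c b"
  by (rule ia_eqI; simp add: coord_simps sum_distrib_left algebra_simps)+

lemma ia_basis_mult:
  assumes "x1 \<le> x2" "y1 \<le> y2"
  shows "ia_basis x1 x2 * ia_basis y1 y2 = (if x2 = y1 then ia_basis x1 y2 else 0)"
proof (rule ia_eqI)
  fix u v
  have "coord (ia_basis x1 x2 * ia_basis y1 y2 :: ('a, 'b) incidence_algebra) u v
      = (\<Sum>z\<in>UNIV. if z = x2 then (if u = x1 \<and> x2 = y1 \<and> v = y2 then 1 else 0) else 0)"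
    unfolding times_incidence_algebra.rep_eq ia_basis.rep_eq using assms
    by (intro sum.cong) auto
  then show "coord (ia_basis x1 x2 * ia_basis y1 y2) u v
      = coord (if x2 = y1 then ia_basis x1 y2 else 0 :: ('a, 'b) incidence_algebra) u v"
    using assms by (auto simp: coord_simps)
qed

lemma coord_sum: "coord (sum f I) x y = (\<Sum>i\<in>I. coord (f i) x y)"
  by (induction I rule: infinite_finite_induct) (auto simp: coord_simps)

lemma ia_basis_expansion:
  "a = (\<Sum>(x, y) | x \<le> y. ia_scale (coord a x y) (ia_basis x y))"
proof (rule ia_eqI)
  fix u v
  have "coord (\<Sum>(x, y) | x \<le> y. ia_scale (coord a x y) (ia_basis x y)) u v
      = (\<Sum>q\<in>{(x, y). x \<le> y}. if q = (u, v) then coord a u v else 0)"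
    unfolding coord_sum by (rule sum.cong) (auto simp: coord_simps split: if_splits)
  then show "coord a u v = coord (\<Sum>(x, y) | x \<le> y. ia_scale (coord a x y) (ia_basis x y)) u v"
    by (auto simp: coord_eq_0)
qed

section \<open>Right modules\<close>

text \<open>As for the record \<open>module\<close> of HOL-Algebra, the fields \<open>mult\<close> and \<open>one\<close> inherited from
  \<open>ring\<close> carry no information.\<close>

record ('a, 'm) right_mod = "'m ring" +
  act :: "'m \<Rightarrow> 'a \<Rightarrow> 'm"  (infixl \<open>\<cdot>\<index>\<close> 70)

definition make_mod ::
    "'m set \<Rightarrow> 'm \<Rightarrow> ('m \<Rightarrow> 'm \<Rightarrow> 'm) \<Rightarrow> ('m \<Rightarrow> 'a \<Rightarrow> 'm) \<Rightarrow> ('a, 'm) right_mod" where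
  "make_mod C z pl ac =
    \<lparr>carrier = C, mult = undefined, one = undefined, zero = z, add = pl, act = ac\<rparr>"

locale right_module = abelian_group M for M :: "('a::ring_1, 'm) right_mod" (structure) +
  assumes act_closed: "m \<in> carrier M \<Longrightarrow> m \<cdot> a \<in> carrier M"
    and act_add_left: "m \<in> carrier M \<Longrightarrow> n \<in> carrier M \<Longrightarrow> (m \<oplus> n) \<cdot> a = m \<cdot> a \<oplus> n \<cdot> a"
    and act_add_right: "m \<in> carrier M \<Longrightarrow> m \<cdot> (a + b) = m \<cdot> a \<oplus> m \<cdot> b"
    and act_mult: "m \<in> carrier M \<Longrightarrow> m \<cdot> (a * b) = (m \<cdot> a) \<cdot> b"
    and act_one: "m \<in> carrier M \<Longrightarrow> m \<cdot> 1 = m"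

definition submod :: "'m set \<Rightarrow> ('a::ring_1, 'm) right_mod \<Rightarrow> bool" where
  "submod N M \<longleftrightarrow>
    additive_subgroup N M \<and> (\<forall>n\<in>N. \<forall>a. n \<cdot>\<^bsub>M\<^esub> a \<in> N)"

definition fin_gen :: "('a::ring_1, 'm) right_mod \<Rightarrow> bool" where
  "fin_gen M \<longleftrightarrow>
    (\<exists>G \<subseteq> carrier M. finite G \<and> (\<forall>N. submod N M \<and> G \<subseteq> N \<longrightarrow> N = carrier M))"

definition fg_module :: "('a::ring_1, 'm) right_mod \<Rightarrow> bool" where
  "fg_module M \<longleftrightarrow> right_module M \<and> fin_gen M"

definition maximal_submod :: "'m set \<Rightarrow> ('a::ring_1, 'm) right_mod \<Rightarrow> bool" where
  "maximal_submod N M \<longleftrightarrow> submod N M \<and> N \<noteq> carrier M \<and>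
    (\<forall>N'. submod N' M \<and> N \<subseteq> N' \<longrightarrow> N' = N \<or> N' = carrier M)"

definition radical :: "('a::ring_1, 'm) right_mod \<Rightarrow> 'm set" where
  "radical M = carrier M \<inter> \<Inter>{N. maximal_submod N M}"

definition quotient_mod ::
    "('a::ring_1, 'm) right_mod \<Rightarrow> 'm set \<Rightarrow> ('a, 'm set) right_mod" where
  "quotient_mod M N = make_mod (a_rcosets\<^bsub>M\<^esub> N) N (\<lambda>C D. C <+>\<^bsub>M\<^esub> D)
    (\<lambda>C a. \<Union>c\<in>C. N +>\<^bsub>M\<^esub> (c \<cdot>\<^bsub>M\<^esub> a))"

definition top_mod :: "('a::ring_1, 'm) right_mod \<Rightarrow> ('a, 'm set) right_mod" where
  "top_mod M = quotient_mod M (radical M)"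

text \<open>Homomorphisms are taken extensional, so that equality of homomorphisms is equality
  of functions; accordingly they are composed with \<^const>\<open>compose\<close>.\<close>

definition mod_hom ::
    "('a::ring_1, 'm) right_mod \<Rightarrow> ('a, 'n) right_mod \<Rightarrow> ('m \<Rightarrow> 'n) set" where
  "mod_hom M N = {f \<in> carrier M \<rightarrow>\<^sub>E carrier N.
    (\<forall>m\<in>carrier M. \<forall>m'\<in>carrier M. f (m \<oplus>\<^bsub>M\<^esub> m') = f m \<oplus>\<^bsub>N\<^esub> f m') \<and>
    (\<forall>m\<in>carrier M. \<forall>a. f (m \<cdot>\<^bsub>M\<^esub> a) = f m \<cdot>\<^bsub>N\<^esub> a)}"

definition hom_group ::
    "('a::ring_1, 'm) right_mod \<Rightarrow> ('a, 'n) right_mod \<Rightarrow> ('m \<Rightarrow> 'n) monoid" where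
  "hom_group M N = \<lparr>carrier = mod_hom M N,
    mult = (\<lambda>f g. \<lambda>m\<in>carrier M. f m \<oplus>\<^bsub>N\<^esub> g m), one = (\<lambda>m\<in>carrier M. \<zero>\<^bsub>N\<^esub>)\<rparr>"

section \<open>Projective and injective modules, Ext\<close>

text \<open>Every finitely generated right module over \<^typ>\<open>'a\<close>, whatever the type of its elements, is
  isomorphic to one with elements of type \<^typ>\<open>nat \<Rightarrow> 'a\<close> (lemma \<open>fg_module_iso_std\<close>).
  So no generality is lost by letting auxiliary modules, i.e. the test modules in the definitions of
  projectivity and injectivity and the terms of resolutions, range over this type.\<close>

type_synonym 'a std_mod = "('a, nat \<Rightarrow> 'a) right_mod"

lemma right_module_transport:
  fixes M :: "('a::ring_1, 'm) right_mod"
  assumes M: "right_module M" and fg: "fin_gen M"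
    and j: "inj_on j (carrier M)"
  obtains N :: "('a::ring_1, 'n) right_mod" where
    "fg_module N" "restrict j (carrier M) \<in> mod_hom M N" "carrier N = j ` carrier M"
proof -
  interpret M: right_module M by fact
  define k where "k = the_inv_into (carrier M) j"
  have kj [simp]: "k (j m) = m" if "m \<in> carrier M" for m
    unfolding k_def using that j by (simp add: the_inv_into_f_f)
  define N where "N = make_mod (j ` carrier M) (j \<zero>\<^bsub>M\<^esub>)
    (\<lambda>u v. j (k u \<oplus>\<^bsub>M\<^esub> k v)) (\<lambda>u a. j (k u \<cdot>\<^bsub>M\<^esub> a))"
  have [simp]: "carrier N = j ` carrier M" "\<zero>\<^bsub>N\<^esub> = j \<zero>\<^bsub>M\<^esub>"
    "u \<oplus>\<^bsub>N\<^esub> v = j (k u \<oplus>\<^bsub>M\<^esub> k v)" "u \<cdot>\<^bsub>N\<^esub> a = j (k u \<cdot>\<^bsub>M\<^esub> a)" for u v a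
    by (simp_all add: N_def make_mod_def)
  note [simp] = M.act_closed M.act_add_left M.act_add_right M.act_mult M.act_one
  interpret N: abelian_group N
  proof (rule abelian_groupI)
    fix u assume "u \<in> carrier N"
    then obtain m where "m \<in> carrier M" "u = j m" by auto
    then show "\<exists>v\<in>carrier N. v \<oplus>\<^bsub>N\<^esub> u = \<zero>\<^bsub>N\<^esub>"
      by (intro bexI[of _ "j (\<ominus>\<^bsub>M\<^esub> m)"]) (auto simp: M.l_neg)
  qed (auto simp: M.a_ac)
  have "right_module N"
    by unfold_locales auto
  moreover have "fin_gen N"
  proof -
    obtain G where G: "G \<subseteq> carrier M" "finite G" "\<And>H. submod H M \<Longrightarrow> G \<subseteq> H \<Longrightarrow> H = carrier M"
      using fg unfolding fin_gen_def by blast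
    have "H = carrier N" if H: "submod H N" "j ` G \<subseteq> H" for H
    proof -
      define H' where "H' = {m \<in> carrier M. j m \<in> H}"
      interpret H: additive_subgroup H N using H(1) by (simp add: submod_def)
      have "subgroup H' (add_monoid M)"
      proof (rule M.add.subgroupI)
        show "H' \<subseteq> carrier M" "H' \<noteq> {}"
          using H.zero_closed by (auto simp: H'_def)
        fix m assume m: "m \<in> H'"
        then have mc: "m \<in> carrier M" "j m \<in> H" by (auto simp: H'_def)
        have "\<ominus>\<^bsub>N\<^esub> (j m) = j (\<ominus>\<^bsub>M\<^esub> m)"
          using mc by (intro N.minus_equality) (auto simp: M.l_neg)
        then show "\<ominus>\<^bsub>M\<^esub> m \<in> H'"
          using H.a_inv_closed[of "j m"] mc by (auto simp: H'_def)
        fix m' assume "m' \<in> H'"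
        then show "m \<oplus>\<^bsub>M\<^esub> m' \<in> H'"
          using mc H.a_closed[of "j m" "j m'"] by (auto simp: H'_def)
      qed
      moreover have "m \<cdot>\<^bsub>M\<^esub> a \<in> H'" if "m \<in> H'" for m a
      proof -
        have mc: "m \<in> carrier M" "j m \<in> H" using that by (auto simp: H'_def)
        have "j m \<cdot>\<^bsub>N\<^esub> a \<in> H" using H(1) mc unfolding submod_def by blast
        then show ?thesis using mc by (simp add: H'_def)
      qed
      ultimately have "submod H' M"
        by (simp add: submod_def additive_subgroup.intro)
      moreover have "G \<subseteq> H'" using G(1) H(2) by (auto simp: H'_def)
      ultimately have "H' = carrier M" by (rule G(3))
      then show ?thesis using H.a_subset by (auto simp: H'_def)
    qed
    then show ?thesis
      unfolding fin_gen_def using G by (intro exI[of _ "j ` G"]) auto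
  qed
  ultimately have "fg_module N" by (simp add: fg_module_def)
  moreover have "restrict j (carrier M) \<in> mod_hom M N"
    by (auto simp: mod_hom_def)
  ultimately show thesis using that by simp
qed

lemma fin_gen_inj_std:
  fixes M :: "('a::ring_1, 'm) right_mod"
  assumes M: "right_module M" and fg: "fin_gen M"
  obtains j :: "'m \<Rightarrow> nat \<Rightarrow> 'a::ring_1" where "inj_on j (carrier M)"
proof -
  interpret M: right_module M by fact
  obtain G where G: "G \<subseteq> carrier M" "finite G" "\<And>H. submod H M \<Longrightarrow> G \<subseteq> H \<Longrightarrow> H = carrier M"
    using fg unfolding fin_gen_def by blast
  obtain n g where Gg: "G = g ` {i::nat. i < n}"
    using finite_imp_nat_seg_image_inj_on[OF G(2)] by blast
  have g: "g i \<in> carrier M" if "i < n" for i using that G(1) Gg by auto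
  define s where "s = (\<lambda>f :: nat \<Rightarrow> 'a. finsum M (\<lambda>i. g i \<cdot>\<^bsub>M\<^esub> f i) {..<n})"
  note [simp] = M.act_closed M.act_add_left M.act_add_right M.act_mult M.act_one
  have sc: "s f \<in> carrier M" for f unfolding s_def using g by (intro M.finsum_closed) auto
  have sadd: "s (\<lambda>i. f i + f' i) = s f \<oplus>\<^bsub>M\<^esub> s f'" for f f'
  proof -
    have "s (\<lambda>i. f i + f' i) = finsum M (\<lambda>i. g i \<cdot>\<^bsub>M\<^esub> f i \<oplus>\<^bsub>M\<^esub> g i \<cdot>\<^bsub>M\<^esub> f' i) {..<n}"
      unfolding s_def using g by (intro M.finsum_cong') auto
    also have "\<dots> = s f \<oplus>\<^bsub>M\<^esub> s f'"
      unfolding s_def using g by (intro M.finsum_addf) auto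
    finally show ?thesis .
  qed
  have act0: "m \<cdot>\<^bsub>M\<^esub> 0 = \<zero>\<^bsub>M\<^esub>" if "m \<in> carrier M" for m
    using that M.act_add_right[of m 0 0] by (simp add: M.add.r_cancel_one)
  have zero_act: "\<zero>\<^bsub>M\<^esub> \<cdot>\<^bsub>M\<^esub> a = \<zero>\<^bsub>M\<^esub>" for a
    using M.act_add_left[of "\<zero>\<^bsub>M\<^esub>" "\<zero>\<^bsub>M\<^esub>" a] by (simp add: M.add.r_cancel_one)
  have s0: "s (\<lambda>_. 0) = \<zero>\<^bsub>M\<^esub>"
    unfolding s_def using g by (intro M.add.finprod_one_eqI) (simp add: act0)
  have sact: "finsum M (\<lambda>i. g i \<cdot>\<^bsub>M\<^esub> f i) {..<k} \<cdot>\<^bsub>M\<^esub> a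
      = finsum M (\<lambda>i. g i \<cdot>\<^bsub>M\<^esub> (f i * a)) {..<k}" if "k \<le> n" for f a k
    using that
  proof (induction k)
    case 0
    then show ?case by (simp add: zero_act)
  next
    case (Suc k)
    have "finsum M (\<lambda>i. g i \<cdot>\<^bsub>M\<^esub> f i) {..<k} \<in> carrier M"
      using g Suc.prems by (intro M.finsum_closed) auto
    moreover have "(\<lambda>i. g i \<cdot>\<^bsub>M\<^esub> h i) \<in> {..<k} \<rightarrow> carrier M" for h :: "nat \<Rightarrow> 'a"
      using g Suc.prems by auto
    ultimately show ?case
      using g[of k] Suc by (simp add: lessThan_Suc M.finsum_insert)
  qed
  have "submod (range s) M"
    unfolding submod_def
  proof (intro conjI ballI allI)
    show "additive_subgroup (range s) M"
    proof (intro additive_subgroup.intro M.add.subgroupI)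
      fix u v assume "u \<in> range s" "v \<in> range s"
      then show "u \<oplus>\<^bsub>M\<^esub> v \<in> range s" using sadd by (metis (no_types, lifting) rangeE rangeI)
    next
      fix u assume "u \<in> range s"
      then obtain f where f: "u = s f" by auto
      have "s (\<lambda>i. - f i) \<oplus>\<^bsub>M\<^esub> s f = \<zero>\<^bsub>M\<^esub>"
        using sadd[of "\<lambda>i. - f i" f] s0 by simp
      then have "\<ominus>\<^bsub>M\<^esub> u = s (\<lambda>i. - f i)"
        unfolding f using sc by (intro M.minus_equality)
      then show "\<ominus>\<^bsub>M\<^esub> u \<in> range s" by simp
    qed (use sc in auto)
    fix u a assume "u \<in> range s"
    then show "u \<cdot>\<^bsub>M\<^esub> a \<in> range s" using sact[of n] unfolding s_def by auto
  qed
  moreover have "G \<subseteq> range s"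
  proof
    fix u assume "u \<in> G"
    then obtain i where i: "i < n" "u = g i" using Gg by auto
    have "s (\<lambda>l. if l = i then 1 else 0)
        = finsum M (\<lambda>l. if i = l then g l else \<zero>\<^bsub>M\<^esub>) {..<n}"
      unfolding s_def using g by (intro M.finsum_cong') (auto simp: act0)
    also have "\<dots> = g i"
      using i g by (intro M.add.finprod_singleton) auto
    finally show "u \<in> range s" using i by (metis rangeI)
  qed
  ultimately have "range s = carrier M" by (rule G(3))
  then have "inj_on (inv_into UNIV s) (carrier M)"
    by (metis inj_on_inv_into order_refl)
  then show thesis by (rule that)
qed

lemma fg_module_iso_std:
  fixes M :: "('a::ring_1, 'm) right_mod"
  assumes "fg_module M"
  obtains N :: "'a::ring_1 std_mod" and f where
    "fg_module N" "f \<in> mod_hom M N" "bij_betw f (carrier M) (carrier N)"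
proof -
  obtain j :: "'m \<Rightarrow> nat \<Rightarrow> 'a" where j: "inj_on j (carrier M)"
    using assms fin_gen_inj_std unfolding fg_module_def by blast
  obtain N :: "'a std_mod" where
    "fg_module N" "restrict j (carrier M) \<in> mod_hom M N" "carrier N = j ` carrier M"
    using assms right_module_transport[OF _ _ j] unfolding fg_module_def by blast
  moreover from this(3) have "bij_betw (restrict j (carrier M)) (carrier M) (carrier N)"
    using j by (auto simp: bij_betw_def)
  ultimately show thesis by (intro that)
qed

definition projective :: "('a::ring_1, 'm) right_mod \<Rightarrow> bool" where
  "projective P \<longleftrightarrow> fg_module P \<and>
    (\<forall>(X :: 'a std_mod) (Y :: 'a std_mod). \<forall>f \<in> mod_hom X Y. \<forall>g \<in> mod_hom P Y.
      fg_module X \<longrightarrow> fg_module Y \<longrightarrow> f ` carrier X = carrier Y \<longrightarrow>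
      (\<exists>h \<in> mod_hom P X. compose (carrier P) f h = g))"

definition injective :: "('a::ring_1, 'm) right_mod \<Rightarrow> bool" where
  "injective I \<longleftrightarrow> fg_module I \<and>
    (\<forall>(X :: 'a std_mod) (Y :: 'a std_mod). \<forall>f \<in> mod_hom X Y. \<forall>g \<in> mod_hom X I.
      fg_module X \<longrightarrow> fg_module Y \<longrightarrow> inj_on f (carrier X) \<longrightarrow>
      (\<exists>h \<in> mod_hom Y I. compose (carrier X) h f = g))"

text \<open>Exactness of \<open>\<dots> \<rightarrow> P 2 \<rightarrow> P 1 \<rightarrow> P 0 \<rightarrow> M \<rightarrow> 0\<close>, where \<open>d i : P (i+1) \<rightarrow> P i\<close> and
  \<open>\<epsilon> : P 0 \<rightarrow> M\<close>.\<close>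

definition projective_resolution ::
    "('a::ring_1, 'm) right_mod \<Rightarrow> (nat \<Rightarrow> 'a std_mod) \<Rightarrow>
     (nat \<Rightarrow> (nat \<Rightarrow> 'a) \<Rightarrow> (nat \<Rightarrow> 'a)) \<Rightarrow> ((nat \<Rightarrow> 'a) \<Rightarrow> 'm) \<Rightarrow> bool" where
  "projective_resolution M P d \<epsilon> \<longleftrightarrow>
    (\<forall>i. projective (P i)) \<and>
    (\<forall>i. d i \<in> mod_hom (P (Suc i)) (P i)) \<and> \<epsilon> \<in> mod_hom (P 0) M \<and>
    \<epsilon> ` carrier (P 0) = carrier M \<and>
    d 0 ` carrier (P (Suc 0)) = a_kernel (P 0) M \<epsilon> \<and>
    (\<forall>i. d (Suc i) ` carrier (P (Suc (Suc i))) = a_kernel (P (Suc i)) (P i) (d i))"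

text \<open>Exactness of \<open>0 \<rightarrow> M \<rightarrow> I 0 \<rightarrow> I 1 \<rightarrow> I 2 \<rightarrow> \<dots>\<close>, where \<open>\<eta> : M \<rightarrow> I 0\<close> and
  \<open>d i : I i \<rightarrow> I (i+1)\<close>.\<close>

definition injective_resolution ::
    "('a::ring_1, 'm) right_mod \<Rightarrow> (nat \<Rightarrow> 'a std_mod) \<Rightarrow>
     (nat \<Rightarrow> (nat \<Rightarrow> 'a) \<Rightarrow> (nat \<Rightarrow> 'a)) \<Rightarrow> ('m \<Rightarrow> (nat \<Rightarrow> 'a)) \<Rightarrow> bool" where
  "injective_resolution M I d \<eta> \<longleftrightarrow>
    (\<forall>i. injective (I i)) \<and>
    (\<forall>i. d i \<in> mod_hom (I i) (I (Suc i))) \<and> \<eta> \<in> mod_hom M (I 0) \<and>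
    inj_on \<eta> (carrier M) \<and>
    \<eta> ` carrier M = a_kernel (I 0) (I (Suc 0)) (d 0) \<and>
    (\<forall>i. d i ` carrier (I i) = a_kernel (I (Suc i)) (I (Suc (Suc i))) (d (Suc i)))"

definition pdim :: "('a::ring_1, 'm) right_mod \<Rightarrow> enat" where
  "pdim M = Inf {enat n | n. \<exists>P d \<epsilon>. projective_resolution M P d \<epsilon> \<and>
    (\<forall>i>n. carrier (P i) = {\<zero>\<^bsub>P i\<^esub>})}"

definition idim :: "('a::ring_1, 'm) right_mod \<Rightarrow> enat" where
  "idim M = Inf {enat n | n. \<exists>I d \<eta>. injective_resolution M I d \<eta> \<and>
    (\<forall>i>n. carrier (I i) = {\<zero>\<^bsub>I i\<^esub>})}"

text \<open>The differential \<open>Hom(P l, N) \<rightarrow> Hom(P (l+1), N)\<close> of the complex \<open>Hom(P, N)\<close>.\<close>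

definition hom_diff ::
    "(nat \<Rightarrow> ('a::ring_1, 'p) right_mod) \<Rightarrow> (nat \<Rightarrow> 'p \<Rightarrow> 'p) \<Rightarrow> nat \<Rightarrow> ('p \<Rightarrow> 'n) \<Rightarrow> ('p \<Rightarrow> 'n)" where
  "hom_diff P d l f = compose (carrier (P (Suc l))) f (d l)"

definition cocycles ::
    "(nat \<Rightarrow> ('a::ring_1, 'p) right_mod) \<Rightarrow> (nat \<Rightarrow> 'p \<Rightarrow> 'p) \<Rightarrow> ('a, 'n) right_mod \<Rightarrow> nat
     \<Rightarrow> ('p \<Rightarrow> 'n) set" where
  "cocycles P d N l = kernel (hom_group (P l) N) (hom_group (P (Suc l)) N) (hom_diff P d l)"

definition coboundaries ::
    "(nat \<Rightarrow> ('a::ring_1, 'p) right_mod) \<Rightarrow> (nat \<Rightarrow> 'p \<Rightarrow> 'p) \<Rightarrow> ('a, 'n) right_mod \<Rightarrow> nat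
     \<Rightarrow> ('p \<Rightarrow> 'n) set" where
  "coboundaries P d N l = (case l of
      0 \<Rightarrow> {\<one>\<^bsub>hom_group (P 0) N\<^esub>}
    | Suc i \<Rightarrow> hom_diff P d i ` mod_hom (P i) N)"

definition hom_cohomology ::
    "(nat \<Rightarrow> ('a::ring_1, 'p) right_mod) \<Rightarrow> (nat \<Rightarrow> 'p \<Rightarrow> 'p) \<Rightarrow> ('a, 'n) right_mod \<Rightarrow> nat
     \<Rightarrow> ('p \<Rightarrow> 'n) set monoid" where
  "hom_cohomology P d N l =
    (hom_group (P l) N)\<lparr>carrier := cocycles P d N l\<rparr> Mod coboundaries P d N l"

text \<open>\<open>Ext l M N\<close>, as an abelian group (written multiplicatively, like every \<^typ>\<open>'x monoid\<close>), is
  computed from a chosen resolution of \<open>M\<close> by finitely generated projectives; as usual, up to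
  isomorphism it does not depend on the choice.  Such a resolution exists for every finitely
  generated module if the base ring is right noetherian, in particular over an incidence algebra.\<close>

definition Ext ::
    "nat \<Rightarrow> ('a::ring_1, 'm) right_mod \<Rightarrow> ('a, 'n) right_mod \<Rightarrow> ((nat \<Rightarrow> 'a) \<Rightarrow> 'n) set monoid" where
  "Ext l M N =
    (let (P, d, \<epsilon>) = (SOME (P, d, \<epsilon>). projective_resolution M P d \<epsilon>) in hom_cohomology P d N l)"

section \<open>Grade, cograde and the simple modules of the incidence algebra\<close>

definition regular_mod :: "('a::ring_1, 'a) right_mod" where
  "regular_mod = make_mod UNIV 0 (+) (*)"

text \<open>\<open>D(A)\<close>, whose right module structure comes from the left module structure of \<open>A\<close>.\<close>

definition dual_mod :: "(('l::{finite,order}, 'k::field) incidence_algebra,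
    ('l, 'k) incidence_algebra \<Rightarrow> 'k) right_mod" where
  "dual_mod = make_mod {\<phi>. Vector_Spaces.linear ia_scale (*) \<phi>} (\<lambda>_. 0)
    (\<lambda>\<phi> \<psi> b. \<phi> b + \<psi> b) (\<lambda>\<phi> a b. \<phi> (a * b))"

definition grade :: "('a::ring_1, 'm) right_mod \<Rightarrow> enat" where
  "grade N = Inf {enat l | l. \<not> trivial_group (Ext l N regular_mod)}"

definition cograde :: "(('l::{finite,order}, 'k::field) incidence_algebra, 'm) right_mod \<Rightarrow> enat"
  where "cograde N = Inf {enat l | l. \<not> trivial_group (Ext l dual_mod N)}"

definition ia_idem :: "'l \<Rightarrow> ('l::{finite,order}, 'k::field) incidence_algebra" where
  "ia_idem x = ia_basis x x"

definition right_ideal_mod :: "'a::ring_1 \<Rightarrow> ('a, 'a) right_mod" where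
  "right_ideal_mod a = regular_mod\<lparr>carrier := range ((*) a)\<rparr>"

definition simple_mod :: "'l \<Rightarrow> (('l::{finite,order}, 'k::field) incidence_algebra,
    ('l, 'k) incidence_algebra set) right_mod" where
  "simple_mod x = top_mod (right_ideal_mod (ia_idem x))"

definition cov :: "'l::order \<Rightarrow> 'l set" where
  "cov x = {y. x < y \<and> \<not> (\<exists>z. x < z \<and> z < y)}"

definition cocov :: "'l::order \<Rightarrow> 'l set" where
  "cocov x = {y. y < x \<and> \<not> (\<exists>z. y < z \<and> z < x)}"

end

theory Submission
  imports Defs "HOL-Library.Function_Algebras"
begin

text \<open>
  Right modules over the incidence algebra are covariant representations of the poset, and the
  projective and injective modules needed are sums of constant representations on principal up-sets
  and down-sets. The intersection of the up-sets of elements \<open>t\<close> in \<open>T\<close> is the up-set of their join,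
  so the up-sets of the covers of \<open>x\<close> give a Koszul resolution of \<open>S\<^sub>x\<close> of length \<open>|cov x|\<close>: at each
  vertex it is the chain complex of a simplex, which is contractible unless it is empty. The same
  construction with the minimal elements not below \<open>w\<close> resolves the injective module of \<open>w\<close>, hence
  \<open>D(A)\<close>, and its dual gives an injective resolution of \<open>S\<^sub>x\<close> of length \<open>|cocov x|\<close>.

  Distributivity enters when Ext is computed. The sets \<open>T\<close> of covers of \<open>x\<close> whose join lies above a
  given \<open>w\<close> are closed under intersection, so the complex \<open>Hom(P, e\<^sub>w A)\<close> is contractible unless only
  \<open>T = cov x\<close> occurs, which happens for some \<open>w\<close>. In \<open>Hom(P, S\<^sub>x)\<close>, for the resolution of \<open>D(A)\<close>, only
  those \<open>T\<close> survive whose join is \<open>x\<close>; these are irredundant decompositions of \<open>x\<close> into join-primes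
  and all have \<open>|cocov x|\<close> elements. The nonzero Ext groups also bound the lengths of
  resolutions from below.
\<close>

section \<open>Homomorphisms of right modules\<close>

text \<open>\<open>Ext\<close> refers to an unspecified resolution, and \<open>pdim\<close> and
  \<open>idim\<close> are infima over resolutions on one fixed element type, whereas the Koszul
  complexes live on other types. So no Ext group is computed: only its vanishing is decided, through
  the elementary predicate \<open>hom_exact\<close>, which does not depend on the projective
  resolution. Its failure in degree n excludes shorter projective resolutions, as a zero term forces
  exactness, and shorter injective ones by dimension shifting. Hence the projective resolution of
  D(A) yields both the cograde and the lower bound for the injective dimension. Closure under
  intersection matters because the sets of covers with join above w are also closed under
  enlargement: if there are any, they are all the sets between a least one and the set of all
  covers, and any cover outside the least one is the apex of a cone. The minimal elements not below
  w occur because their up-sets fill exactly the complement of the down-set of w.\<close>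

definition mhom :: "('a::ring_1, 'm) right_mod \<Rightarrow> ('a, 'n) right_mod \<Rightarrow> ('m \<Rightarrow> 'n) \<Rightarrow> bool" where
  "mhom M N f \<longleftrightarrow> f \<in> carrier M \<rightarrow> carrier N \<and>
    (\<forall>m\<in>carrier M. \<forall>m'\<in>carrier M. f (m \<oplus>\<^bsub>M\<^esub> m') = f m \<oplus>\<^bsub>N\<^esub> f m') \<and>
    (\<forall>m\<in>carrier M. \<forall>a. f (m \<cdot>\<^bsub>M\<^esub> a) = f m \<cdot>\<^bsub>N\<^esub> a)"

lemma mhomI:
  assumes "\<And>m. m \<in> carrier M \<Longrightarrow> f m \<in> carrier N"
    and "\<And>m m'. m \<in> carrier M \<Longrightarrow> m' \<in> carrier M \<Longrightarrow> f (m \<oplus>\<^bsub>M\<^esub> m') = f m \<oplus>\<^bsub>N\<^esub> f m'"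
    and "\<And>m a. m \<in> carrier M \<Longrightarrow> f (m \<cdot>\<^bsub>M\<^esub> a) = f m \<cdot>\<^bsub>N\<^esub> a"
  shows "mhom M N f"
  using assms by (auto simp: mhom_def)

lemma mhom_closed: "mhom M N f \<Longrightarrow> m \<in> carrier M \<Longrightarrow> f m \<in> carrier N"
  and mhom_add: "mhom M N f \<Longrightarrow> m \<in> carrier M \<Longrightarrow> m' \<in> carrier M \<Longrightarrow> f (m \<oplus>\<^bsub>M\<^esub> m') = f m \<oplus>\<^bsub>N\<^esub> f m'"
  and mhom_act: "mhom M N f \<Longrightarrow> m \<in> carrier M \<Longrightarrow> f (m \<cdot>\<^bsub>M\<^esub> a) = f m \<cdot>\<^bsub>N\<^esub> a"
  by (auto simp: mhom_def)

text \<open>Extensionality is the only difference between the two notions. \<open>mhom\<close> drops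
  it so that composites, sums and differences of homomorphisms need no
  \<open>restrict\<close>.\<close>

lemma mod_hom_iff: "f \<in> mod_hom M N \<longleftrightarrow> mhom M N f \<and> f \<in> extensional (carrier M)"
  by (auto simp: mod_hom_def mhom_def PiE_iff extensional_def)

lemma mod_hom_mhom: "f \<in> mod_hom M N \<Longrightarrow> mhom M N f"
  by (simp add: mod_hom_iff)

lemma mhom_cong:
  assumes "right_module M" "mhom M N f" "\<And>m. m \<in> carrier M \<Longrightarrow> f m = g m"
  shows "mhom M N g"
proof -
  interpret M: right_module M by fact
  have eq: "g m = f m" if "m \<in> carrier M" for m using assms(3)[OF that] by simp
  show ?thesis using assms(2) by (auto simp: mhom_def M.act_closed eq)
qed

lemma restrict_mod_hom:
  assumes "right_module M" "mhom M N f"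
  shows "restrict f (carrier M) \<in> mod_hom M N"
  using assms mhom_cong[OF assms, of "restrict f (carrier M)"] by (simp add: mod_hom_iff)

lemma mhom_comp: "mhom M N f \<Longrightarrow> mhom N L g \<Longrightarrow> mhom M L (\<lambda>m. g (f m))"
  by (auto simp: mhom_def Pi_iff)

lemma mhom_id: "mhom M M (\<lambda>m. m)"
  by (auto simp: mhom_def)

context right_module
begin

lemma act_zero_right: "m \<in> carrier M \<Longrightarrow> m \<cdot> 0 = \<zero>"
  using act_add_right[of m 0 0] act_closed[of m 0] by (simp add: add.r_cancel_one)

lemma act_zero_left: "\<zero> \<cdot> a = \<zero>"
  using act_add_left[of \<zero> \<zero> a] act_closed[of \<zero> a] by (simp add: add.r_cancel_one)

text \<open>Since negation is the action of a ring element, closure under the action gives closure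
  under negation (\<open>submodI\<close>), and homomorphisms respect differences
  (\<open>mhom_minus\<close>).\<close>

lemma act_minus_one:
  assumes "m \<in> carrier M"
  shows "m \<cdot> (-1) = \<ominus> m"
proof -
  have "m \<cdot> (-1) \<oplus> m = \<zero>"
    using assms act_add_right[of m "-1" 1] by (simp add: act_one act_zero_right)
  then show ?thesis using assms act_closed by (metis minus_equality)
qed

lemma act_neg: "m \<in> carrier M \<Longrightarrow> (\<ominus> m) \<cdot> a = \<ominus> (m \<cdot> a)"
  by (metis act_closed act_minus_one act_mult mult_minus1 mult_minus1_right)

lemma minus_eq_zero_iff: "m \<in> carrier M \<Longrightarrow> n \<in> carrier M \<Longrightarrow> m \<ominus> n = \<zero> \<longleftrightarrow> m = n"
  by (metis add.inv_solve_right' l_zero minus_eq zero_closed)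

lemma minus_act: "m \<in> carrier M \<Longrightarrow> n \<in> carrier M \<Longrightarrow> (m \<ominus> n) \<cdot> a = m \<cdot> a \<ominus> n \<cdot> a"
  by (simp add: minus_eq act_add_left act_neg)

lemma finsum_act:
  assumes "finite I" "f \<in> I \<rightarrow> carrier M"
  shows "finsum M f I \<cdot> a = finsum M (\<lambda>i. f i \<cdot> a) I"
  using assms
proof (induction I rule: finite_induct)
  case empty
  then show ?case by (simp add: act_zero_left)
next
  case (insert i I)
  have 1: "f \<in> I \<rightarrow> carrier M" "f i \<in> carrier M" "(\<lambda>i. f i \<cdot> a) \<in> I \<rightarrow> carrier M"
    using insert.prems act_closed by auto
  then show ?case
    using insert act_closed[OF 1(2)] finsum_closed[OF 1(1)]
    by (simp add: act_add_left)
qed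

end

lemma mhom_zero:
  assumes "right_module M" "right_module N" "mhom M N f"
  shows "f \<zero>\<^bsub>M\<^esub> = \<zero>\<^bsub>N\<^esub>"
proof -
  interpret M: right_module M by fact
  interpret N: right_module N by fact
  have "f \<zero>\<^bsub>M\<^esub> \<oplus>\<^bsub>N\<^esub> f \<zero>\<^bsub>M\<^esub> = f \<zero>\<^bsub>M\<^esub>"
    using mhom_add[OF assms(3), of "\<zero>\<^bsub>M\<^esub>" "\<zero>\<^bsub>M\<^esub>"] by simp
  then show ?thesis using mhom_closed[OF assms(3), of "\<zero>\<^bsub>M\<^esub>"] by (simp add: N.add.r_cancel_one)
qed

lemma mhom_minus:
  assumes "right_module M" "right_module N" "mhom M N f" "m \<in> carrier M" "m' \<in> carrier M"
  shows "f (m \<ominus>\<^bsub>M\<^esub> m') = f m \<ominus>\<^bsub>N\<^esub> f m'"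
proof -
  interpret M: right_module M by fact
  interpret N: right_module N by fact
  have "f (m \<oplus>\<^bsub>M\<^esub> m' \<cdot>\<^bsub>M\<^esub> (-1)) = f m \<oplus>\<^bsub>N\<^esub> f m' \<cdot>\<^bsub>N\<^esub> (-1)"
    using assms(4,5) by (simp add: mhom_add[OF assms(3)] mhom_act[OF assms(3)] M.act_closed)
  then show ?thesis
    using assms(4,5) mhom_closed[OF assms(3)]
    by (simp add: M.minus_eq N.minus_eq M.act_minus_one N.act_minus_one)
qed

lemma mhom_finsum:
  assumes "right_module M" "right_module N" "mhom M N f" "finite I" "g \<in> I \<rightarrow> carrier M"
  shows "f (finsum M g I) = finsum N (\<lambda>i. f (g i)) I"
proof -
  interpret M: right_module M by fact
  interpret N: right_module N by fact
  show ?thesis using assms(4,5)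
  proof (induction I rule: finite_induct)
    case empty
    then show ?case by (simp add: mhom_zero[OF assms(1-3)])
  next
    case (insert i I)
    then have "(\<lambda>i. f (g i)) \<in> I \<rightarrow> carrier N" "f (g i) \<in> carrier N" "g \<in> I \<rightarrow> carrier M" "g i \<in> carrier M"
      using mhom_closed[OF assms(3)] by auto
    then show ?case using insert mhom_add[OF assms(3)] by simp
  qed
qed

lemma mhom_sub:
  assumes "right_module M" "right_module N" "mhom M N f" "mhom M N g"
  shows "mhom M N (\<lambda>m. f m \<ominus>\<^bsub>N\<^esub> g m)"
proof -
  interpret N: right_module N by fact
  show ?thesis
  proof (rule mhomI)
    fix m m' assume "m \<in> carrier M" "m' \<in> carrier M"
    then show "f (m \<oplus>\<^bsub>M\<^esub> m') \<ominus>\<^bsub>N\<^esub> g (m \<oplus>\<^bsub>M\<^esub> m') =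
           f m \<ominus>\<^bsub>N\<^esub> g m \<oplus>\<^bsub>N\<^esub> (f m' \<ominus>\<^bsub>N\<^esub> g m')"
      using assms(3,4) by (simp add: N.minus_eq mhom_add mhom_closed N.a_ac N.minus_add)
  qed (use assms(3,4) in \<open>auto simp: mhom_closed mhom_act N.minus_act\<close>)
qed

section \<open>Submodules and images of homomorphisms\<close>

lemma submodI:
  assumes "right_module M" "N \<subseteq> carrier M" "\<zero>\<^bsub>M\<^esub> \<in> N"
    and "\<And>m n. m \<in> N \<Longrightarrow> n \<in> N \<Longrightarrow> m \<oplus>\<^bsub>M\<^esub> n \<in> N" and "\<And>m a. m \<in> N \<Longrightarrow> m \<cdot>\<^bsub>M\<^esub> a \<in> N"
  shows "submod N M"
proof -
  interpret M: right_module M by fact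
  have "subgroup N (add_monoid M)"
  proof (rule M.add.subgroupI)
    fix m assume "m \<in> N"
    then show "\<ominus>\<^bsub>M\<^esub> m \<in> N" using assms(2,5) M.act_minus_one by (metis subsetD)
  qed (use assms in auto)
  then show ?thesis using assms(5) by (simp add: submod_def additive_subgroup.intro)
qed

lemma submodD:
  assumes "submod N M"
  shows "N \<subseteq> carrier M" "\<zero>\<^bsub>M\<^esub> \<in> N" "m \<in> N \<Longrightarrow> n \<in> N \<Longrightarrow> m \<oplus>\<^bsub>M\<^esub> n \<in> N" "m \<in> N \<Longrightarrow> m \<cdot>\<^bsub>M\<^esub> a \<in> N"
proof -
  interpret additive_subgroup N M using assms by (simp add: submod_def)
  show "N \<subseteq> carrier M" "\<zero>\<^bsub>M\<^esub> \<in> N" "m \<in> N \<Longrightarrow> n \<in> N \<Longrightarrow> m \<oplus>\<^bsub>M\<^esub> n \<in> N" "m \<in> N \<Longrightarrow> m \<cdot>\<^bsub>M\<^esub> a \<in> N"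
    using a_subset assms by (auto simp: submod_def)
qed

abbreviation sub_mod :: "('a::ring_1, 'm) right_mod \<Rightarrow> 'm set \<Rightarrow> ('a, 'm) right_mod" where
  "sub_mod M N \<equiv> M\<lparr>carrier := N\<rparr>"

lemma right_module_sub:
  assumes "right_module M" "submod N M"
  shows "right_module (sub_mod M N)"
proof -
  interpret M: right_module M by fact
  note N = submodD[OF assms(2)]
  interpret N: abelian_group "sub_mod M N"
  proof (rule abelian_groupI)
    fix m assume m: "m \<in> carrier (sub_mod M N)"
    then have "m \<in> carrier M" "m \<cdot>\<^bsub>M\<^esub> (-1) \<in> N" using N by auto
    then show "\<exists>n\<in>carrier (sub_mod M N). n \<oplus>\<^bsub>sub_mod M N\<^esub> m = \<zero>\<^bsub>sub_mod M N\<^esub>"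
      by (intro bexI[of _ "m \<cdot>\<^bsub>M\<^esub> (-1)"]) (auto simp: M.act_minus_one M.l_neg)
  qed (use N in \<open>auto simp: M.a_ac subset_iff\<close>)
  show ?thesis
    using N by unfold_locales (auto simp: M.act_add_left M.act_add_right M.act_mult M.act_one subset_iff)
qed

lemma submod_image:
  assumes "right_module M" "right_module N" "mhom M N f"
  shows "submod (f ` carrier M) N"
proof -
  interpret M: right_module M by fact
  interpret N: right_module N by fact
  show ?thesis
  proof (rule submodI)
    show "\<zero>\<^bsub>N\<^esub> \<in> f ` carrier M" using mhom_zero[OF assms] by (metis M.zero_closed image_eqI)
  next
    fix m n assume "m \<in> f ` carrier M" "n \<in> f ` carrier M"
    then obtain m' n' where "m' \<in> carrier M" "m = f m'" "n' \<in> carrier M" "n = f n'" by blast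
    then show "m \<oplus>\<^bsub>N\<^esub> n \<in> f ` carrier M"
      by (intro image_eqI[of _ _ "m' \<oplus>\<^bsub>M\<^esub> n'"]) (simp_all add: mhom_add[OF assms(3)])
  next
    fix m a assume "m \<in> f ` carrier M"
    then obtain m' where "m' \<in> carrier M" "m = f m'" by blast
    then show "m \<cdot>\<^bsub>N\<^esub> a \<in> f ` carrier M"
      by (intro image_eqI[of _ _ "m' \<cdot>\<^bsub>M\<^esub> a"]) (simp_all add: mhom_act[OF assms(3)] M.act_closed)
  qed (use assms mhom_closed in auto)
qed

text \<open>A submodule of the image containing the images of the generators pulls back to a
  submodule containing the generators. Needed because lifting and extension problems are posed over
  the image of \<open>f\<close>, not over its codomain.\<close>

lemma fg_module_image:
  assumes "fg_module M" "right_module N" "mhom M N f"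
  shows "fg_module (sub_mod N (f ` carrier M))"
proof -
  have M: "right_module M" using assms by (simp add: fg_module_def)
  interpret M: right_module M by fact
  interpret N: right_module N by fact
  let ?I = "sub_mod N (f ` carrier M)"
  obtain G where G: "G \<subseteq> carrier M" "finite G" "\<And>H. submod H M \<Longrightarrow> G \<subseteq> H \<Longrightarrow> H = carrier M"
    using assms unfolding fin_gen_def fg_module_def by blast
  have "H = carrier ?I" if H: "submod H ?I" "f ` G \<subseteq> H" for H
  proof -
    note H' = submodD[OF H(1)]
    have "submod {m \<in> carrier M. f m \<in> H} M"
    proof (rule submodI)
      show "\<zero>\<^bsub>M\<^esub> \<in> {m \<in> carrier M. f m \<in> H}" using H'(2) mhom_zero[OF M assms(2,3)] by simp
    qed (use M H'(3,4) assms(3) in \<open>auto simp: mhom_add mhom_act M.act_closed\<close>)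
    then have "{m \<in> carrier M. f m \<in> H} = carrier M" using G H(2) by blast
    then show ?thesis using H'(1) by auto
  qed
  then have "fin_gen ?I" unfolding fin_gen_def using G by (intro exI[of _ "f ` G"]) auto
  then show ?thesis using right_module_sub[OF assms(2) submod_image[OF M assms(2,3)]]
    by (simp add: fg_module_def)
qed

lemma mhom_inv_into:
  assumes "right_module M" "mhom M N f" "bij_betw f (carrier M) (carrier N)"
  shows "mhom N M (inv_into (carrier M) f)"
proof -
  interpret M: right_module M by fact
  let ?g = "inv_into (carrier M) f"
  have im: "f ` carrier M = carrier N" and inj: "inj_on f (carrier M)"
    using assms(3) by (auto simp: bij_betw_def)
  have g: "?g n \<in> carrier M" "f (?g n) = n" if "n \<in> carrier N" for n
    using that im by (auto intro: inv_into_into f_inv_into_f)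
  have eq: "?g n = m" if "m \<in> carrier M" "f m = n" for m n
    using that inj by (auto intro: inv_into_f_f)
  show ?thesis
  proof (rule mhomI)
    fix n n' assume "n \<in> carrier N" "n' \<in> carrier N"
    then show "?g (n \<oplus>\<^bsub>N\<^esub> n') = ?g n \<oplus>\<^bsub>M\<^esub> ?g n'"
      by (intro eq) (simp_all add: g mhom_add[OF assms(2)])
  next
    fix n a assume "n \<in> carrier N"
    then show "?g (n \<cdot>\<^bsub>N\<^esub> a) = ?g n \<cdot>\<^bsub>M\<^esub> a"
      by (intro eq) (simp_all add: g mhom_act[OF assms(2)] M.act_closed)
  qed (rule g)
qed

section \<open>Isomorphisms; lifting and extension for modules on arbitrary element types\<close>

lemma fg_moduleD: "fg_module M \<Longrightarrow> right_module M" "fg_module M \<Longrightarrow> fin_gen M"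
  by (auto simp: fg_module_def)

text \<open>Both directions are kept as data, so that inverting is symmetric and transported maps
  can be written down without \<open>inv_into\<close>.\<close>

definition mod_iso :: "('a::ring_1, 'm) right_mod \<Rightarrow> ('a, 'n) right_mod \<Rightarrow> ('m \<Rightarrow> 'n) \<Rightarrow> ('n \<Rightarrow> 'm) \<Rightarrow> bool" where
  "mod_iso M N f g \<longleftrightarrow> mhom M N f \<and> mhom N M g \<and>
    (\<forall>m\<in>carrier M. g (f m) = m) \<and> (\<forall>n\<in>carrier N. f (g n) = n)"

lemma mod_isoD:
  assumes "mod_iso M N f g"
  shows "mhom M N f" "mhom N M g" "m \<in> carrier M \<Longrightarrow> g (f m) = m" "n \<in> carrier N \<Longrightarrow> f (g n) = n"
  using assms by (auto simp: mod_iso_def)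

lemma mod_iso_sym: "mod_iso M N f g \<Longrightarrow> mod_iso N M g f"
  by (auto simp: mod_iso_def)

lemma mod_isoI_bij:
  assumes "right_module M" "mhom M N f" "bij_betw f (carrier M) (carrier N)"
  shows "mod_iso M N f (inv_into (carrier M) f)"
  using assms mhom_inv_into[OF assms] by (auto simp: mod_iso_def bij_betw_def f_inv_into_f)

lemma mod_iso_std:
  fixes M :: "('a::ring_1, 'm) right_mod"
  assumes "fg_module M"
  obtains N :: "'a std_mod" and f g where "fg_module N" "mod_iso M N f g"
  using fg_module_iso_std[OF assms] mod_isoI_bij[OF fg_moduleD(1)[OF assms]] mod_hom_mhom
  by metis

text \<open>The definition of \<open>projective\<close> tests only surjections between modules on
  the standard type. Here \<open>Y\<close> is replaced by the image of \<open>f\<close>, which is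
  finitely generated even if \<open>Y\<close> is not known to be, and the surjection onto it is
  moved to the standard type by isomorphisms. In this form it applies directly to differentials of
  exact sequences.\<close>

lemma projective_lift:
  fixes P :: "('a::ring_1, 'p) right_mod" and X :: "('a, 'x) right_mod" and Y :: "('a, 'y) right_mod"
  assumes "projective P" "fg_module X" "right_module Y" "mhom X Y f" "mhom P Y g"
    and "g ` carrier P \<subseteq> f ` carrier X"
  obtains h where "mhom P X h" "\<And>p. p \<in> carrier P \<Longrightarrow> f (h p) = g p"
proof -
  let ?Z = "sub_mod Y (f ` carrier X)"
  have P: "right_module P" using assms(1) by (simp add: projective_def fg_module_def)
  have X: "right_module X" using assms(2) by (simp add: fg_module_def)
  interpret P: right_module P by fact
  interpret X: right_module X by fact
  obtain X' :: "'a std_mod" and i i' where X': "fg_module X'" "mod_iso X X' i i'"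
    using mod_iso_std[OF assms(2)] .
  obtain Z' :: "'a std_mod" and j j' where Z': "fg_module Z'" "mod_iso ?Z Z' j j'"
    using mod_iso_std[OF fg_module_image[OF assms(2-4)]] .
  note i = mod_isoD[OF X'(2)] and j = mod_isoD[OF Z'(2)]
  have X'r: "right_module X'" using X'(1) by (simp add: fg_module_def)
  have f': "mhom X ?Z f" and g': "mhom P ?Z g"
    using assms(4,5,6) by (auto simp: mhom_def)
  let ?f = "restrict (\<lambda>x. j (f (i' x))) (carrier X')" and ?g = "restrict (\<lambda>p. j (g p)) (carrier P)"
  have "?f \<in> mod_hom X' Z'" "?g \<in> mod_hom P Z'"
    by (intro restrict_mod_hom X'r P mhom_comp[OF i(2) mhom_comp[OF f' j(1)]] mhom_comp[OF g' j(1)])+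
  moreover have "?f ` carrier X' = carrier Z'"
  proof (intro equalityI subsetI)
    fix z assume z: "z \<in> carrier Z'"
    then obtain x where x: "x \<in> carrier X" "f x = j' z" using mhom_closed[OF j(2) z] by auto
    then have "?f (i x) = z" using i j z by (simp add: mhom_closed[OF i(1)])
    then show "z \<in> ?f ` carrier X'" using x mhom_closed[OF i(1)] by blast
  qed (use mhom_closed[OF \<open>?f \<in> mod_hom X' Z'\<close>[THEN mod_hom_mhom]] in auto)
  ultimately obtain h where h: "h \<in> mod_hom P X'" "compose (carrier P) ?f h = ?g"
    using assms(1) X'(1) Z'(1) unfolding projective_def by blast
  have hm: "mhom P X' h" using h(1) by (rule mod_hom_mhom)
  show thesis
  proof
    show "mhom P X (\<lambda>p. i' (h p))" by (rule mhom_comp[OF hm i(2)])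
    fix p assume p: "p \<in> carrier P"
    then have "j (f (i' (h p))) = j (g p)"
      using fun_cong[OF h(2), of p] mhom_closed[OF hm p] by (simp add: compose_def)
    moreover have "f (i' (h p)) \<in> carrier ?Z" "g p \<in> carrier ?Z"
      using mhom_closed[OF f'] mhom_closed[OF g' p] mhom_closed[OF i(2) mhom_closed[OF hm p]] by auto
    ultimately show "f (i' (h p)) = g p" using j(3) by metis
  qed
qed

text \<open>\<open>f\<close> need not be injective: the kernel condition makes \<open>g\<close>
  factor through the image of \<open>f\<close>, whose inclusion into \<open>Y\<close> is then moved
  to the standard type.\<close>

lemma injective_extend:
  fixes I :: "('a::ring_1, 'p) right_mod" and X :: "('a, 'x) right_mod" and Y :: "('a, 'y) right_mod"
  assumes "injective I" "fg_module X" "fg_module Y" "mhom X Y f" "mhom X I g"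
    and ker: "\<And>x. x \<in> carrier X \<Longrightarrow> f x = \<zero>\<^bsub>Y\<^esub> \<Longrightarrow> g x = \<zero>\<^bsub>I\<^esub>"
  obtains h where "mhom Y I h" "\<And>x. x \<in> carrier X \<Longrightarrow> h (f x) = g x"
proof -
  let ?Z = "sub_mod Y (f ` carrier X)"
  have I: "right_module I" and X: "right_module X" and Y: "right_module Y"
    using assms(1-3) by (simp_all add: injective_def fg_module_def)
  interpret I: right_module I by fact
  interpret X: right_module X by fact
  interpret Y: right_module Y by fact
  have eq: "g x = g x'" if "x \<in> carrier X" "x' \<in> carrier X" "f x = f x'" for x x'
  proof -
    have "f (x \<ominus>\<^bsub>X\<^esub> x') = \<zero>\<^bsub>Y\<^esub>"
      using that by (simp add: mhom_minus[OF X Y assms(4)] Y.minus_eq_zero_iff mhom_closed[OF assms(4)])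
    then have "g (x \<ominus>\<^bsub>X\<^esub> x') = \<zero>\<^bsub>I\<^esub>" using that by (intro ker) auto
    then show ?thesis
      using that by (simp add: mhom_minus[OF X I assms(5)] I.minus_eq_zero_iff mhom_closed[OF assms(5)])
  qed
  \<comment> \<open>A set-theoretic section only; by \<open>eq\<close> the value
    \<open>g (s z)\<close> does not depend on the chosen preimage, which makes it additive and
    compatible with the action.\<close>
  define s where "s = inv_into (carrier X) f"
  have s: "s z \<in> carrier X" "f (s z) = z" if "z \<in> carrier ?Z" for z
    using that by (auto simp: s_def intro: inv_into_into f_inv_into_f)
  have gs: "g (s (f x)) = g x" if "x \<in> carrier X" for x
    using that by (intro eq s) auto
  have g': "mhom ?Z I (\<lambda>z. g (s z))"
  proof (rule mhomI)
    fix z z' assume z: "z \<in> carrier ?Z" "z' \<in> carrier ?Z"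
    then have "z \<oplus>\<^bsub>?Z\<^esub> z' = f (s z \<oplus>\<^bsub>X\<^esub> s z')" using s by (simp add: mhom_add[OF assms(4)])
    then show "g (s (z \<oplus>\<^bsub>?Z\<^esub> z')) = g (s z) \<oplus>\<^bsub>I\<^esub> g (s z')"
      using gs[of "s z \<oplus>\<^bsub>X\<^esub> s z'"] s z by (simp add: mhom_add[OF assms(5)])
  next
    fix z a assume z: "z \<in> carrier ?Z"
    then have "z \<cdot>\<^bsub>?Z\<^esub> a = f (s z \<cdot>\<^bsub>X\<^esub> a)" using s by (simp add: mhom_act[OF assms(4)])
    then show "g (s (z \<cdot>\<^bsub>?Z\<^esub> a)) = g (s z) \<cdot>\<^bsub>I\<^esub> a"
      using gs[of "s z \<cdot>\<^bsub>X\<^esub> a"] s z by (simp add: mhom_act[OF assms(5)] X.act_closed)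
  qed (use s mhom_closed[OF assms(5)] in auto)
  obtain Z' :: "'a std_mod" and j j' where Z': "fg_module Z'" "mod_iso ?Z Z' j j'"
    using mod_iso_std[OF fg_module_image[OF assms(2) Y assms(4)]] .
  obtain Y' :: "'a std_mod" and i i' where Y': "fg_module Y'" "mod_iso Y Y' i i'"
    using mod_iso_std[OF assms(3)] .
  note i = mod_isoD[OF Y'(2)] and j = mod_isoD[OF Z'(2)]
  have Z'r: "right_module Z'" using Z'(1) by (simp add: fg_module_def)
  have inc: "mhom ?Z Y (\<lambda>z. z)"
    using mhom_closed[OF assms(4)] by (auto simp: mhom_def)
  let ?f = "restrict (\<lambda>z. i (j' z)) (carrier Z')" and ?g = "restrict (\<lambda>z. g (s (j' z))) (carrier Z')"
  have "?f \<in> mod_hom Z' Y'" "?g \<in> mod_hom Z' I"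
    using mhom_comp[OF mhom_comp[OF j(2) inc] i(1)] mhom_comp[OF j(2) g']
    by (auto intro!: restrict_mod_hom Z'r)
  moreover have "inj_on ?f (carrier Z')"
  proof (rule inj_on_inverseI)
    fix z assume z: "z \<in> carrier Z'"
    show "j (i' (?f z)) = z"
      using z j(4) mhom_closed[OF inc mhom_closed[OF j(2) z]] i(3) by simp
  qed
  ultimately obtain h where h: "h \<in> mod_hom Y' I" "compose (carrier Z') h ?f = ?g"
    using assms(1) Z'(1) Y'(1) unfolding injective_def by blast
  have hm: "mhom Y' I h" using h(1) by (rule mod_hom_mhom)
  show thesis
  proof
    show "mhom Y I (\<lambda>y. h (i y))" by (rule mhom_comp[OF i(1) hm])
    fix x assume x: "x \<in> carrier X"
    then have jc: "j (f x) \<in> carrier Z'" "j' (j (f x)) = f x"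
      using mhom_closed[OF j(1), of "f x"] j(3) by auto
    show "h (i (f x)) = g x"
      using fun_cong[OF h(2), of "j (f x)"] jc gs[OF x] by (simp add: compose_def)
  qed
qed

lemma mhom_plus:
  assumes "right_module N" "mhom M N f" "mhom M N g"
  shows "mhom M N (\<lambda>m. f m \<oplus>\<^bsub>N\<^esub> g m)"
proof -
  interpret N: right_module N by fact
  show ?thesis
    by (rule mhomI) (simp_all add: mhom_closed[OF assms(2)] mhom_closed[OF assms(3)] N.a_ac N.act_add_left
      mhom_add[OF assms(2)] mhom_add[OF assms(3)] mhom_act[OF assms(2)] mhom_act[OF assms(3)])
qed

lemma mhom_const_zero:
  assumes "right_module N"
  shows "mhom M N (\<lambda>_. \<zero>\<^bsub>N\<^esub>)"
proof -
  interpret N: right_module N by fact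
  show ?thesis by (rule mhomI) (simp_all add: N.act_zero_left)
qed

lemma mhom_sub_mod_iff:
  assumes "S \<subseteq> carrier N"
  shows "mhom M (sub_mod N S) f \<longleftrightarrow> mhom M N f \<and> f ` carrier M \<subseteq> S"
  using assms by (simp add: mhom_def Pi_iff image_subset_iff) blast

section \<open>Resolutions\<close>

text \<open>Unlike \<^const>\<open>projective_resolution\<close>, the terms may have elements of any type, and
  homomorphisms are not required to be extensional.\<close>

definition proj_res :: "('a::ring_1, 'm) right_mod \<Rightarrow> (nat \<Rightarrow> ('a, 'p) right_mod) \<Rightarrow>
    (nat \<Rightarrow> 'p \<Rightarrow> 'p) \<Rightarrow> ('p \<Rightarrow> 'm) \<Rightarrow> bool" where
  "proj_res M P d e \<longleftrightarrow> right_module M \<and> (\<forall>i. projective (P i)) \<and>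
    (\<forall>i. mhom (P (Suc i)) (P i) (d i)) \<and> mhom (P 0) M e \<and>
    e ` carrier (P 0) = carrier M \<and>
    d 0 ` carrier (P (Suc 0)) = {p \<in> carrier (P 0). e p = \<zero>\<^bsub>M\<^esub>} \<and>
    (\<forall>i. d (Suc i) ` carrier (P (Suc (Suc i))) = {p \<in> carrier (P (Suc i)). d i p = \<zero>\<^bsub>P i\<^esub>})"

definition inj_res :: "('a::ring_1, 'm) right_mod \<Rightarrow> (nat \<Rightarrow> ('a, 'p) right_mod) \<Rightarrow>
    (nat \<Rightarrow> 'p \<Rightarrow> 'p) \<Rightarrow> ('m \<Rightarrow> 'p) \<Rightarrow> bool" where
  "inj_res M I d e \<longleftrightarrow> right_module M \<and> (\<forall>i. injective (I i)) \<and>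
    (\<forall>i. mhom (I i) (I (Suc i)) (d i)) \<and> mhom M (I 0) e \<and>
    inj_on e (carrier M) \<and>
    e ` carrier M = {p \<in> carrier (I 0). d 0 p = \<zero>\<^bsub>I (Suc 0)\<^esub>} \<and>
    (\<forall>i. d i ` carrier (I i) = {p \<in> carrier (I (Suc i)). d (Suc i) p = \<zero>\<^bsub>I (Suc (Suc i))\<^esub>})"

lemma projective_resolution_proj_res:
  "right_module M \<Longrightarrow> projective_resolution M P d e \<Longrightarrow> proj_res M P d e"
  by (auto simp: projective_resolution_def proj_res_def mod_hom_mhom a_kernel_def kernel_def)

lemma injective_resolution_inj_res:
  "right_module M \<Longrightarrow> injective_resolution M I d e \<Longrightarrow> inj_res M I d e"
  by (auto simp: injective_resolution_def inj_res_def mod_hom_mhom a_kernel_def kernel_def)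

lemma projectiveD: "projective P \<Longrightarrow> fg_module P" "projective P \<Longrightarrow> right_module P"
  by (auto simp: projective_def fg_module_def)

lemma injectiveD: "injective P \<Longrightarrow> fg_module P" "injective P \<Longrightarrow> right_module P"
  by (auto simp: injective_def fg_module_def)

lemma proj_resD:
  assumes "proj_res M P d e"
  shows "right_module M" "projective (P i)" "right_module (P i)" "fg_module (P i)"
    "mhom (P (Suc i)) (P i) (d i)" "mhom (P 0) M e"
    "m \<in> carrier M \<Longrightarrow> m \<in> e ` carrier (P 0)"
    "p \<in> carrier (P 0) \<Longrightarrow> e p = \<zero>\<^bsub>M\<^esub> \<longleftrightarrow> p \<in> d 0 ` carrier (P (Suc 0))"
    "q \<in> carrier (P (Suc i)) \<Longrightarrow> d i q = \<zero>\<^bsub>P i\<^esub> \<longleftrightarrow> q \<in> d (Suc i) ` carrier (P (Suc (Suc i)))"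
    "q \<in> carrier (P (Suc (Suc i))) \<Longrightarrow> d i (d (Suc i) q) = \<zero>\<^bsub>P i\<^esub>"
proof -
  show "right_module M" "projective (P i)" "mhom (P (Suc i)) (P i) (d i)" "mhom (P 0) M e"
    using assms by (simp_all add: proj_res_def)
  then show "right_module (P i)" "fg_module (P i)" by (simp_all add: projectiveD)
  have e: "e ` carrier (P 0) = carrier M" "d 0 ` carrier (P (Suc 0)) = {p \<in> carrier (P 0). e p = \<zero>\<^bsub>M\<^esub>}"
    "\<And>i. d (Suc i) ` carrier (P (Suc (Suc i))) = {p \<in> carrier (P (Suc i)). d i p = \<zero>\<^bsub>P i\<^esub>}"
    using assms by (simp_all add: proj_res_def)
  show "m \<in> carrier M \<Longrightarrow> m \<in> e ` carrier (P 0)" using e(1) by simp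
  show "p \<in> carrier (P 0) \<Longrightarrow> e p = \<zero>\<^bsub>M\<^esub> \<longleftrightarrow> p \<in> d 0 ` carrier (P (Suc 0))" by (simp add: e(2))
  show "q \<in> carrier (P (Suc i)) \<Longrightarrow> d i q = \<zero>\<^bsub>P i\<^esub> \<longleftrightarrow> q \<in> d (Suc i) ` carrier (P (Suc (Suc i)))"
    by (simp add: e(3))
  show "d i (d (Suc i) q) = \<zero>\<^bsub>P i\<^esub>" if "q \<in> carrier (P (Suc (Suc i)))"
    using imageI[OF that, of "d (Suc i)"] unfolding e(3) by simp
qed

lemma inj_resD:
  assumes "inj_res M I d e"
  shows "right_module M" "injective (I i)" "right_module (I i)" "fg_module (I i)"
    "mhom (I i) (I (Suc i)) (d i)" "mhom M (I 0) e" "inj_on e (carrier M)"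
    "p \<in> carrier (I 0) \<Longrightarrow> d 0 p = \<zero>\<^bsub>I (Suc 0)\<^esub> \<longleftrightarrow> p \<in> e ` carrier M"
    "q \<in> carrier (I (Suc i)) \<Longrightarrow> d (Suc i) q = \<zero>\<^bsub>I (Suc (Suc i))\<^esub> \<longleftrightarrow> q \<in> d i ` carrier (I i)"
    "q \<in> carrier (I i) \<Longrightarrow> d (Suc i) (d i q) = \<zero>\<^bsub>I (Suc (Suc i))\<^esub>"
    "m \<in> carrier M \<Longrightarrow> d 0 (e m) = \<zero>\<^bsub>I (Suc 0)\<^esub>"
proof -
  show "right_module M" "injective (I i)" "mhom (I i) (I (Suc i)) (d i)" "mhom M (I 0) e" "inj_on e (carrier M)"
    using assms by (simp_all add: inj_res_def)
  then show "right_module (I i)" "fg_module (I i)" by (simp_all add: injectiveD)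
  have e: "e ` carrier M = {p \<in> carrier (I 0). d 0 p = \<zero>\<^bsub>I (Suc 0)\<^esub>}"
    "\<And>i. d i ` carrier (I i) = {p \<in> carrier (I (Suc i)). d (Suc i) p = \<zero>\<^bsub>I (Suc (Suc i))\<^esub>}"
    using assms by (simp_all add: inj_res_def)
  show "p \<in> carrier (I 0) \<Longrightarrow> d 0 p = \<zero>\<^bsub>I (Suc 0)\<^esub> \<longleftrightarrow> p \<in> e ` carrier M" by (simp add: e(1))
  show "q \<in> carrier (I (Suc i)) \<Longrightarrow> d (Suc i) q = \<zero>\<^bsub>I (Suc (Suc i))\<^esub> \<longleftrightarrow> q \<in> d i ` carrier (I i)"
    by (simp add: e(2))
  show "d (Suc i) (d i q) = \<zero>\<^bsub>I (Suc (Suc i))\<^esub>" if "q \<in> carrier (I i)"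
    using imageI[OF that, of "d i"] unfolding e(2) by simp
  show "d 0 (e m) = \<zero>\<^bsub>I (Suc 0)\<^esub>" if "m \<in> carrier M"
    using imageI[OF that, of e] unfolding e(1) by simp
qed

subsection \<open>Vanishing of Ext\<close>

text \<open>Vanishing of the degree \<open>l\<close> cohomology of Hom(P, N), said with elements:
  every cocycle is a coboundary, where in degree 0 only the zero map counts as one. Values outside
  the carriers are irrelevant, so no quotient group and no extensional function appears.\<close>

definition hom_exact :: "(nat \<Rightarrow> ('a::ring_1, 'p) right_mod) \<Rightarrow> (nat \<Rightarrow> 'p \<Rightarrow> 'p) \<Rightarrow>
    ('a, 'n) right_mod \<Rightarrow> nat \<Rightarrow> bool" where
  "hom_exact P d N l \<longleftrightarrow> (\<forall>f. mhom (P l) N f \<and> (\<forall>p\<in>carrier (P (Suc l)). f (d l p) = \<zero>\<^bsub>N\<^esub>) \<longrightarrow>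
    (case l of 0 \<Rightarrow> \<forall>p\<in>carrier (P 0). f p = \<zero>\<^bsub>N\<^esub>
     | Suc i \<Rightarrow> \<exists>g. mhom (P i) N g \<and> (\<forall>p\<in>carrier (P (Suc i)). f p = g (d i p))))"

lemma comm_group_hom_group:
  assumes "right_module M" "right_module N"
  shows "comm_group (hom_group M N)"
proof -
  interpret M: right_module M by fact
  interpret N: right_module N by fact
  have res: "restrict f (carrier M) \<in> mod_hom M N" if "mhom M N f" for f
    using restrict_mod_hom[OF assms(1) that] .
  show ?thesis
  proof (rule comm_groupI)
    fix f g assume fg: "f \<in> carrier (hom_group M N)" "g \<in> carrier (hom_group M N)"
    then have f: "mhom M N f" and g: "mhom M N g" by (auto simp: hom_group_def mod_hom_iff)
    show "f \<otimes>\<^bsub>hom_group M N\<^esub> g \<in> carrier (hom_group M N)"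
      using res[OF mhom_plus[OF assms(2) f g]] by (simp add: hom_group_def)
    show "f \<otimes>\<^bsub>hom_group M N\<^esub> g = g \<otimes>\<^bsub>hom_group M N\<^esub> f"
      using mhom_closed[OF f] mhom_closed[OF g] by (auto simp: hom_group_def N.a_comm intro!: restrict_ext)
    fix h assume "h \<in> carrier (hom_group M N)"
    then have h: "mhom M N h" by (auto simp: hom_group_def mod_hom_iff)
    show "f \<otimes>\<^bsub>hom_group M N\<^esub> g \<otimes>\<^bsub>hom_group M N\<^esub> h = f \<otimes>\<^bsub>hom_group M N\<^esub> (g \<otimes>\<^bsub>hom_group M N\<^esub> h)"
      using mhom_closed[OF f] mhom_closed[OF g] mhom_closed[OF h]
      by (auto simp: hom_group_def N.a_assoc intro!: restrict_ext)
  next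
    show "\<one>\<^bsub>hom_group M N\<^esub> \<in> carrier (hom_group M N)"
      using res[OF mhom_const_zero[OF assms(2)]] by (simp add: hom_group_def)
  next
    fix f assume "f \<in> carrier (hom_group M N)"
    then have f: "mhom M N f" "f \<in> extensional (carrier M)" by (auto simp: hom_group_def mod_hom_iff)
    show "\<one>\<^bsub>hom_group M N\<^esub> \<otimes>\<^bsub>hom_group M N\<^esub> f = f"
      using f(2) mhom_closed[OF f(1)] by (auto simp: hom_group_def fun_eq_iff extensional_def)
    let ?g = "restrict (\<lambda>m. \<zero>\<^bsub>N\<^esub> \<ominus>\<^bsub>N\<^esub> f m) (carrier M)"
    have "?g \<in> carrier (hom_group M N)"
      using res[OF mhom_sub[OF assms mhom_const_zero[OF assms(2)] f(1)]] by (simp add: hom_group_def)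
    moreover have "?g \<otimes>\<^bsub>hom_group M N\<^esub> f = \<one>\<^bsub>hom_group M N\<^esub>"
      using mhom_closed[OF f(1)] by (auto simp: hom_group_def N.minus_eq N.l_neg intro!: restrict_ext)
    ultimately show "\<exists>g\<in>carrier (hom_group M N). g \<otimes>\<^bsub>hom_group M N\<^esub> f = \<one>\<^bsub>hom_group M N\<^esub>"
      by blast
  qed
qed

lemma hom_group_precompose:
  assumes "right_module X" "right_module Y" "right_module N" "mhom X Y d"
  shows "(\<lambda>f. compose (carrier X) f d) \<in> hom (hom_group Y N) (hom_group X N)"
proof (rule homI)
  fix f assume "f \<in> carrier (hom_group Y N)"
  then show "compose (carrier X) f d \<in> carrier (hom_group X N)"
    using restrict_mod_hom[OF assms(1) mhom_comp[OF assms(4)], of N f]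
    by (simp add: hom_group_def compose_def mod_hom_iff)
qed (use mhom_closed[OF assms(4)] in \<open>auto simp: hom_group_def compose_def intro!: restrict_ext\<close>)

text \<open>The quotient is trivial exactly if all cocycles are coboundaries. Restricting a map to
  the carrier passes from \<open>mhom\<close> to the extensional elements of the Hom groups.\<close>

lemma trivial_hom_cohomology_iff:
  assumes "proj_res M P d e" "right_module N"
  shows "trivial_group (hom_cohomology P d N l) \<longleftrightarrow> hom_exact P d N l"
proof -
  note P = proj_resD[OF assms(1)]
  let ?G = "hom_group (P l) N" and ?Z = "cocycles P d N l" and ?B = "coboundaries P d N l"
  interpret G: comm_group ?G by (rule comm_group_hom_group[OF P(3) assms(2)])
  interpret G': comm_group "hom_group (P (Suc l)) N" by (rule comm_group_hom_group[OF P(3) assms(2)])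
  interpret D: group_hom ?G "hom_group (P (Suc l)) N" "hom_diff P d l"
    using hom_group_precompose[OF P(3) P(3) assms(2) P(5), of l]
    by unfold_locales (simp add: hom_diff_def[abs_def])
  have Z: "subgroup ?Z ?G" unfolding cocycles_def by (rule D.subgroup_kernel)
  have Z_iff: "f \<in> ?Z \<longleftrightarrow> f \<in> mod_hom (P l) N \<and> (\<forall>p\<in>carrier (P (Suc l)). f (d l p) = \<zero>\<^bsub>N\<^esub>)" for f
    by (auto simp: cocycles_def kernel_def hom_group_def hom_diff_def compose_def fun_eq_iff restrict_def)
  have B_iff: "f \<in> ?B \<longleftrightarrow> f \<in> mod_hom (P l) N \<and> (case l of 0 \<Rightarrow> \<forall>p\<in>carrier (P 0). f p = \<zero>\<^bsub>N\<^esub>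
     | Suc i \<Rightarrow> \<exists>g. mhom (P i) N g \<and> (\<forall>p\<in>carrier (P (Suc i)). f p = g (d i p)))" for f
  proof (cases l)
    case 0
    show ?thesis
    proof
      assume "f \<in> ?B"
      then show "f \<in> mod_hom (P l) N \<and> (case l of 0 \<Rightarrow> \<forall>p\<in>carrier (P 0). f p = \<zero>\<^bsub>N\<^esub>
        | Suc i \<Rightarrow> \<exists>g. mhom (P i) N g \<and> (\<forall>p\<in>carrier (P (Suc i)). f p = g (d i p)))"
        using 0 G.one_closed by (auto simp: coboundaries_def hom_group_def)
    next
      assume "f \<in> mod_hom (P l) N \<and> (case l of 0 \<Rightarrow> \<forall>p\<in>carrier (P 0). f p = \<zero>\<^bsub>N\<^esub>
        | Suc i \<Rightarrow> \<exists>g. mhom (P i) N g \<and> (\<forall>p\<in>carrier (P (Suc i)). f p = g (d i p)))"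
      then show "f \<in> ?B"
        using 0 by (auto simp: coboundaries_def hom_group_def fun_eq_iff mod_hom_iff extensional_def)
    qed
  next
    case (Suc i)
    have dm: "mhom (P (Suc i)) (P i) (d i)" by (rule P)
    show ?thesis
    proof
      assume "f \<in> ?B"
      then obtain g where g: "g \<in> mod_hom (P i) N" "f = hom_diff P d i g"
        using Suc by (auto simp: coboundaries_def)
      have "f \<in> mod_hom (P l) N"
        using g hom_in_carrier[OF hom_group_precompose[OF P(3) P(3) assms(2) dm], of g] Suc
        by (simp add: hom_diff_def hom_group_def)
      then show "f \<in> mod_hom (P l) N \<and> (case l of 0 \<Rightarrow> \<forall>p\<in>carrier (P 0). f p = \<zero>\<^bsub>N\<^esub>
        | Suc i \<Rightarrow> \<exists>g. mhom (P i) N g \<and> (\<forall>p\<in>carrier (P (Suc i)). f p = g (d i p)))"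
        using g Suc by (auto simp: hom_diff_def compose_def mod_hom_iff intro!: exI[of _ g])
    next
      assume "f \<in> mod_hom (P l) N \<and> (case l of 0 \<Rightarrow> \<forall>p\<in>carrier (P 0). f p = \<zero>\<^bsub>N\<^esub>
        | Suc i \<Rightarrow> \<exists>g. mhom (P i) N g \<and> (\<forall>p\<in>carrier (P (Suc i)). f p = g (d i p)))"
      then obtain g where f: "f \<in> mod_hom (P (Suc i)) N"
        and g: "mhom (P i) N g" "\<And>p. p \<in> carrier (P (Suc i)) \<Longrightarrow> f p = g (d i p)"
        using Suc by auto
      have "f = hom_diff P d i (restrict g (carrier (P i)))"
        using f g(2) mhom_closed[OF dm]
        by (auto simp: hom_diff_def compose_def fun_eq_iff mod_hom_iff extensional_def)
      then show "f \<in> ?B"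
        using Suc restrict_mod_hom[OF P(3) g(1)] by (auto simp: coboundaries_def)
    qed
  qed
  have sub: "?B \<subseteq> ?Z"
  proof
    fix f assume f: "f \<in> ?B"
    show "f \<in> ?Z"
    proof (cases l)
      case 0
      then show ?thesis using f mhom_closed[OF P(5), of _ 0] unfolding B_iff Z_iff by auto
    next
      case (Suc i)
      then obtain g where g: "mhom (P i) N g" "\<And>p. p \<in> carrier (P (Suc i)) \<Longrightarrow> f p = g (d i p)"
        using f unfolding B_iff by auto
      then show ?thesis
        using f Suc mhom_closed[OF P(5)] P(10) mhom_zero[OF P(3) assms(2) g(1)] unfolding B_iff Z_iff by auto
    qed
  qed
  have B: "subgroup ?B ?G"
  proof (cases l)
    case 0
    then show ?thesis using G.triv_subgroup by (simp add: coboundaries_def)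
  next
    case (Suc i)
    interpret H: comm_group "hom_group (P i) N" by (rule comm_group_hom_group[OF P(3) assms(2)])
    interpret E: group_hom "hom_group (P i) N" ?G "hom_diff P d i"
      using hom_group_precompose[OF P(3) P(3) assms(2) P(5), of i] Suc
      by unfold_locales (simp add: hom_diff_def[abs_def])
    show ?thesis using E.img_is_subgroup Suc by (simp add: coboundaries_def hom_group_def)
  qed
  interpret Z: comm_group "?G\<lparr>carrier := ?Z\<rparr>"
    by (rule group.group_comm_groupI[OF G.subgroup_imp_group[OF Z]])
      (simp add: G.m_comm subgroup.mem_carrier[OF Z])
  have BZ: "subgroup ?B (?G\<lparr>carrier := ?Z\<rparr>)" by (rule G.subgroup_incl[OF B Z sub])
  then have "group (hom_cohomology P d N l)"
    unfolding hom_cohomology_def by (intro normal.factorgroup_is_group Z.subgroup_imp_normal)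
  then have "trivial_group (hom_cohomology P d N l) \<longleftrightarrow> (\<forall>f\<in>?Z. ?B #>\<^bsub>?G\<lparr>carrier := ?Z\<rparr>\<^esub> f = ?B)"
    using subgroup.one_closed[OF Z]
    by (auto simp: trivial_group_def hom_cohomology_def carrier_FactGroup)
  also have "\<dots> \<longleftrightarrow> ?Z \<subseteq> ?B"
    using Z.coset_join1[OF _ _ BZ] Z.coset_join2[OF _ BZ] by auto
  also have "\<dots> \<longleftrightarrow> hom_exact P d N l"
  proof
    assume le: "?Z \<subseteq> ?B"
    show "hom_exact P d N l"
      unfolding hom_exact_def
    proof (intro allI impI, elim conjE)
      fix f assume f: "mhom (P l) N f" "\<forall>p\<in>carrier (P (Suc l)). f (d l p) = \<zero>\<^bsub>N\<^esub>"
      have "restrict f (carrier (P l)) \<in> ?Z"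
        using f restrict_mod_hom[OF P(3) f(1)] mhom_closed[OF P(5), of _ l] by (simp add: Z_iff)
      then have "restrict f (carrier (P l)) \<in> ?B" using le by blast
      then show "case l of 0 \<Rightarrow> \<forall>p\<in>carrier (P 0). f p = \<zero>\<^bsub>N\<^esub>
        | Suc i \<Rightarrow> \<exists>g. mhom (P i) N g \<and> (\<forall>p\<in>carrier (P (Suc i)). f p = g (d i p))"
        unfolding B_iff by (cases l) auto
    qed
  next
    assume "hom_exact P d N l"
    then show "?Z \<subseteq> ?B" unfolding hom_exact_def Z_iff subset_iff B_iff mod_hom_iff by blast
  qed
  finally show ?thesis .
qed

text \<open>The comparison theorem: projectivity of each \<open>P i\<close> and exactness of
  \<open>Q\<close> lift the identity of \<open>M\<close> to a chain map.\<close>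

lemma chain_map_lift:
  assumes P: "proj_res M P d e" and Q: "proj_res M Q d' e'"
  obtains \<phi> where "\<And>i. mhom (P i) (Q i) (\<phi> i)" "\<And>p. p \<in> carrier (P 0) \<Longrightarrow> e' (\<phi> 0 p) = e p"
    "\<And>i p. p \<in> carrier (P (Suc i)) \<Longrightarrow> d' i (\<phi> (Suc i) p) = \<phi> i (d i p)"
proof -
  note P = proj_resD[OF P] and Q = proj_resD[OF Q]
  \<comment> \<open>The invariant says that the next lifting problem is solvable, namely that \<phi>
    d lands in the image of d'. The clause for \<open>i = 0\<close> is included so that dependent
    choice also returns the compatibility with the augmentations.\<close>
  let ?I = "\<lambda>i \<phi>. mhom (P i) (Q i) \<phi> \<and> (\<forall>p\<in>carrier (P (Suc i)). \<phi> (d i p) \<in> d' i ` carrier (Q (Suc i))) \<and>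
    (i = 0 \<longrightarrow> (\<forall>p\<in>carrier (P 0). e' (\<phi> p) = e p))"
  have base: "\<exists>\<phi>. ?I 0 \<phi>"
  proof -
    have "e ` carrier (P 0) \<subseteq> e' ` carrier (Q 0)" using Q(7) mhom_closed[OF P(6)] by blast
    then obtain h where h: "mhom (P 0) (Q 0) h" "\<And>p. p \<in> carrier (P 0) \<Longrightarrow> e' (h p) = e p"
      using projective_lift[OF P(2) Q(4) Q(1) Q(6) P(6)] by blast
    have "h (d 0 p) \<in> d' 0 ` carrier (Q (Suc 0))" if "p \<in> carrier (P (Suc 0))" for p
      using that h P(8)[of "d 0 p"] Q(8)[of "h (d 0 p)"] mhom_closed[OF P(5) that] mhom_closed[OF h(1)]
      by auto
    then show ?thesis using h by auto
  qed
  have step: "\<exists>\<phi>'. ?I (Suc i) \<phi>' \<and> (\<forall>p\<in>carrier (P (Suc i)). d' i (\<phi>' p) = \<phi> (d i p))" if "?I i \<phi>" for i \<phi>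
  proof -
    from that have \<phi>: "mhom (P i) (Q i) \<phi>" by blast
    have "(\<lambda>p. \<phi> (d i p)) ` carrier (P (Suc i)) \<subseteq> d' i ` carrier (Q (Suc i))" using that by blast
    then obtain h where h: "mhom (P (Suc i)) (Q (Suc i)) h" "\<And>p. p \<in> carrier (P (Suc i)) \<Longrightarrow> d' i (h p) = \<phi> (d i p)"
      using projective_lift[OF P(2) Q(4) Q(3) Q(5) mhom_comp[OF P(5) \<phi>]] by blast
    have "h (d (Suc i) p) \<in> d' (Suc i) ` carrier (Q (Suc (Suc i)))" if "p \<in> carrier (P (Suc (Suc i)))" for p
    proof -
      have dp: "d (Suc i) p \<in> carrier (P (Suc i))" by (rule mhom_closed[OF P(5) that])
      then have "d' i (h (d (Suc i) p)) = \<zero>\<^bsub>Q i\<^esub>"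
        using h(2) P(10)[OF that] mhom_zero[OF P(3) Q(3) \<phi>] by simp
      then show ?thesis using Q(9)[OF mhom_closed[OF h(1) dp]] by simp
    qed
    then show ?thesis using h by auto
  qed
  have "\<exists>\<phi>. \<forall>i. ?I i (\<phi> i) \<and> (\<forall>p\<in>carrier (P (Suc i)). d' i (\<phi> (Suc i) p) = \<phi> i (d i p))"
    by (rule dependent_nat_choice[OF base step])
  then obtain \<phi> where \<phi>: "?I i (\<phi> i)" "\<forall>p\<in>carrier (P (Suc i)). d' i (\<phi> (Suc i) p) = \<phi> i (d i p)" for i
    by metis
  show thesis
  proof
    show "mhom (P i) (Q i) (\<phi> i)" for i using \<phi>(1)[of i] by blast
    show "e' (\<phi> 0 p) = e p" if "p \<in> carrier (P 0)" for p using \<phi>(1)[of 0] that by blast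
    show "d' i (\<phi> (Suc i) p) = \<phi> i (d i p)" if "p \<in> carrier (P (Suc i))" for i p
      using \<phi>(2)[of i] that by blast
  qed
qed

text \<open>The identity and the comparison map \<open>\<phi> \<circ> \<psi>\<close> of \<open>Q\<close> are chain homotopic. In the
  construction of the homotopy \<open>h\<close>, the invariant \<open>d h d = (1 - \<phi> \<psi>) d\<close> involves only one component of \<open>h\<close>.\<close>

lemma hom_exact_transfer:
  assumes P: "proj_res M P d e" and Q: "proj_res M Q d' e'" and N: "right_module N"
    and ex: "hom_exact P d N l"
  shows "hom_exact Q d' N l"
proof -
  obtain \<phi> where \<phi>: "\<And>i. mhom (P i) (Q i) (\<phi> i)" "\<And>p. p \<in> carrier (P 0) \<Longrightarrow> e' (\<phi> 0 p) = e p"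
    "\<And>i p. p \<in> carrier (P (Suc i)) \<Longrightarrow> d' i (\<phi> (Suc i) p) = \<phi> i (d i p)"
    using chain_map_lift[OF P Q] by blast
  obtain \<psi> where \<psi>: "\<And>i. mhom (Q i) (P i) (\<psi> i)" "\<And>q. q \<in> carrier (Q 0) \<Longrightarrow> e (\<psi> 0 q) = e' q"
    "\<And>i q. q \<in> carrier (Q (Suc i)) \<Longrightarrow> d i (\<psi> (Suc i) q) = \<psi> i (d' i q)"
    using chain_map_lift[OF Q P] by blast
  note P = proj_resD[OF P] and Q = proj_resD[OF Q]
  define \<theta> where "\<theta> = (\<lambda>i q. q \<ominus>\<^bsub>Q i\<^esub> \<phi> i (\<psi> i q))"
  note d'c = mhom_closed[OF Q(5)] and \<phi>c = mhom_closed[OF \<phi>(1)] and \<psi>c = mhom_closed[OF \<psi>(1)]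
  have \<theta>: "mhom (Q i) (Q i) (\<theta> i)" for i
    unfolding \<theta>_def by (intro mhom_sub Q mhom_id mhom_comp[OF \<psi>(1) \<phi>(1)])
  have \<theta>d: "d' i (\<theta> (Suc i) q) = \<theta> i (d' i q)" if "q \<in> carrier (Q (Suc i))" for i q
    unfolding \<theta>_def using that
    by (simp add: mhom_minus[OF Q(3) Q(3) Q(5)] \<phi>c \<psi>c \<phi>(3) \<psi>(3))
  \<comment> \<open>The hypothesis on \<open>h\<close> puts \<theta> - h d' in degree
    \<open>Suc i\<close> into the kernel of \<open>d' i\<close>, hence into the image of the next
    differential; projectivity then lifts it.\<close>
  have step: "\<exists>h'. mhom (Q (Suc i)) (Q (Suc (Suc i))) h' \<and>
      (\<forall>q\<in>carrier (Q (Suc i)). d' (Suc i) (h' q) = \<theta> (Suc i) q \<ominus>\<^bsub>Q (Suc i)\<^esub> h (d' i q))"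
    if h: "mhom (Q i) (Q (Suc i)) h" "\<And>q. q \<in> carrier (Q (Suc i)) \<Longrightarrow> d' i (h (d' i q)) = \<theta> i (d' i q)"
    for i h
  proof -
    interpret Qi: right_module "Q i" by (rule Q)
    have k: "mhom (Q (Suc i)) (Q (Suc i)) (\<lambda>q. \<theta> (Suc i) q \<ominus>\<^bsub>Q (Suc i)\<^esub> h (d' i q))"
      by (intro mhom_sub Q \<theta> mhom_comp[OF Q(5) h(1)])
    have "d' i (\<theta> (Suc i) q \<ominus>\<^bsub>Q (Suc i)\<^esub> h (d' i q)) = \<zero>\<^bsub>Q i\<^esub>" if q: "q \<in> carrier (Q (Suc i))" for q
      using q mhom_closed[OF \<theta>] mhom_closed[OF h(1)] d'c
      by (simp add: mhom_minus[OF Q(3) Q(3) Q(5)] \<theta>d h(2) Qi.minus_eq_zero_iff)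
    then have "(\<lambda>q. \<theta> (Suc i) q \<ominus>\<^bsub>Q (Suc i)\<^esub> h (d' i q)) ` carrier (Q (Suc i)) \<subseteq> d' (Suc i) ` carrier (Q (Suc (Suc i)))"
      using Q(9) mhom_closed[OF k] by blast
    then show ?thesis using projective_lift[OF Q(2) Q(4) Q(3) Q(5) k] by metis
  qed
  have base: "\<exists>h. mhom (Q 0) (Q (Suc 0)) h \<and> (\<forall>q\<in>carrier (Q 0). d' 0 (h q) = \<theta> 0 q)"
  proof -
    interpret M: right_module M by (rule Q)
    have "e' (\<theta> 0 q) = \<zero>\<^bsub>M\<^esub>" if "q \<in> carrier (Q 0)" for q
      unfolding \<theta>_def using that mhom_closed[OF Q(6)]
      by (simp add: mhom_minus[OF Q(3) Q(1) Q(6)] \<phi>c \<psi>c \<phi>(2) \<psi>(2) M.minus_eq_zero_iff)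
    then have "\<theta> 0 ` carrier (Q 0) \<subseteq> d' 0 ` carrier (Q (Suc 0))" using Q(8) mhom_closed[OF \<theta>] by blast
    then show ?thesis using projective_lift[OF Q(2) Q(4) Q(3) Q(5) \<theta>] by metis
  qed
  have htpy: "\<exists>h. mhom (Q i) (Q (Suc i)) h \<and> (\<forall>q\<in>carrier (Q (Suc i)). d' i (h (d' i q)) = \<theta> i (d' i q))" for i
  proof (induction i)
    case 0
    then show ?case using base d'c by blast
  next
    case (Suc i)
    then obtain h where h: "mhom (Q i) (Q (Suc i)) h"
      "\<And>q. q \<in> carrier (Q (Suc i)) \<Longrightarrow> d' i (h (d' i q)) = \<theta> i (d' i q)" by blast
    obtain h' where h': "mhom (Q (Suc i)) (Q (Suc (Suc i))) h'"
      "\<And>q. q \<in> carrier (Q (Suc i)) \<Longrightarrow> d' (Suc i) (h' q) = \<theta> (Suc i) q \<ominus>\<^bsub>Q (Suc i)\<^esub> h (d' i q)"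
      using step[OF h] by blast
    interpret Qi: right_module "Q (Suc i)" by (rule Q)
    have "d' (Suc i) (h' (d' (Suc i) q)) = \<theta> (Suc i) (d' (Suc i) q)" if "q \<in> carrier (Q (Suc (Suc i)))" for q
      using that h'(2)[OF d'c[OF that]] mhom_closed[OF \<theta> d'c[OF that]] Q(10) mhom_zero[OF Q(3) Q(3) h(1)]
      by (simp add: Qi.minus_eq)
    then show ?case using h'(1) by blast
  qed
  interpret N: right_module N by fact
  show ?thesis unfolding hom_exact_def
  proof (intro allI impI, elim conjE)
    fix f assume f: "mhom (Q l) N f" "\<forall>q\<in>carrier (Q (Suc l)). f (d' l q) = \<zero>\<^bsub>N\<^esub>"
    have f\<phi>: "mhom (P l) N (\<lambda>p. f (\<phi> l p))" by (rule mhom_comp[OF \<phi>(1) f(1)])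
    have f\<phi>0: "\<forall>p\<in>carrier (P (Suc l)). f (\<phi> l (d l p)) = \<zero>\<^bsub>N\<^esub>"
      using f(2) \<phi>(3) \<phi>c by metis
    have f\<theta>: "f (\<theta> l q) = f q \<ominus>\<^bsub>N\<^esub> f (\<phi> l (\<psi> l q))" if "q \<in> carrier (Q l)" for q
      unfolding \<theta>_def using that \<phi>c \<psi>c by (simp add: mhom_minus[OF Q(3) N f(1)])
    show "case l of 0 \<Rightarrow> \<forall>q\<in>carrier (Q 0). f q = \<zero>\<^bsub>N\<^esub>
      | Suc i \<Rightarrow> \<exists>g. mhom (Q i) N g \<and> (\<forall>q\<in>carrier (Q (Suc i)). f q = g (d' i q))"
    proof (cases l)
      case 0
      have "\<forall>p\<in>carrier (P 0). f (\<phi> 0 p) = \<zero>\<^bsub>N\<^esub>"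
        using ex f\<phi> f\<phi>0 0 by (auto simp: hom_exact_def)
      moreover obtain h where "mhom (Q 0) (Q (Suc 0)) h" "\<forall>q\<in>carrier (Q 0). d' 0 (h q) = \<theta> 0 q"
        using base by blast
      then have "\<forall>q\<in>carrier (Q 0). f (\<theta> 0 q) = \<zero>\<^bsub>N\<^esub>" using f(2) 0 mhom_closed by metis
      ultimately have "f q \<ominus>\<^bsub>N\<^esub> \<zero>\<^bsub>N\<^esub> = \<zero>\<^bsub>N\<^esub>" if "q \<in> carrier (Q 0)" for q
        using f\<theta>[of q] 0 \<psi>c[of q 0] that by simp
      then have "\<forall>q\<in>carrier (Q 0). f q = \<zero>\<^bsub>N\<^esub>"
        using 0 mhom_closed[OF f(1)] by (simp add: N.minus_eq_zero_iff)
      then show ?thesis using 0 by simp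
    next
      case (Suc i)
      obtain g where g: "mhom (P i) N g" "\<And>p. p \<in> carrier (P (Suc i)) \<Longrightarrow> f (\<phi> l p) = g (d i p)"
        using ex f\<phi> f\<phi>0 Suc by (auto simp: hom_exact_def)
      obtain h where h: "mhom (Q i) (Q (Suc i)) h"
        "\<And>q. q \<in> carrier (Q (Suc i)) \<Longrightarrow> d' i (h (d' i q)) = \<theta> i (d' i q)"
        using htpy by blast
      obtain h' where h': "mhom (Q (Suc i)) (Q (Suc (Suc i))) h'"
        "\<And>q. q \<in> carrier (Q (Suc i)) \<Longrightarrow> d' (Suc i) (h' q) = \<theta> (Suc i) q \<ominus>\<^bsub>Q (Suc i)\<^esub> h (d' i q)"
        using step[OF h] by blast
      have fm: "mhom (Q (Suc i)) N f" using f(1) Suc by simp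
      \<comment> \<open>Applying the cocycle f to d' h' = \<theta> - h d' kills the left side, so f
        \<theta> = f h d'. As \<theta> = 1 - \<phi> \<psi> and f \<phi> = g d, this exhibits f as (f
        h + g \<psi>) d'.\<close>
      have "f q = f (h (d' i q)) \<oplus>\<^bsub>N\<^esub> g (\<psi> i (d' i q))" if q: "q \<in> carrier (Q (Suc i))" for q
      proof -
        have hq: "h (d' i q) \<in> carrier (Q (Suc i))" "\<theta> (Suc i) q \<in> carrier (Q (Suc i))"
          using mhom_closed[OF h(1) d'c[OF q]] mhom_closed[OF \<theta> q] by auto
        have "\<zero>\<^bsub>N\<^esub> = f (d' (Suc i) (h' q))" using f(2) Suc mhom_closed[OF h'(1) q] by simp
        also have "\<dots> = f (\<theta> (Suc i) q) \<ominus>\<^bsub>N\<^esub> f (h (d' i q))"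
          using hq by (simp add: h'(2)[OF q] mhom_minus[OF Q(3) N fm])
        finally have "f (\<theta> (Suc i) q) = f (h (d' i q))"
          using hq mhom_closed[OF fm] by (metis N.minus_eq_zero_iff)
        moreover have "f (\<theta> (Suc i) q) = f q \<ominus>\<^bsub>N\<^esub> g (\<psi> i (d' i q))"
          using f\<theta> q Suc g(2)[OF \<psi>c[OF q]] \<psi>(3)[OF q] by simp
        moreover have "f q \<in> carrier N" "g (\<psi> i (d' i q)) \<in> carrier N"
          using mhom_closed[OF fm q] mhom_closed[OF g(1) \<psi>c[OF d'c[OF q]]] by auto
        ultimately show ?thesis by (metis N.minus_eq N.a_assoc N.a_inv_closed N.l_neg N.r_zero)
      qed
      moreover have "mhom (Q i) N (\<lambda>q. f (h q) \<oplus>\<^bsub>N\<^esub> g (\<psi> i q))"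
        by (intro mhom_plus N mhom_comp[OF h(1) fm] mhom_comp[OF \<psi>(1) g(1)])
      ultimately show ?thesis using Suc by auto
    qed
  qed
qed


subsection \<open>Invariance under isomorphism\<close>

lemma mod_iso_image:
  assumes "mod_iso M N f g"
  shows "f ` carrier M = carrier N"
proof (intro equalityI subsetI)
  note f = mod_isoD[OF assms]
  fix n assume "n \<in> carrier N"
  then show "n \<in> f ` carrier M" by (intro image_eqI[of _ _ "g n"]) (simp_all add: f(4) mhom_closed[OF f(2)])
qed (use mhom_closed[OF mod_isoD(1)[OF assms]] in auto)

lemma proj_res_iso:
  assumes "proj_res M P d e" "mod_iso M M' f g" "right_module M'"
  shows "proj_res M' P d (\<lambda>p. f (e p))"
proof -
  note P = proj_resD[OF assms(1)] and f = mod_isoD[OF assms(2)]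
  have "f (e p) = \<zero>\<^bsub>M'\<^esub> \<longleftrightarrow> e p = \<zero>\<^bsub>M\<^esub>" if "p \<in> carrier (P 0)" for p
    using mhom_zero[OF P(1) assms(3) f(1)] mhom_zero[OF assms(3) P(1) f(2)] f(3) mhom_closed[OF P(6) that] by metis
  moreover have "(\<lambda>p. f (e p)) ` carrier (P 0) = carrier M'"
  proof (intro equalityI subsetI)
    fix m assume m: "m \<in> carrier M'"
    then obtain p where "p \<in> carrier (P 0)" "e p = g m" using P(7) mhom_closed[OF f(2)] by fastforce
    then show "m \<in> (\<lambda>p. f (e p)) ` carrier (P 0)" using f(4) m by (intro image_eqI) auto
  qed (use mhom_closed[OF mhom_comp[OF P(6) f(1)]] in auto)
  ultimately show ?thesis
    using assms(1,3) mhom_comp[OF P(6) f(1)] by (auto simp: proj_res_def)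
qed

lemma inj_res_iso:
  assumes "inj_res M I d e" "mod_iso M M' f g" "right_module M'"
  shows "inj_res M' I d (\<lambda>m. e (g m))"
proof -
  note I = inj_resD[OF assms(1)] and f = mod_isoD[OF assms(2)]
  have gi: "inj_on g (carrier M')" "g ` carrier M' = carrier M"
    using f(4) mod_iso_image[OF mod_iso_sym[OF assms(2)]] by (auto intro: inj_on_inverseI)
  have inj: "inj_on (\<lambda>m. e (g m)) (carrier M')"
    using comp_inj_on[OF gi(1), of e] I(7) by (simp add: gi(2) comp_def)
  have "(\<lambda>m. e (g m)) ` carrier M' = e ` carrier M"
    by (simp add: image_image flip: gi(2))
  then show ?thesis
    using assms(1,3) mhom_comp[OF f(2) I(6)] by (simp only: inj_res_def inj simp_thms)
qed

lemma hom_exact_iso: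
  assumes "mod_iso N N' f g" "right_module N" "right_module N'" "hom_exact P d N l"
  shows "hom_exact P d N' l"
  unfolding hom_exact_def
proof (intro allI impI, elim conjE)
  note f = mod_isoD[OF assms(1)]
  note f0 = mhom_zero[OF assms(2,3) f(1)] and g0 = mhom_zero[OF assms(3,2) f(2)]
  fix h assume h: "mhom (P l) N' h" "\<forall>p\<in>carrier (P (Suc l)). h (d l p) = \<zero>\<^bsub>N'\<^esub>"
  have ex: "case l of 0 \<Rightarrow> \<forall>p\<in>carrier (P 0). g (h p) = \<zero>\<^bsub>N\<^esub>
    | Suc i \<Rightarrow> \<exists>k. mhom (P i) N k \<and> (\<forall>p\<in>carrier (P (Suc i)). g (h p) = k (d i p))"
    using assms(4) mhom_comp[OF h(1) f(2)] h(2) g0 unfolding hom_exact_def by simp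
  show "case l of 0 \<Rightarrow> \<forall>p\<in>carrier (P 0). h p = \<zero>\<^bsub>N'\<^esub>
    | Suc i \<Rightarrow> \<exists>k. mhom (P i) N' k \<and> (\<forall>p\<in>carrier (P (Suc i)). h p = k (d i p))"
  proof (cases l)
    case 0
    have "h p = \<zero>\<^bsub>N'\<^esub>" if "p \<in> carrier (P 0)" for p
    proof -
      have "g (h p) = \<zero>\<^bsub>N\<^esub>" using ex 0 that by simp
      then show ?thesis using f(4)[of "h p"] mhom_closed[OF h(1), of p] f0 0 that by simp
    qed
    then show ?thesis using 0 by simp
  next
    case (Suc i)
    then obtain k where k: "mhom (P i) N k" "\<And>p. p \<in> carrier (P (Suc i)) \<Longrightarrow> g (h p) = k (d i p)"
      using ex by auto
    have "h p = f (k (d i p))" if "p \<in> carrier (P (Suc i))" for p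
      using k(2)[OF that] f(4)[of "h p"] mhom_closed[OF h(1), of p] Suc that by simp
    then show ?thesis using Suc mhom_comp[OF k(1) f(1)] by auto
  qed
qed

lemma projective_iso:
  fixes P :: "('a::ring_1, 'p) right_mod"
  assumes "projective P" "mod_iso P P' i j" "fg_module P'"
  shows "projective P'"
  unfolding projective_def
proof (intro conjI allI ballI impI)
  note i = mod_isoD[OF assms(2)]
  fix X Y :: "'a std_mod" and f g
  assume f: "f \<in> mod_hom X Y" and g: "g \<in> mod_hom P' Y" and X: "fg_module X" and Y: "fg_module Y"
    and surj: "f ` carrier X = carrier Y"
  have gi: "mhom P Y (\<lambda>p. g (i p))" by (rule mhom_comp[OF i(1) mod_hom_mhom[OF g]])
  then have "(\<lambda>p. g (i p)) ` carrier P \<subseteq> f ` carrier X" unfolding surj using mhom_closed[OF gi] by auto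
  then obtain h where h: "mhom P X h" "\<And>p. p \<in> carrier P \<Longrightarrow> f (h p) = g (i p)"
    using projective_lift[OF assms(1) X fg_moduleD(1)[OF Y] mod_hom_mhom[OF f] gi] by blast
  show "\<exists>h\<in>mod_hom P' X. compose (carrier P') f h = g"
  proof (rule bexI)
    show "restrict (\<lambda>p. h (j p)) (carrier P') \<in> mod_hom P' X"
      by (rule restrict_mod_hom[OF fg_moduleD(1)[OF assms(3)] mhom_comp[OF i(2) h(1)]])
    show "compose (carrier P') f (restrict (\<lambda>p. h (j p)) (carrier P')) = g"
      using g h(2) mhom_closed[OF i(2)] i(4) by (auto simp: compose_def fun_eq_iff mod_hom_iff extensional_def)
  qed
qed (rule assms(3))

lemma injective_iso:
  fixes I :: "('a::ring_1, 'p) right_mod"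
  assumes "injective I" "mod_iso I I' i j" "fg_module I'"
  shows "injective I'"
  unfolding injective_def
proof (intro conjI allI ballI impI)
  note i = mod_isoD[OF assms(2)]
  fix X Y :: "'a std_mod" and f g
  assume f: "f \<in> mod_hom X Y" and g: "g \<in> mod_hom X I'" and X: "fg_module X" and Y: "fg_module Y"
    and inj: "inj_on f (carrier X)"
  have I: "right_module I" by (rule injectiveD(2)[OF assms(1)])
  have gi: "mhom X I (\<lambda>p. j (g p))" by (rule mhom_comp[OF mod_hom_mhom[OF g] i(2)])
  interpret X: right_module X by (rule fg_moduleD(1)[OF X])
  have "j (g x) = \<zero>\<^bsub>I\<^esub>" if "x \<in> carrier X" "f x = \<zero>\<^bsub>Y\<^esub>" for x
  proof -
    have "f x = f \<zero>\<^bsub>X\<^esub>"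
      using that mhom_zero[OF fg_moduleD(1)[OF X] fg_moduleD(1)[OF Y] mod_hom_mhom[OF f]] by simp
    then have "x = \<zero>\<^bsub>X\<^esub>" using inj that by (simp add: inj_on_def)
    then show ?thesis using mhom_zero[OF fg_moduleD(1)[OF X] I gi] by simp
  qed
  then obtain h where h: "mhom Y I h" "\<And>x. x \<in> carrier X \<Longrightarrow> h (f x) = j (g x)"
    using injective_extend[OF assms(1) X Y mod_hom_mhom[OF f] gi] by blast
  show "\<exists>h\<in>mod_hom Y I'. compose (carrier X) h f = g"
  proof (rule bexI)
    show "restrict (\<lambda>y. i (h y)) (carrier Y) \<in> mod_hom Y I'"
      by (rule restrict_mod_hom[OF fg_moduleD(1)[OF Y] mhom_comp[OF h(1) i(1)]])
    show "compose (carrier X) (restrict (\<lambda>y. i (h y)) (carrier Y)) f = g"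
      using g h(2) mhom_closed[OF mod_hom_mhom[OF f]] i(4)
      by (auto simp: compose_def fun_eq_iff mod_hom_iff extensional_def Pi_iff mhom_def)
  qed
qed (rule assms(3))

lemma mod_iso_carrier_zero:
  assumes "mod_iso M N f g" "right_module M" "right_module N" "carrier M = {\<zero>\<^bsub>M\<^esub>}"
  shows "carrier N = {\<zero>\<^bsub>N\<^esub>}"
proof -
  note f = mod_isoD[OF assms(1)]
  interpret N: right_module N by fact
  have "n = \<zero>\<^bsub>N\<^esub>" if "n \<in> carrier N" for n
    using f(4)[OF that] mhom_closed[OF f(2) that] mhom_zero[OF assms(2,3) f(1)] assms(4) by auto
  then show ?thesis by auto
qed

lemma std_family:
  fixes P :: "nat \<Rightarrow> ('a::ring_1, 'p) right_mod"
  assumes "\<And>i. fg_module (P i)"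
  obtains Q :: "nat \<Rightarrow> 'a std_mod" and f g where
    "\<And>i. fg_module (Q i)" "\<And>i. mod_iso (P i) (Q i) (f i) (g i)"
proof -
  have "\<exists>Q :: 'a std_mod. \<exists>f g. fg_module Q \<and> mod_iso (P i) Q f g" for i
    using mod_iso_std[OF assms] by blast
  then show thesis using that by metis
qed

text \<open>The differentials are conjugated by isomorphisms of the terms with standard modules.
  This carries the constructed resolutions into the type over which \<open>pdim\<close> and
  \<open>Ext\<close> range; the second conclusion preserves their length.\<close>

lemma proj_res_std:
  fixes P :: "nat \<Rightarrow> ('a::ring_1, 'p) right_mod"
  assumes "proj_res M P d e"
  obtains Q :: "nat \<Rightarrow> 'a std_mod" and d' e' where "projective_resolution M Q d' e'"
    "\<And>i. carrier (P i) = {\<zero>\<^bsub>P i\<^esub>} \<Longrightarrow> carrier (Q i) = {\<zero>\<^bsub>Q i\<^esub>}"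
proof -
  note P = proj_resD[OF assms]
  obtain Q :: "nat \<Rightarrow> 'a std_mod" and f g where Q: "\<And>i. fg_module (Q i)"
    and iso: "\<And>i. mod_iso (P i) (Q i) (f i) (g i)"
    using std_family[of P, OF P(4)] by blast
  note f = mod_isoD[OF iso] and Qr = fg_moduleD(1)[OF Q]
  define d' where "d' = (\<lambda>i. restrict (\<lambda>q. f i (d i (g (Suc i) q))) (carrier (Q (Suc i))))"
  define e' where "e' = restrict (\<lambda>q. e (g 0 q)) (carrier (Q 0))"
  have bij: "g i ` carrier (Q i) = carrier (P i)" for i by (rule mod_iso_image[OF mod_iso_sym[OF iso]])
  have f0: "f i p = \<zero>\<^bsub>Q i\<^esub> \<longleftrightarrow> p = \<zero>\<^bsub>P i\<^esub>" if "p \<in> carrier (P i)" for i p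
    using mhom_zero[OF P(3) Qr f(1)] mhom_zero[OF Qr P(3) f(2)] f(3)[OF that] by metis
  have im: "d' i ` carrier (Q (Suc i)) = f i ` d i ` carrier (P (Suc i))" for i
    unfolding d'_def bij[of "Suc i", symmetric] by (auto simp: image_image)
  have ker: "f i ` {p \<in> carrier (P i). R p} = {q \<in> carrier (Q i). R (g i q)}" for i R
  proof (intro equalityI subsetI)
    fix q assume "q \<in> {q \<in> carrier (Q i). R (g i q)}"
    then show "q \<in> f i ` {p \<in> carrier (P i). R p}"
      using f(4)[of q i] mhom_closed[OF f(2), of q i] by (intro image_eqI[of _ _ "g i q"]) auto
  qed (use f(3) mhom_closed[OF f(1)] in auto)
  have "e' ` carrier (Q 0) = carrier M"
  proof -
    have "e' ` carrier (Q 0) = e ` g 0 ` carrier (Q 0)" by (auto simp: e'_def image_image)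
    then show ?thesis using assms by (simp add: bij proj_res_def)
  qed
  moreover have "d' 0 ` carrier (Q (Suc 0)) = {q \<in> carrier (Q 0). e' q = \<zero>\<^bsub>M\<^esub>}"
    using assms ker[of 0 "\<lambda>p. e p = \<zero>\<^bsub>M\<^esub>"] by (auto simp: im proj_res_def e'_def)
  moreover have "d' (Suc i) ` carrier (Q (Suc (Suc i))) = {q \<in> carrier (Q (Suc i)). d' i q = \<zero>\<^bsub>Q i\<^esub>}" for i
  proof -
    have "d' (Suc i) ` carrier (Q (Suc (Suc i))) = f (Suc i) ` {p \<in> carrier (P (Suc i)). d i p = \<zero>\<^bsub>P i\<^esub>}"
      using assms by (simp add: im proj_res_def)
    also have "\<dots> = {q \<in> carrier (Q (Suc i)). d' i q = \<zero>\<^bsub>Q i\<^esub>}"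
      using mhom_closed[OF P(5)] mhom_closed[OF f(2)] unfolding ker by (auto simp: d'_def f0)
    finally show ?thesis .
  qed
  moreover have "d' i \<in> mod_hom (Q (Suc i)) (Q i)" for i
    unfolding d'_def by (intro restrict_mod_hom Qr mhom_comp[OF mhom_comp[OF f(2) P(5)] f(1)])
  moreover have "e' \<in> mod_hom (Q 0) M"
    unfolding e'_def by (intro restrict_mod_hom Qr mhom_comp[OF f(2) P(6)])
  moreover have "projective (Q i)" for i by (rule projective_iso[OF P(2) iso Q])
  ultimately have "projective_resolution M Q d' e'"
    by (simp add: projective_resolution_def a_kernel_def kernel_def)
  then show thesis using that mod_iso_carrier_zero[OF iso P(3) Qr] by blast
qed

lemma inj_res_std:
  fixes I :: "nat \<Rightarrow> ('a::ring_1, 'p) right_mod"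
  assumes "inj_res M I d e"
  obtains J :: "nat \<Rightarrow> 'a std_mod" and d' e' where "injective_resolution M J d' e'"
    "\<And>i. carrier (I i) = {\<zero>\<^bsub>I i\<^esub>} \<Longrightarrow> carrier (J i) = {\<zero>\<^bsub>J i\<^esub>}"
proof -
  note I = inj_resD[OF assms]
  obtain J :: "nat \<Rightarrow> 'a std_mod" and f g where J: "\<And>i. fg_module (J i)"
    and iso: "\<And>i. mod_iso (I i) (J i) (f i) (g i)"
    using std_family[of I, OF I(4)] by blast
  note f = mod_isoD[OF iso] and Jr = fg_moduleD(1)[OF J]
  define d' where "d' = (\<lambda>i. restrict (\<lambda>q. f (Suc i) (d i (g i q))) (carrier (J i)))"
  define e' where "e' = restrict (\<lambda>m. f 0 (e m)) (carrier M)"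
  have bij: "g i ` carrier (J i) = carrier (I i)" for i by (rule mod_iso_image[OF mod_iso_sym[OF iso]])
  have f0: "f i p = \<zero>\<^bsub>J i\<^esub> \<longleftrightarrow> p = \<zero>\<^bsub>I i\<^esub>" if "p \<in> carrier (I i)" for i p
    using mhom_zero[OF I(3) Jr f(1)] mhom_zero[OF Jr I(3) f(2)] f(3)[OF that] by metis
  have im: "d' i ` carrier (J i) = f (Suc i) ` d i ` carrier (I i)" for i
    unfolding d'_def bij[of i, symmetric] by (auto simp: image_image)
  have ker: "f i ` {p \<in> carrier (I i). R p} = {q \<in> carrier (J i). R (g i q)}" for i R
  proof (intro equalityI subsetI)
    fix q assume "q \<in> {q \<in> carrier (J i). R (g i q)}"
    then show "q \<in> f i ` {p \<in> carrier (I i). R p}"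
      using f(4)[of q i] mhom_closed[OF f(2), of q i] by (intro image_eqI[of _ _ "g i q"]) auto
  qed (use f(3) mhom_closed[OF f(1)] in auto)
  have "e' ` carrier M = {p \<in> carrier (J 0). d' 0 p = \<zero>\<^bsub>J (Suc 0)\<^esub>}"
  proof -
    have "e' ` carrier M = f 0 ` e ` carrier M" by (auto simp: e'_def image_image)
    also have "\<dots> = f 0 ` {p \<in> carrier (I 0). d 0 p = \<zero>\<^bsub>I (Suc 0)\<^esub>}"
      using assms by (simp add: inj_res_def)
    also have "\<dots> = {p \<in> carrier (J 0). d' 0 p = \<zero>\<^bsub>J (Suc 0)\<^esub>}"
      using mhom_closed[OF I(5)] mhom_closed[OF f(2)] unfolding ker by (auto simp: d'_def f0)
    finally show ?thesis .
  qed
  moreover have "d' i ` carrier (J i) = {q \<in> carrier (J (Suc i)). d' (Suc i) q = \<zero>\<^bsub>J (Suc (Suc i))\<^esub>}" for i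
  proof -
    have "d' i ` carrier (J i) = f (Suc i) ` {p \<in> carrier (I (Suc i)). d (Suc i) p = \<zero>\<^bsub>I (Suc (Suc i))\<^esub>}"
      using assms by (simp add: im inj_res_def)
    also have "\<dots> = {q \<in> carrier (J (Suc i)). d' (Suc i) q = \<zero>\<^bsub>J (Suc (Suc i))\<^esub>}"
      using mhom_closed[OF I(5)] mhom_closed[OF f(2)] unfolding ker by (auto simp: d'_def f0)
    finally show ?thesis .
  qed
  moreover have "d' i \<in> mod_hom (J i) (J (Suc i))" for i
    unfolding d'_def by (intro restrict_mod_hom Jr mhom_comp[OF mhom_comp[OF f(2) I(5)] f(1)])
  moreover have "e' \<in> mod_hom M (J 0)"
    unfolding e'_def by (intro restrict_mod_hom I mhom_comp[OF I(6) f(1)])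
  moreover have "inj_on e' (carrier M)"
  proof (rule inj_onI)
    fix m m' assume m: "m \<in> carrier M" "m' \<in> carrier M" "e' m = e' m'"
    then have "g 0 (f 0 (e m)) = g 0 (f 0 (e m'))" by (simp add: e'_def)
    then show "m = m'" using m I(7) mhom_closed[OF I(6)] by (simp add: f(3) inj_on_eq_iff)
  qed
  moreover have "injective (J i)" for i by (rule injective_iso[OF I(2) iso J])
  ultimately have "injective_resolution M J d' e'"
    by (simp add: injective_resolution_def a_kernel_def kernel_def)
  then show thesis using that mod_iso_carrier_zero[OF iso I(3) Jr] by blast
qed

subsection \<open>Injective resolutions bound the degree of Ext\<close>

lemma hom_exact_zero:
  assumes "right_module N" "carrier N = {\<zero>\<^bsub>N\<^esub>}"
  shows "hom_exact P d N l"
  unfolding hom_exact_def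
proof (intro allI impI, elim conjE)
  fix f assume f: "mhom (P l) N f"
  have f0: "f p = \<zero>\<^bsub>N\<^esub>" if "p \<in> carrier (P l)" for p
    using mhom_closed[OF f that] assms(2) by simp
  show "case l of 0 \<Rightarrow> \<forall>p\<in>carrier (P 0). f p = \<zero>\<^bsub>N\<^esub>
    | Suc i \<Rightarrow> \<exists>g. mhom (P i) N g \<and> (\<forall>p\<in>carrier (P (Suc i)). f p = g (d i p))"
  proof (cases l)
    case (Suc i)
    have "mhom (P i) N (\<lambda>_. \<zero>\<^bsub>N\<^esub>)" by (rule mhom_const_zero[OF assms(1)])
    then show ?thesis unfolding Suc nat.case using f0 Suc by blast
  qed (use f0 in simp)
qed

text \<open>Dimension shifting along 0 -> N -> I 0 -> Z -> 0, with Z the image of the first map of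
  the injective resolution: as \<open>I 0\<close> is injective, a class in degree
  \<open>Suc l\<close> with coefficients N comes from one in degree \<open>l\<close> with
  coefficients Z.\<close>

lemma hom_exact_Suc:
  assumes P: "proj_res X P d e" and I: "inj_res N I \<delta> \<eta>"
    and ex: "hom_exact P d (sub_mod (I (Suc 0)) (\<delta> 0 ` carrier (I 0))) l"
  shows "hom_exact P d N (Suc l)"
  unfolding hom_exact_def
proof (intro allI impI, elim conjE)
  note P = proj_resD[OF P] and I = inj_resD[OF I]
  let ?Z = "sub_mod (I (Suc 0)) (\<delta> 0 ` carrier (I 0))"
  note \<eta>c = mhom_closed[OF I(6)] and \<eta>0 = mhom_zero[OF I(1) I(3) I(6)]
  interpret I0: right_module "I 0" by (rule I)
  interpret I1: right_module "I (Suc 0)" by (rule I)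
  fix f assume f: "mhom (P (Suc l)) N f" "\<forall>p\<in>carrier (P (Suc (Suc l))). f (d (Suc l) p) = \<zero>\<^bsub>N\<^esub>"
  \<comment> \<open>By exactness of \<open>P\<close> the cocycle f vanishes on the kernel of
    \<open>d l\<close>, so the composite of \<eta> and f extends along \<open>d l\<close> to a map
    into \<open>I 0\<close>.\<close>
  have "\<eta> (f p) = \<zero>\<^bsub>I 0\<^esub>" if "p \<in> carrier (P (Suc l))" "d l p = \<zero>\<^bsub>P l\<^esub>" for p
    using that P(9)[OF that(1)] f(2) \<eta>0 by auto
  then obtain g where g: "mhom (P l) (I 0) g" "\<And>p. p \<in> carrier (P (Suc l)) \<Longrightarrow> g (d l p) = \<eta> (f p)"
    using injective_extend[OF I(2) P(4) P(4) P(5) mhom_comp[OF f(1) I(6)]] by blast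
  have "mhom (P l) ?Z (\<lambda>p. \<delta> 0 (g p))"
    using mhom_comp[OF g(1) I(5)] mhom_closed[OF g(1)] by (auto simp: mhom_def)
  moreover have "\<forall>p\<in>carrier (P (Suc l)). \<delta> 0 (g (d l p)) = \<zero>\<^bsub>?Z\<^esub>"
    using g(2) I(11) mhom_closed[OF f(1)] by simp
  ultimately have ex: "case l of 0 \<Rightarrow> \<forall>p\<in>carrier (P 0). \<delta> 0 (g p) = \<zero>\<^bsub>?Z\<^esub>
     | Suc i \<Rightarrow> \<exists>k. mhom (P i) ?Z k \<and> (\<forall>p\<in>carrier (P (Suc i)). \<delta> 0 (g p) = k (d i p))"
    using ex unfolding hom_exact_def by blast
  \<comment> \<open>The extension g is corrected by a map factoring through the preceding
    differential. This leaves its restriction along \<open>d l\<close> unchanged and makes its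
    values lie in the kernel of \<open>\<delta> 0\<close>, which is the image of N.\<close>
  have "\<exists>g'. mhom (P l) (I 0) g' \<and> (\<forall>p\<in>carrier (P l). \<delta> 0 (g' p) = \<zero>\<^bsub>I (Suc 0)\<^esub>) \<and>
    (\<forall>p\<in>carrier (P (Suc l)). g' (d l p) = \<eta> (f p))"
  proof (cases l)
    case 0
    then show ?thesis using ex g by auto
  next
    case (Suc i)
    then obtain k where k: "mhom (P i) ?Z k" "\<And>p. p \<in> carrier (P (Suc i)) \<Longrightarrow> \<delta> 0 (g p) = k (d i p)"
      using ex by auto
    have kI: "mhom (P i) (I (Suc 0)) k" "k ` carrier (P i) \<subseteq> \<delta> 0 ` carrier (I 0)"
      using k(1) submodD(1)[OF submod_image[OF I(3) I(3) I(5)]] by (simp_all add: mhom_sub_mod_iff)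
    obtain k' where k': "mhom (P i) (I 0) k'" "\<And>p. p \<in> carrier (P i) \<Longrightarrow> \<delta> 0 (k' p) = k p"
      using projective_lift[OF P(2) I(4) I(3) I(5) kI] by blast
    have gm: "mhom (P (Suc i)) (I 0) g" using g(1) Suc by simp
    let ?g = "\<lambda>p. g p \<ominus>\<^bsub>I 0\<^esub> k' (d i p)"
    have "mhom (P l) (I 0) ?g"
      using mhom_sub[OF P(3) I(3) gm mhom_comp[OF P(5) k'(1)]] Suc by simp
    moreover have "\<delta> 0 (?g p) = \<zero>\<^bsub>I (Suc 0)\<^esub>" if "p \<in> carrier (P l)" for p
      using that Suc mhom_closed[OF P(5)] mhom_closed[OF k'(1)] mhom_closed[OF gm] mhom_closed[OF kI(1)] k(2)
      by (simp add: mhom_minus[OF I(3) I(3) I(5)] k'(2) I1.minus_eq_zero_iff)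
    moreover have "?g (d l p) = \<eta> (f p)" if "p \<in> carrier (P (Suc l))" for p
      using that Suc P(10) g(2) mhom_zero[OF P(3) I(3) k'(1)] mhom_closed[OF f(1)] \<eta>c by (simp add: I0.minus_eq)
    ultimately show ?thesis by blast
  qed
  then obtain g' where g': "mhom (P l) (I 0) g'" "\<And>p. p \<in> carrier (P l) \<Longrightarrow> \<delta> 0 (g' p) = \<zero>\<^bsub>I (Suc 0)\<^esub>"
    "\<And>p. p \<in> carrier (P (Suc l)) \<Longrightarrow> g' (d l p) = \<eta> (f p)" by blast
  let ?N = "sub_mod (I 0) (\<eta> ` carrier N)"
  have "mhom N ?N \<eta>" using I(6) by (auto simp: mhom_def)
  moreover have "bij_betw \<eta> (carrier N) (carrier ?N)" using I(7) by (simp add: bij_betw_def)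
  ultimately have inv: "mhom ?N N (inv_into (carrier N) \<eta>)" by (rule mhom_inv_into[OF I(1)])
  have "mhom (P l) ?N g'"
    using g'(1,2) I(8) mhom_closed[OF g'(1)] submodD(1)[OF submod_image[OF I(1) I(3) I(6)]]
    by (auto simp: mhom_sub_mod_iff)
  then have "mhom (P l) N (\<lambda>p. inv_into (carrier N) \<eta> (g' p))" using inv by (rule mhom_comp)
  moreover have "f p = inv_into (carrier N) \<eta> (g' (d l p))" if "p \<in> carrier (P (Suc l))" for p
    using that g'(3) I(7) mhom_closed[OF f(1)] by simp
  ultimately show "case Suc l of 0 \<Rightarrow> \<forall>p\<in>carrier (P 0). f p = \<zero>\<^bsub>N\<^esub>
    | Suc i \<Rightarrow> \<exists>g. mhom (P i) N g \<and> (\<forall>p\<in>carrier (P (Suc i)). f p = g (d i p))" by auto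
qed

text \<open>Dropping \<open>I 0\<close> resolves the first cosyzygy, which is what the next
  dimension shift needs.\<close>

lemma inj_res_shift:
  assumes I: "inj_res N I \<delta> \<eta>"
  shows "inj_res (sub_mod (I (Suc 0)) (\<delta> 0 ` carrier (I 0))) (\<lambda>i. I (Suc i)) (\<lambda>i. \<delta> (Suc i)) (\<lambda>x. x)"
proof -
  note J = inj_resD[OF I]
  have "mhom (sub_mod (I (Suc 0)) (\<delta> 0 ` carrier (I 0))) (I (Suc 0)) (\<lambda>x. x)"
    using mhom_closed[OF J(5)] by (auto simp: mhom_def)
  then show ?thesis
    using I right_module_sub[OF J(3) submod_image[OF J(3) J(3) J(5)], of 0] by (simp add: inj_res_def inj_on_def)
qed

lemma inj_res_zero:
  assumes "inj_res N I \<delta> \<eta>" "carrier (I 0) = {\<zero>\<^bsub>I 0\<^esub>}"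
  shows "carrier N = {\<zero>\<^bsub>N\<^esub>}"
proof -
  note I = inj_resD[OF assms(1)]
  interpret N: right_module N by (rule I)
  show ?thesis
  proof (intro equalityI subsetI)
    fix n assume n: "n \<in> carrier N"
    then have "\<eta> n = \<eta> \<zero>\<^bsub>N\<^esub>"
      using mhom_closed[OF I(6) n] mhom_closed[OF I(6) N.zero_closed] assms(2) by simp
    then show "n \<in> {\<zero>\<^bsub>N\<^esub>}" using I(7) n by (simp add: inj_on_eq_iff)
  qed simp
qed

text \<open>Iterated dimension shifting, ending at a zero module. The induction varies
  \<open>N\<close>, so the element type of \<open>N\<close> has to be that of the terms of
  \<open>I\<close>, where all cosyzygies live.\<close>

lemma hom_exact_ge_std:
  fixes N :: "'a::ring_1 std_mod" and I :: "nat \<Rightarrow> 'a std_mod"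
  assumes "proj_res X P d e" "inj_res N I \<delta> \<eta>" "\<And>i. i \<ge> m \<Longrightarrow> carrier (I i) = {\<zero>\<^bsub>I i\<^esub>}" "m \<le> l"
  shows "hom_exact P d N l"
  using assms(2-4)
proof (induction m arbitrary: N I \<delta> \<eta> l)
  case 0
  then show ?case using hom_exact_zero[OF inj_resD(1) inj_res_zero] by (metis zero_le)
next
  case (Suc m)
  then obtain l' where l: "l = Suc l'" "m \<le> l'" by (cases l) auto
  show ?case
    unfolding l(1) by (rule hom_exact_Suc[OF assms(1) Suc.prems(1)], rule Suc.IH[OF inj_res_shift[OF Suc.prems(1)]])
      (use Suc.prems(2) l(2) in auto)
qed

text \<open>One shift takes coefficients on an arbitrary type to a submodule of
  \<open>I (Suc 0)\<close>, to which the previous lemma applies.\<close>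

lemma hom_exact_ge:
  fixes I :: "nat \<Rightarrow> 'a::ring_1 std_mod"
  assumes "proj_res X P d e" "inj_res N I \<delta> \<eta>" "\<And>i. i \<ge> m \<Longrightarrow> carrier (I i) = {\<zero>\<^bsub>I i\<^esub>}" "m \<le> l"
  shows "hom_exact P d N l"
proof (cases m)
  case 0
  then show ?thesis
    using hom_exact_zero[OF inj_resD(1)[OF assms(2)] inj_res_zero[OF assms(2)]] assms(3) by simp
next
  case (Suc m')
  then obtain l' where l: "l = Suc l'" "m' \<le> l'" using assms(4) by (cases l) auto
  show ?thesis
    unfolding l(1) by (rule hom_exact_Suc[OF assms(1,2)], rule hom_exact_ge_std[OF assms(1) inj_res_shift[OF assms(2)]])
      (use assms(3) Suc l(2) in auto)
qed

section \<open>Modules with a multiplicity-free basis\<close>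

text \<open>\<open>conv_mod R\<close> is the direct sum, over the indices \<open>i\<close>, of the interval modules supported on the
  convex sets \<open>{y. (i, y) \<in> R}\<close>. Projectives, injectives, simples, \<open>A\<close> and \<open>D(A)\<close> are all of this form.\<close>

definition conv_mod :: "('e \<times> 'l::{finite,order}) set \<Rightarrow>
    (('l, 'k::field) incidence_algebra, 'e \<Rightarrow> 'l \<Rightarrow> 'k) right_mod" where
  "conv_mod R = make_mod {f. \<forall>i y. (i, y) \<notin> R \<longrightarrow> f i y = 0} (\<lambda>_ _. 0) (\<lambda>f g i y. f i y + g i y)
    (\<lambda>f a i y. if (i, y) \<in> R then \<Sum>u\<in>UNIV. f i u * coord a u y else 0)"

definition convex_rel :: "('e \<times> 'l::order) set \<Rightarrow> bool" where
  "convex_rel R \<longleftrightarrow> (\<forall>i u y v. (i, u) \<in> R \<longrightarrow> (i, v) \<in> R \<longrightarrow> u \<le> y \<longrightarrow> y \<le> v \<longrightarrow> (i, y) \<in> R)"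

lemma conv_mod_simps [simp]:
  "carrier (conv_mod R) = {f. \<forall>i y. (i, y) \<notin> R \<longrightarrow> f i y = 0}"
  "\<zero>\<^bsub>conv_mod R\<^esub> = (\<lambda>_ _. 0)"
  "f \<oplus>\<^bsub>conv_mod R\<^esub> g = (\<lambda>i y. f i y + g i y)"
  "f \<cdot>\<^bsub>conv_mod R\<^esub> a = (\<lambda>i y. if (i, y) \<in> R then \<Sum>u\<in>UNIV. f i u * coord a u y else 0)"
  by (simp_all add: conv_mod_def make_mod_def)

text \<open>Convexity is what makes the truncated action associative: an intermediate vertex v with
  u \<le> v \<le> y and both ends in the support is in the support too, so truncating at v loses no
  term.\<close>

lemma right_module_conv:
  assumes "convex_rel R"
  shows "right_module (conv_mod R :: (('l::{finite,order}, 'k::field) incidence_algebra, 'e \<Rightarrow> 'l \<Rightarrow> 'k) right_mod)"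
    (is "right_module ?M")
proof -
  interpret abelian_group ?M
  proof (rule abelian_groupI)
    fix f assume "f \<in> carrier ?M"
    then show "\<exists>g\<in>carrier ?M. g \<oplus>\<^bsub>?M\<^esub> f = \<zero>\<^bsub>?M\<^esub>"
      by (intro bexI[of _ "\<lambda>i y. - f i y"]) auto
  qed (auto simp: algebra_simps)
  show ?thesis
  proof
    fix f and a b :: "('l, 'k) incidence_algebra" assume f: "f \<in> carrier ?M"
    show "f \<cdot>\<^bsub>?M\<^esub> (a * b) = f \<cdot>\<^bsub>?M\<^esub> a \<cdot>\<^bsub>?M\<^esub> b"
    proof (intro ext)
      fix i y
      show "(f \<cdot>\<^bsub>?M\<^esub> (a * b)) i y = (f \<cdot>\<^bsub>?M\<^esub> a \<cdot>\<^bsub>?M\<^esub> b) i y"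
      proof (cases "(i, y) \<in> R")
        case True
        have eq: "f i u * coord a u v * coord b v y
            = (if (i, v) \<in> R then f i u * coord a u v * coord b v y else 0)" for u v
        proof (cases "(i, u) \<in> R \<and> u \<le> v \<and> v \<le> y")
          case True
          then have "(i, v) \<in> R" using assms \<open>(i, y) \<in> R\<close> unfolding convex_rel_def by blast
          then show ?thesis by simp
        next
          case False
          then have "f i u * coord a u v * coord b v y = 0"
            using f coord_eq_0[of u v a] coord_eq_0[of v y b] by fastforce
          then show ?thesis by simp
        qed
        have "(f \<cdot>\<^bsub>?M\<^esub> (a * b)) i y = (\<Sum>u\<in>UNIV. \<Sum>v\<in>UNIV. f i u * coord a u v * coord b v y)"
          using True by (simp add: coord_simps sum_distrib_left mult.assoc)
        also have "\<dots> = (\<Sum>v\<in>UNIV. \<Sum>u\<in>UNIV. f i u * coord a u v * coord b v y)" by (rule sum.swap)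
        also have "\<dots> = (\<Sum>v\<in>UNIV. \<Sum>u\<in>UNIV. if (i, v) \<in> R then f i u * coord a u v * coord b v y else 0)"
          by (intro sum.cong refl eq)
        also have "\<dots> = (f \<cdot>\<^bsub>?M\<^esub> a \<cdot>\<^bsub>?M\<^esub> b) i y"
          using True by (auto simp: sum_distrib_right intro!: sum.cong)
        finally show ?thesis .
      qed simp
    qed
    show "f \<cdot>\<^bsub>?M\<^esub> 1 = f"
      using f by (auto simp: fun_eq_iff coord_simps if_distrib[of "\<lambda>t. _ * t"] cong: if_cong)
  qed (auto simp: coord_simps algebra_simps sum.distrib fun_eq_iff)
qed

definition unit_vec :: "'e \<Rightarrow> 'l \<Rightarrow> 'e \<Rightarrow> 'l \<Rightarrow> 'k::field" where
  "unit_vec i y = (\<lambda>i' y'. if i' = i \<and> y' = y then 1 else 0)"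

lemma unit_vec_act:
  "(unit_vec i y \<cdot>\<^bsub>conv_mod R\<^esub> a) i' y' = (if (i', y') \<in> R \<and> i' = i then coord a y y' else 0)"
  by (auto simp: unit_vec_def if_distrib[of "\<lambda>t. t * _"] cong: if_cong)

lemma fg_module_conv:
  fixes R :: "('e::finite \<times> 'l::{finite,order}) set"
  assumes "convex_rel R"
  shows "fg_module (conv_mod R :: (('l, 'k::field) incidence_algebra, 'e \<Rightarrow> 'l \<Rightarrow> 'k) right_mod)"
    (is "fg_module ?M")
proof -
  let ?G = "(\<lambda>(i, y). unit_vec i y) ` R :: ('e \<Rightarrow> 'l \<Rightarrow> 'k) set"
  have "H = carrier ?M" if H: "submod H ?M" "?G \<subseteq> H" for H
  proof -
    note H' = submodD[OF H(1)]
    have "f \<in> H" if f: "f \<in> carrier ?M" for f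
    proof -
      have "(\<lambda>i y. if (i, y) \<in> S then f i y else 0) \<in> H" if "finite S" "S \<subseteq> R" for S
        using that
      proof (induction S rule: finite_induct)
        case empty
        then show ?case using H'(2) by simp
      next
        case (insert p S)
        obtain i y where p: "p = (i, y)" by force
        have "unit_vec i y \<in> H" using H(2) insert.prems p by auto
        \<comment> \<open>Field scalars act through \<open>ia_scale c 1\<close>, so the submodule
          generated by the unit vectors contains their linear combinations.\<close>
        then have "unit_vec i y \<cdot>\<^bsub>?M\<^esub> ia_scale (f i y) 1 \<in> H" by (rule H'(4))
        then have "(\<lambda>i y. if (i, y) \<in> S then f i y else 0) \<oplus>\<^bsub>?M\<^esub> unit_vec i y \<cdot>\<^bsub>?M\<^esub> ia_scale (f i y) 1 \<in> H"
          using insert by (intro H'(3)) auto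
        also have "(\<lambda>i y. if (i, y) \<in> S then f i y else 0) \<oplus>\<^bsub>?M\<^esub> unit_vec i y \<cdot>\<^bsub>?M\<^esub> ia_scale (f i y) 1
            = (\<lambda>i y. if (i, y) \<in> insert p S then f i y else 0)"
        proof (intro ext)
          fix i' y'
          show "((\<lambda>i y. if (i, y) \<in> S then f i y else 0) \<oplus>\<^bsub>?M\<^esub> unit_vec i y \<cdot>\<^bsub>?M\<^esub> ia_scale (f i y) 1) i' y'
            = (if (i', y') \<in> insert p S then f i' y' else 0)"
            using insert.hyps insert.prems p
            by (simp only: conv_mod_simps(3) unit_vec_act) (auto simp: coord_simps)
        qed
        finally show ?case .
      qed
      from this[of R] have "(\<lambda>i y. if (i, y) \<in> R then f i y else 0) \<in> H" by simp
      also have "(\<lambda>i y. if (i, y) \<in> R then f i y else 0) = f" using f by (auto simp: fun_eq_iff)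
      finally show ?thesis .
    qed
    then show ?thesis using H'(1) by blast
  qed
  then have "fin_gen ?M"
    unfolding fin_gen_def by (intro exI[of _ ?G]) (auto simp: unit_vec_def)
  then show ?thesis using right_module_conv[OF assms] by (simp add: fg_module_def)
qed

lemma finsum_conv:
  assumes "convex_rel R" "finite I" "g \<in> I \<rightarrow> carrier (conv_mod R)"
  shows "finsum (conv_mod R) g I = (\<lambda>i y. \<Sum>k\<in>I. g k i y)"
proof -
  interpret right_module "conv_mod R" by (rule right_module_conv[OF assms(1)])
  show ?thesis using assms(2,3)
  proof (induction I rule: finite_induct)
    case empty
    then show ?case by simp
  next
    case (insert k I)
    then have "g \<in> I \<rightarrow> carrier (conv_mod R)" "g k \<in> carrier (conv_mod R)" by auto
    then show ?case using insert.hyps insert.IH finsum_insert[OF insert.hyps] by simp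
  qed
qed

text \<open>A sparse matrix of constants: row \<open>i\<close> has entries \<open>m i c\<close>,
  applied to the component \<open>\<sigma> i c\<close>. Constants commute with the transition maps
  except where source or target is truncated; the hypothesis says that along u \<le> y both routes
  are truncated or neither is.\<close>

lemma mhom_matrix:
  fixes C :: "'f \<Rightarrow> 'c set" and m :: "'f \<Rightarrow> 'c \<Rightarrow> 'k::field" and \<sigma> :: "'f \<Rightarrow> 'c \<Rightarrow> 'e"
    and R :: "('e \<times> 'l::{finite,order}) set" and R' :: "('f \<times> 'l) set"
  assumes supp: "\<And>i c u y. c \<in> C i \<Longrightarrow> m i c \<noteq> 0 \<Longrightarrow> (\<sigma> i c, u) \<in> R \<Longrightarrow> (i, y) \<in> R' \<Longrightarrow> u \<le> y \<Longrightarrow>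
      (i, u) \<in> R' \<longleftrightarrow> (\<sigma> i c, y) \<in> R"
  shows "mhom (conv_mod R) (conv_mod R')
    (\<lambda>f i y. if (i, y) \<in> R' then \<Sum>c\<in>C i. m i c * f (\<sigma> i c) y else 0)"
proof (rule mhomI)
  fix f :: "'e \<Rightarrow> 'l \<Rightarrow> 'k" and a :: "('l, 'k) incidence_algebra" assume f: "f \<in> carrier (conv_mod R)"
  let ?D = "\<lambda>f i y. if (i, y) \<in> R' then \<Sum>c\<in>C i. m i c * f (\<sigma> i c) y else 0"
  show "?D (f \<cdot>\<^bsub>conv_mod R\<^esub> a) = ?D f \<cdot>\<^bsub>conv_mod R'\<^esub> a"
  proof (intro ext)
    fix i y
    show "?D (f \<cdot>\<^bsub>conv_mod R\<^esub> a) i y = (?D f \<cdot>\<^bsub>conv_mod R'\<^esub> a) i y"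
    proof (cases "(i, y) \<in> R'")
      case True
      have eq: "(if (\<sigma> i c, y) \<in> R then m i c * (f (\<sigma> i c) u * coord a u y) else 0)
        = (if (i, u) \<in> R' then m i c * f (\<sigma> i c) u * coord a u y else 0)" if "c \<in> C i" for c u
      proof (cases "m i c \<noteq> 0 \<and> (\<sigma> i c, u) \<in> R \<and> u \<le> y")
        case True
        then show ?thesis using supp[OF that _ _ \<open>(i, y) \<in> R'\<close>] by auto
      next
        case False
        then have "m i c * f (\<sigma> i c) u * coord a u y = 0"
          using f coord_eq_0[of u y a] by fastforce
        then show ?thesis by (simp add: mult.assoc)
      qed
      have "?D (f \<cdot>\<^bsub>conv_mod R\<^esub> a) i y
          = (\<Sum>c\<in>C i. \<Sum>u\<in>UNIV. if (\<sigma> i c, y) \<in> R then m i c * (f (\<sigma> i c) u * coord a u y) else 0)"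
        using True by (auto simp: sum_distrib_left intro!: sum.cong)
      also have "\<dots> = (\<Sum>c\<in>C i. \<Sum>u\<in>UNIV. if (i, u) \<in> R' then m i c * f (\<sigma> i c) u * coord a u y else 0)"
        by (intro sum.cong refl eq)
      also have "\<dots> = (\<Sum>u\<in>UNIV. \<Sum>c\<in>C i. if (i, u) \<in> R' then m i c * f (\<sigma> i c) u * coord a u y else 0)"
        by (rule sum.swap)
      also have "\<dots> = (?D f \<cdot>\<^bsub>conv_mod R'\<^esub> a) i y"
        using True by (auto simp: sum_distrib_right intro!: sum.cong)
      finally show ?thesis .
    qed simp
  qed
qed (auto simp: fun_eq_iff sum.distrib algebra_simps)

subsection \<open>Projectivity\<close>

declare conv_mod_simps(4) [simp del]

text \<open>The element of \<open>e_z A\<close> with coordinates \<open>v\<close>. Applied to the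
  generator of a constant representation on the up-set of z it produces the vector
  \<open>v\<close>.\<close>

definition row :: "'l \<Rightarrow> ('l \<Rightarrow> 'k) \<Rightarrow> ('l::{finite,order}, 'k::field) incidence_algebra" where
  "row z v = Abs_ia (\<lambda>u y. if u = z \<and> z \<le> y then v y else 0)"

lemma coord_row: "coord (row z v) u y = (if u = z \<and> z \<le> y then v y else 0)"
  unfolding row_def by (subst Abs_ia_inverse) auto

lemma row_add: "row z (\<lambda>y. v y + w y) = row z v + row z w"
  by (rule ia_eqI) (simp add: coord_row coord_simps)

lemma row_mult:
  assumes "\<And>y. \<not> z \<le> y \<Longrightarrow> v y = 0"
  shows "row z v * a = row z (\<lambda>y. \<Sum>u\<in>UNIV. v u * coord a u y)"
proof (rule ia_eqI)
  fix u y
  have eq: "(if u = z \<and> z \<le> w then v w else 0) * coord a w y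
      = (if u = z \<and> z \<le> y then v w * coord a w y else 0)" for w
    using assms[of w] coord_eq_0[of w y a] order_trans[of z w y] by auto
  show "coord (row z v * a) u y = coord (row z (\<lambda>y. \<Sum>u\<in>UNIV. v u * coord a u y)) u y"
    unfolding times_incidence_algebra.rep_eq coord_row eq by auto
qed

lemma convex_up:
  assumes "\<And>i y. (i, y) \<in> R \<longleftrightarrow> i \<in> E \<and> z i \<le> y"
  shows "convex_rel R"
  using assms by (auto simp: convex_rel_def)

lemma conv_expand:
  fixes R :: "('e::finite \<times> 'l::{finite,order}) set"
  assumes R: "\<And>i y. (i, y) \<in> R \<longleftrightarrow> i \<in> E \<and> z i \<le> y"
    and q: "q \<in> carrier (conv_mod R)"
  shows "q = finsum (conv_mod R) (\<lambda>i. unit_vec i (z i) \<cdot>\<^bsub>conv_mod R\<^esub> row (z i) (q i)) E"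
proof -
  let ?g = "\<lambda>i. unit_vec i (z i) \<cdot>\<^bsub>conv_mod R\<^esub> row (z i) (q i)"
  have "?g \<in> E \<rightarrow> carrier (conv_mod R)" by (auto simp: unit_vec_act)
  then have "finsum (conv_mod R) ?g E = (\<lambda>i y. \<Sum>k\<in>E. ?g k i y)"
    by (intro finsum_conv convex_up[OF R]) auto
  also have "\<dots> = (\<lambda>i y. \<Sum>k\<in>E. if k = i then q i y else 0)"
    using q by (intro ext sum.cong refl) (auto simp: unit_vec_act coord_row R)
  also have "\<dots> = q" using q by (auto simp: fun_eq_iff R)
  finally show ?thesis by simp
qed

text \<open>Yoneda: a map out of a sum of modules \<open>e_z A\<close> is determined by the images
  of the generators. Of the image of the generator at \<open>z i\<close> only the coordinates at the
  vertex \<open>z i\<close> enter, so such maps are matrices of scalars.\<close>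

lemma mhom_conv_expand:
  fixes R :: "('e::finite \<times> 'l::{finite,order}) set"
    and f :: "('e \<Rightarrow> 'l \<Rightarrow> 'k::field) \<Rightarrow> 'f \<Rightarrow> 'l \<Rightarrow> 'k"
  assumes R: "\<And>i y. (i, y) \<in> R \<longleftrightarrow> i \<in> E \<and> z i \<le> y" and R': "convex_rel R'"
    and f: "mhom (conv_mod R) (conv_mod R') f" and q: "q \<in> carrier (conv_mod R)"
  shows "f q = (\<lambda>j y. if (j, y) \<in> R' then \<Sum>i\<in>E. f (unit_vec i (z i)) j (z i) * q i y else 0)"
proof -
  note M = right_module_conv[OF convex_up[OF R]] and N = right_module_conv[OF R']
  interpret M: right_module "conv_mod R :: (('l, 'k) incidence_algebra, _) right_mod" by (rule M)
  interpret N: right_module "conv_mod R' :: (('l, 'k) incidence_algebra, _) right_mod" by (rule N)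
  have u: "(unit_vec i (z i) :: 'e \<Rightarrow> 'l \<Rightarrow> 'k) \<in> carrier (conv_mod R)" if "i \<in> E" for i
    using that by (auto simp: unit_vec_def R)
  have "f q = f (finsum (conv_mod R) (\<lambda>i. unit_vec i (z i) \<cdot>\<^bsub>conv_mod R\<^esub> row (z i) (q i)) E)"
    using conv_expand[OF R q] by simp
  also have "\<dots> = finsum (conv_mod R') (\<lambda>i. f (unit_vec i (z i) \<cdot>\<^bsub>conv_mod R\<^esub> row (z i) (q i))) E"
    by (rule mhom_finsum[OF M N f]) (use u M.act_closed in \<open>auto simp del: conv_mod_simps(1-3)\<close>)
  also have "\<dots> = finsum (conv_mod R') (\<lambda>i. f (unit_vec i (z i)) \<cdot>\<^bsub>conv_mod R'\<^esub> row (z i) (q i)) E"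
    by (rule N.finsum_cong') (use u mhom_act[OF f] mhom_closed[OF f] N.act_closed in \<open>auto simp del: conv_mod_simps(1-3)\<close>)
  also have "\<dots> = (\<lambda>j y. \<Sum>i\<in>E. (f (unit_vec i (z i)) \<cdot>\<^bsub>conv_mod R'\<^esub> row (z i) (q i)) j y)"
    by (rule finsum_conv[OF R']) (use u mhom_closed[OF f] N.act_closed in \<open>auto simp del: conv_mod_simps(1-3)\<close>)
  also have "\<dots> = (\<lambda>j y. if (j, y) \<in> R' then \<Sum>i\<in>E. f (unit_vec i (z i)) j (z i) * q i y else 0)"
  proof (intro ext)
    fix j y
    have "(\<Sum>u\<in>UNIV. f (unit_vec i (z i)) j u * coord (row (z i) (q i)) u y)
        = f (unit_vec i (z i)) j (z i) * q i y" if "i \<in> E" for i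
    proof -
      have "z i \<le> y \<or> q i y = 0" using q that R by auto
      then have "f (unit_vec i (z i)) j u * coord (row (z i) (q i)) u y
        = (if u = z i then f (unit_vec i (z i)) j (z i) * q i y else 0)" for u
        by (auto simp: coord_row)
      then show ?thesis by simp
    qed
    then show "(\<Sum>i\<in>E. (f (unit_vec i (z i)) \<cdot>\<^bsub>conv_mod R'\<^esub> row (z i) (q i)) j y)
      = (if (j, y) \<in> R' then \<Sum>i\<in>E. f (unit_vec i (z i)) j (z i) * q i y else 0)" by (simp add: conv_mod_simps(4))
  qed
  finally show ?thesis .
qed

lemma projective_conv:
  fixes R :: "('e::finite \<times> 'l::{finite,order}) set"
  assumes R: "\<And>i y. (i, y) \<in> R \<longleftrightarrow> i \<in> E \<and> z i \<le> y"
  shows "projective (conv_mod R :: (('l, 'k::field) incidence_algebra, 'e \<Rightarrow> 'l \<Rightarrow> 'k) right_mod)"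
    (is "projective ?P")
  unfolding projective_def
proof (intro conjI allI ballI impI)
  show "fg_module ?P" by (rule fg_module_conv[OF convex_up[OF R]])
  then have P: "right_module ?P" by (rule fg_moduleD)
  interpret P: right_module ?P by (rule P)
  fix X Y :: "('l, 'k) incidence_algebra std_mod" and f g
  assume f: "f \<in> mod_hom X Y" and g: "g \<in> mod_hom ?P Y" and X: "fg_module X" and Y: "fg_module Y"
    and surj: "f ` carrier X = carrier Y"
  interpret X: right_module X by (rule fg_moduleD(1)[OF X])
  interpret Y: right_module Y by (rule fg_moduleD(1)[OF Y])
  note fm = mod_hom_mhom[OF f] and gm = mod_hom_mhom[OF g]
  have u: "unit_vec i (z i) \<in> carrier ?P" if "i \<in> E" for i
    using that by (auto simp: unit_vec_def R)
  have "\<exists>x. x \<in> carrier X \<and> f x = g (unit_vec i (z i))" if "i \<in> E" for i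
    using mhom_closed[OF gm u[OF that]] surj by (metis imageE)
  then obtain x where x: "\<And>i. i \<in> E \<Longrightarrow> x i \<in> carrier X" "\<And>i. i \<in> E \<Longrightarrow> f (x i) = g (unit_vec i (z i))"
    by metis
  \<comment> \<open>The preimages \<open>x i\<close> are arbitrary and need not be fixed by the
    idempotent at \<open>z i\<close>, since every \<open>row (z i) v\<close> already lies in the
    right ideal of that idempotent.\<close>
  let ?h = "\<lambda>q. finsum X (\<lambda>i. x i \<cdot>\<^bsub>X\<^esub> row (z i) (q i)) E"
  have hm: "mhom ?P X ?h"
  proof (rule mhomI)
    fix q assume q: "q \<in> carrier ?P"
    show "?h q \<in> carrier X" using x(1) by (intro X.finsum_closed) (auto simp: X.act_closed)
    show "?h (q \<cdot>\<^bsub>?P\<^esub> a) = ?h q \<cdot>\<^bsub>X\<^esub> a" for a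
    proof -
      have r: "row (z i) (q i) * a = row (z i) ((q \<cdot>\<^bsub>?P\<^esub> a) i)" if "i \<in> E" for i
      proof -
        have "row (z i) (q i) * a = row (z i) (\<lambda>y. \<Sum>u\<in>UNIV. q i u * coord a u y)"
          using q R by (intro row_mult) auto
        also have "\<dots> = row (z i) ((q \<cdot>\<^bsub>?P\<^esub> a) i)"
          using that by (intro ia_eqI) (auto simp: coord_row R conv_mod_simps(4))
        finally show ?thesis .
      qed
      have "?h q \<cdot>\<^bsub>X\<^esub> a = finsum X (\<lambda>i. (x i \<cdot>\<^bsub>X\<^esub> row (z i) (q i)) \<cdot>\<^bsub>X\<^esub> a) E"
        using x(1) by (intro X.finsum_act) (auto simp: X.act_closed)
      also have "\<dots> = ?h (q \<cdot>\<^bsub>?P\<^esub> a)"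
        using x(1) r by (intro X.finsum_cong') (auto simp: X.act_closed X.act_mult[symmetric])
      finally show ?thesis by simp
    qed
    fix q' assume "q' \<in> carrier ?P"
    have "?h (q \<oplus>\<^bsub>?P\<^esub> q') = finsum X (\<lambda>i. x i \<cdot>\<^bsub>X\<^esub> row (z i) (q i) \<oplus>\<^bsub>X\<^esub> x i \<cdot>\<^bsub>X\<^esub> row (z i) (q' i)) E"
      using x(1) by (intro X.finsum_cong') (auto simp: row_add X.act_add_right X.act_closed)
    also have "\<dots> = ?h q \<oplus>\<^bsub>X\<^esub> ?h q'"
      using x(1) by (intro X.finsum_addf) (auto simp: X.act_closed)
    finally show "?h (q \<oplus>\<^bsub>?P\<^esub> q') = ?h q \<oplus>\<^bsub>X\<^esub> ?h q'" .
  qed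
  have fh: "f (?h q) = g q" if q: "q \<in> carrier ?P" for q
  proof -
    have "f (?h q) = finsum Y (\<lambda>i. f (x i \<cdot>\<^bsub>X\<^esub> row (z i) (q i))) E"
      by (rule mhom_finsum[OF fg_moduleD(1)[OF X] fg_moduleD(1)[OF Y] fm]) (use x X.act_closed in auto)
    also have "\<dots> = finsum Y (\<lambda>i. g (unit_vec i (z i) \<cdot>\<^bsub>?P\<^esub> row (z i) (q i))) E"
      by (rule Y.finsum_cong')
        (use u x mhom_closed[OF gm] mhom_act[OF gm] mhom_act[OF fm] P.act_closed Y.act_closed in \<open>auto simp del: conv_mod_simps(1-3)\<close>)
    also have "\<dots> = g (finsum ?P (\<lambda>i. unit_vec i (z i) \<cdot>\<^bsub>?P\<^esub> row (z i) (q i)) E)"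
      by (rule mhom_finsum[OF P fg_moduleD(1)[OF Y] gm, symmetric])
        (use u P.act_closed in \<open>auto simp del: conv_mod_simps(1-3)\<close>)
    finally show ?thesis using conv_expand[OF R q] by simp
  qed
  show "\<exists>h\<in>mod_hom ?P X. compose (carrier ?P) f h = g"
  proof (rule bexI)
    show "restrict ?h (carrier ?P) \<in> mod_hom ?P X" by (rule restrict_mod_hom[OF P hm])
    show "compose (carrier ?P) f (restrict ?h (carrier ?P)) = g"
      using g fh by (auto simp: compose_def fun_eq_iff mod_hom_iff extensional_def simp del: conv_mod_simps(1-3))
  qed
qed


subsection \<open>Injectivity\<close>

text \<open>A linear functional on a submodule of \<open>Y\<close> is extended after pulling it back along a
  surjection from a free module, which is a vector space on a whole type.\<close>

lemma functional_extension:
  fixes Y :: "(('l::{finite,order}, 'k::field) incidence_algebra, 'y) right_mod"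
  assumes Y: "fg_module Y" and S: "submod S Y"
    and add: "\<And>s t. s \<in> S \<Longrightarrow> t \<in> S \<Longrightarrow> \<mu> (s \<oplus>\<^bsub>Y\<^esub> t) = \<mu> s + \<mu> t"
    and scale: "\<And>s c. s \<in> S \<Longrightarrow> \<mu> (s \<cdot>\<^bsub>Y\<^esub> ia_scale c 1) = c * (\<mu> s :: 'k)"
  obtains \<Lambda> where "\<And>y y'. y \<in> carrier Y \<Longrightarrow> y' \<in> carrier Y \<Longrightarrow> \<Lambda> (y \<oplus>\<^bsub>Y\<^esub> y') = \<Lambda> y + \<Lambda> y'"
    "\<And>y c. y \<in> carrier Y \<Longrightarrow> \<Lambda> (y \<cdot>\<^bsub>Y\<^esub> ia_scale c 1) = c * (\<Lambda> y :: 'k)"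
    "\<And>s. s \<in> S \<Longrightarrow> \<Lambda> s = \<mu> s"
proof -
  interpret Y: right_module Y by (rule fg_moduleD(1)[OF Y])
  note S' = submodD[OF S]
  obtain G where G: "G \<subseteq> carrier Y" "finite G" "\<And>H. submod H Y \<Longrightarrow> G \<subseteq> H \<Longrightarrow> H = carrier Y"
    using Y unfolding fg_module_def fin_gen_def by blast
  define \<sigma> where "\<sigma> = (\<lambda>f :: 'y \<Rightarrow> ('l, 'k) incidence_algebra. finsum Y (\<lambda>g. g \<cdot>\<^bsub>Y\<^esub> f g) G)"
  have gc: "(\<lambda>g. g \<cdot>\<^bsub>Y\<^esub> f g) \<in> G \<rightarrow> carrier Y" for f using G(1) by (auto simp: Y.act_closed)
  have \<sigma>c: "\<sigma> f \<in> carrier Y" for f unfolding \<sigma>_def by (rule Y.finsum_closed[OF gc])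
  have \<sigma>_add: "\<sigma> (f + f') = \<sigma> f \<oplus>\<^bsub>Y\<^esub> \<sigma> f'" for f f'
  proof -
    have "\<sigma> (f + f') = finsum Y (\<lambda>g. g \<cdot>\<^bsub>Y\<^esub> f g \<oplus>\<^bsub>Y\<^esub> g \<cdot>\<^bsub>Y\<^esub> f' g) G"
      unfolding \<sigma>_def using G(1) by (intro Y.finsum_cong') (auto simp: Y.act_closed Y.act_add_right)
    then show ?thesis unfolding \<sigma>_def using Y.finsum_addf[OF gc gc] by simp
  qed
  have \<sigma>_act: "\<sigma> (\<lambda>g. f g * a) = \<sigma> f \<cdot>\<^bsub>Y\<^esub> a" for f a
  proof -
    have "\<sigma> f \<cdot>\<^bsub>Y\<^esub> a = finsum Y (\<lambda>g. (g \<cdot>\<^bsub>Y\<^esub> f g) \<cdot>\<^bsub>Y\<^esub> a) G"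
      unfolding \<sigma>_def by (rule Y.finsum_act[OF G(2) gc])
    also have "\<dots> = \<sigma> (\<lambda>g. f g * a)"
      unfolding \<sigma>_def using G(1) by (intro Y.finsum_cong') (auto simp: Y.act_closed Y.act_mult)
    finally show ?thesis by simp
  qed
  have \<sigma>_0: "\<sigma> 0 = \<zero>\<^bsub>Y\<^esub>"
    unfolding \<sigma>_def using G(1) by (intro Y.add.finprod_one_eqI) (auto simp: Y.act_zero_right)
  have "submod (range \<sigma>) Y"
  proof (rule submodI)
    show "\<zero>\<^bsub>Y\<^esub> \<in> range \<sigma>" using \<sigma>_0 by (metis rangeI)
    show "m \<oplus>\<^bsub>Y\<^esub> n \<in> range \<sigma>" if "m \<in> range \<sigma>" "n \<in> range \<sigma>" for m n
      using that by (auto simp: \<sigma>_add[symmetric])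
    show "m \<cdot>\<^bsub>Y\<^esub> a \<in> range \<sigma>" if "m \<in> range \<sigma>" for m a using that by (auto simp: \<sigma>_act[symmetric])
  qed (use \<sigma>c Y.right_module_axioms in auto)
  moreover have "G \<subseteq> range \<sigma>"
  proof
    fix h assume h: "h \<in> G"
    have "\<sigma> (\<lambda>g. if g = h then 1 else 0) = finsum Y (\<lambda>g. if h = g then g else \<zero>\<^bsub>Y\<^esub>) G"
      unfolding \<sigma>_def using G(1) by (intro Y.finsum_cong') (auto simp: Y.act_one Y.act_zero_right)
    also have "\<dots> = h" using h G by (intro Y.add.finprod_singleton) auto
    finally show "h \<in> range \<sigma>" by (metis rangeI)
  qed
  ultimately have surj: "range \<sigma> = carrier Y" by (rule G(3))

  define sc where "sc = (\<lambda>c (f :: 'y \<Rightarrow> ('l, 'k) incidence_algebra) g. ia_scale c (f g))"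
  have sc_mult: "sc c f = (\<lambda>g. f g * ia_scale c 1)" for c f
    unfolding sc_def by (simp flip: ia_scale_mult)
  have \<sigma>_sc: "\<sigma> (sc c f) = \<sigma> f \<cdot>\<^bsub>Y\<^esub> ia_scale c 1" for c f by (simp only: sc_mult \<sigma>_act)
  interpret V: vector_space sc
    by unfold_locales (rule ext, rule ia_eqI, simp add: sc_def coord_simps algebra_simps)+
  interpret VK: vector_space_pair sc "(*) :: 'k \<Rightarrow> 'k \<Rightarrow> 'k"
    by unfold_locales (auto simp: algebra_simps)
  let ?V = "{f. \<sigma> f \<in> S}"
  obtain B where B: "B \<subseteq> ?V" "V.independent B" "?V \<subseteq> V.span B"
    using V.maximal_independent_subset by blast
  let ?c = "VK.construct B (\<lambda>f. \<mu> (\<sigma> f))"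
  interpret c: Vector_Spaces.linear sc "(*) :: 'k \<Rightarrow> 'k \<Rightarrow> 'k" ?c by (rule VK.linear_construct[OF B(2)])
  have \<mu>0: "\<mu> \<zero>\<^bsub>Y\<^esub> = 0" using add[OF S'(2) S'(2)] by (simp only: Y.l_zero[OF Y.zero_closed] add_cancel_right_right)
  have eq: "?c f = \<mu> (\<sigma> f)" if "\<sigma> f \<in> S" for f
  proof -
    have "V.span B \<subseteq> {f. \<sigma> f \<in> S \<and> ?c f = \<mu> (\<sigma> f)}"
    proof (rule V.span_minimal)
      show "B \<subseteq> {f. \<sigma> f \<in> S \<and> ?c f = \<mu> (\<sigma> f)}" using B(1) VK.construct_basis[OF B(2)] by auto
      show "V.subspace {f. \<sigma> f \<in> S \<and> ?c f = \<mu> (\<sigma> f)}"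
        unfolding V.subspace_def
        using S'(2-4) by (auto simp: \<sigma>_0 \<mu>0 c.zero c.add c.scale \<sigma>_add add \<sigma>_sc scale)
    qed
    then show ?thesis using B(3) that by blast
  qed
  \<comment> \<open>The functional \<open>?c\<close> on the free module agrees with the pullback of
    \<mu> on the preimage of S. In particular it vanishes on the kernel of \<sigma>, so it descends
    to \<open>Y\<close> along any section.\<close>
  define \<Lambda> where "\<Lambda> = (\<lambda>y. ?c (inv_into UNIV \<sigma> y))"
  have \<Lambda>\<sigma>: "\<Lambda> (\<sigma> f) = ?c f" for f
  proof -
    let ?f = "inv_into UNIV \<sigma> (\<sigma> f)"
    have "\<sigma> ?f = \<sigma> f" by (simp add: f_inv_into_f)
    moreover have "\<sigma> (?f - f) \<oplus>\<^bsub>Y\<^esub> \<sigma> f = \<sigma> ?f" by (simp flip: \<sigma>_add)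
    ultimately have "\<sigma> (?f - f) = \<zero>\<^bsub>Y\<^esub>" using \<sigma>c by (simp add: Y.add.r_cancel_one)
    then have "?c (?f - f) = 0" using eq[of "?f - f"] S'(2) \<mu>0 by simp
    then show ?thesis by (simp add: \<Lambda>_def c.diff)
  qed
  show thesis
  proof
    fix y assume "y \<in> carrier Y"
    then obtain f where f: "y = \<sigma> f" using surj by auto
    show "\<Lambda> (y \<cdot>\<^bsub>Y\<^esub> ia_scale c 1) = c * \<Lambda> y" for c
      by (simp add: f \<Lambda>\<sigma> c.scale flip: \<sigma>_sc)
    fix y' assume "y' \<in> carrier Y"
    then obtain f' where f': "y' = \<sigma> f'" using surj by auto
    show "\<Lambda> (y \<oplus>\<^bsub>Y\<^esub> y') = \<Lambda> y + \<Lambda> y'"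
      by (simp add: f f' \<Lambda>\<sigma> c.add flip: \<sigma>_add)
  next
    fix s assume s: "s \<in> S"
    then obtain f where "s = \<sigma> f" using surj S'(1) by blast
    then show "\<Lambda> s = \<mu> s" using eq s by (simp add: \<Lambda>\<sigma>)
  qed
qed

lemma mult_ia_basis:
  assumes "y \<le> w"
  shows "a * ia_basis y w = (\<Sum>u\<in>UNIV. ia_scale (coord a u y) (ia_basis u w))"
proof (rule ia_eqI)
  fix p q
  have "coord (a * ia_basis y w) p q = (if q = w then coord a p y else 0)"
    using assms by (auto simp: coord_simps if_distrib[of "\<lambda>t. _ * t"] cong: if_cong)
  moreover have "coord (ia_scale (coord a u y) (ia_basis u w)) p q
      = (if u = p then if q = w then coord a p y else 0 else 0)" for u
  proof -
    have "coord a u y = 0 \<or> u \<le> w" using assms coord_eq_0[of u y a] by (metis order_trans)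
    then show ?thesis by (auto simp: coord_simps)
  qed
  ultimately show "coord (a * ia_basis y w) p q
    = coord (\<Sum>u\<in>UNIV. ia_scale (coord a u y) (ia_basis u w)) p q"
    by (simp add: coord_sum)
qed

lemma convex_down:
  assumes "\<And>i y. (i, y) \<in> R \<longleftrightarrow> i \<in> E \<and> y \<le> z i"
  shows "convex_rel R"
  using assms by (auto simp: convex_rel_def)

text \<open>The constant representation on the down-set of z is D(A e_z), and maps from Y into it
  correspond to linear functionals on Y e_z: the functional is the coordinate at \<open>z i\<close>,
  and the coordinate at u is recovered by first acting with \<open>ia_basis u (z i)\<close>. So
  extending a homomorphism amounts to extending a functional.\<close>

lemma injective_conv:
  fixes R :: "('e::finite \<times> 'l::{finite,order}) set"
  assumes R: "\<And>i y. (i, y) \<in> R \<longleftrightarrow> i \<in> E \<and> y \<le> z i"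
  shows "injective (conv_mod R :: (('l, 'k::field) incidence_algebra, 'e \<Rightarrow> 'l \<Rightarrow> 'k) right_mod)"
    (is "injective ?I")
  unfolding injective_def
proof (intro conjI allI ballI impI)
  show "fg_module ?I" by (rule fg_module_conv[OF convex_down[OF R]])
  then have I: "right_module ?I" by (rule fg_moduleD)
  interpret I: right_module ?I by (rule I)
  fix X Y :: "('l, 'k) incidence_algebra std_mod" and f g
  assume f: "f \<in> mod_hom X Y" and g: "g \<in> mod_hom X ?I" and X: "fg_module X" and Y: "fg_module Y"
    and inj: "inj_on f (carrier X)"
  interpret X: right_module X by (rule fg_moduleD(1)[OF X])
  interpret Y: right_module Y by (rule fg_moduleD(1)[OF Y])
  note fm = mod_hom_mhom[OF f] and gm = mod_hom_mhom[OF g]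
  let ?S = "f ` carrier X" and ?s = "inv_into (carrier X) f"
  have inv: "mhom (sub_mod Y ?S) X ?s"
    using mhom_inv_into[of X "sub_mod Y ?S" f] inj fm X.right_module_axioms mhom_sub_mod_iff[of ?S Y X f] mhom_closed[OF fm]
    by (auto simp: bij_betw_def)
  have g_on_image: "mhom (sub_mod Y ?S) ?I (\<lambda>y. g (?s y))" by (rule mhom_comp[OF inv gm])
  have "\<exists>\<Lambda>. (\<forall>y\<in>carrier Y. \<forall>y'\<in>carrier Y. \<Lambda> (y \<oplus>\<^bsub>Y\<^esub> y') = \<Lambda> y + \<Lambda> y') \<and>
      (\<forall>y\<in>carrier Y. \<forall>c. \<Lambda> (y \<cdot>\<^bsub>Y\<^esub> ia_scale c 1) = c * \<Lambda> y) \<and> (\<forall>s\<in>?S. \<Lambda> s = g (?s s) i (z i))" if "i \<in> E" for i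
  proof -
    have "g (?s (s \<oplus>\<^bsub>Y\<^esub> t)) i (z i) = g (?s s) i (z i) + g (?s t) i (z i)" if "s \<in> ?S" "t \<in> ?S" for s t
      using mhom_add[OF g_on_image] that by simp
    moreover have "g (?s (s \<cdot>\<^bsub>Y\<^esub> ia_scale c 1)) i (z i) = c * g (?s s) i (z i)" if "s \<in> ?S" for s c
    proof -
      have "(i, z i) \<in> R" using \<open>i \<in> E\<close> R by auto
      then show ?thesis using mhom_act[OF g_on_image, of s "ia_scale c 1"] that
        by (simp add: conv_mod_simps(4) coord_simps if_distrib[of "\<lambda>t. _ * t"] cong: if_cong)
    qed
    ultimately show ?thesis
      using functional_extension[OF Y submod_image[OF X.right_module_axioms Y.right_module_axioms fm],
          of "\<lambda>s. g (?s s) i (z i)"] by metis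
  qed
  then obtain \<Lambda> where \<Lambda>_add: "\<And>i y y'. i \<in> E \<Longrightarrow> y \<in> carrier Y \<Longrightarrow> y' \<in> carrier Y \<Longrightarrow> \<Lambda> i (y \<oplus>\<^bsub>Y\<^esub> y') = \<Lambda> i y + \<Lambda> i y'"
    and \<Lambda>_scale: "\<And>i y c. i \<in> E \<Longrightarrow> y \<in> carrier Y \<Longrightarrow> \<Lambda> i (y \<cdot>\<^bsub>Y\<^esub> ia_scale c 1) = c * \<Lambda> i y"
    and \<Lambda>_ext: "\<And>i s. i \<in> E \<Longrightarrow> s \<in> ?S \<Longrightarrow> \<Lambda> i s = g (?s s) i (z i)"
    by metis
  have \<Lambda>0: "\<Lambda> i (y \<cdot>\<^bsub>Y\<^esub> 0) = 0" if "i \<in> E" "y \<in> carrier Y" for i y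
    using \<Lambda>_add[OF that(1) Y.act_closed[OF that(2), of 0] Y.act_closed[OF that(2), of 0]] Y.act_add_right[OF that(2), of 0 0]
    by (simp only: add_0_left add_cancel_right_right)
  have \<Lambda>_sum: "\<Lambda> i (y \<cdot>\<^bsub>Y\<^esub> (\<Sum>w\<in>W. a w)) = (\<Sum>w\<in>W. \<Lambda> i (y \<cdot>\<^bsub>Y\<^esub> a w))" if "i \<in> E" "y \<in> carrier Y" for i y a and W :: "'l set"
    by (induction W rule: infinite_finite_induct)
      (simp_all add: \<Lambda>0[OF that] Y.act_add_right[OF that(2)] \<Lambda>_add[OF that(1)] Y.act_closed[OF that(2)])
  let ?h = "\<lambda>y i u. if (i, u) \<in> R then \<Lambda> i (y \<cdot>\<^bsub>Y\<^esub> ia_basis u (z i)) else 0"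
  have hm: "mhom Y ?I ?h"
  proof (rule mhomI)
    fix y and a :: "('l, 'k) incidence_algebra" assume y: "y \<in> carrier Y"
    show "?h (y \<cdot>\<^bsub>Y\<^esub> a) = ?h y \<cdot>\<^bsub>?I\<^esub> a"
    proof (intro ext)
      fix i u
      show "?h (y \<cdot>\<^bsub>Y\<^esub> a) i u = (?h y \<cdot>\<^bsub>?I\<^esub> a) i u"
      proof (cases "(i, u) \<in> R")
        case True
        then have i: "i \<in> E" "u \<le> z i" by (auto simp: R)
        have "a * ia_basis u (z i) = (\<Sum>w\<in>UNIV. ia_basis w (z i) * ia_scale (coord a w u) 1)"
          by (simp add: mult_ia_basis[OF i(2)] flip: ia_scale_mult(2))
        then have "?h (y \<cdot>\<^bsub>Y\<^esub> a) i u = \<Lambda> i (y \<cdot>\<^bsub>Y\<^esub> (\<Sum>w\<in>UNIV. ia_basis w (z i) * ia_scale (coord a w u) 1))"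
          using True y by (simp flip: Y.act_mult)
        also have "\<dots> = (\<Sum>w\<in>UNIV. coord a w u * \<Lambda> i (y \<cdot>\<^bsub>Y\<^esub> ia_basis w (z i)))"
          using i y by (simp add: \<Lambda>_sum Y.act_mult \<Lambda>_scale Y.act_closed)
        also have "\<dots> = (\<Sum>w\<in>UNIV. ?h y i w * coord a w u)"
        proof (intro sum.cong refl)
          fix w
          have "coord a w u = 0 \<or> (i, w) \<in> R" using i coord_eq_0[of w u a] R by (metis order_trans)
          then show "coord a w u * \<Lambda> i (y \<cdot>\<^bsub>Y\<^esub> ia_basis w (z i)) = ?h y i w * coord a w u" by auto
        qed
        finally show ?thesis using True by (simp add: conv_mod_simps(4))
      qed (simp add: conv_mod_simps(4))
    qed
  qed (auto simp: R Y.act_add_left \<Lambda>_add Y.act_closed fun_eq_iff)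
  have hf: "?h (f x) = g x" if x: "x \<in> carrier X" for x
  proof (intro ext)
    fix i u
    show "?h (f x) i u = g x i u"
    proof (cases "(i, u) \<in> R")
      case True
      then have i: "i \<in> E" "u \<le> z i" "(i, z i) \<in> R" by (auto simp: R)
      have "f x \<cdot>\<^bsub>Y\<^esub> ia_basis u (z i) = f (x \<cdot>\<^bsub>X\<^esub> ia_basis u (z i))" using mhom_act[OF fm x] by simp
      then have "?h (f x) i u = g (x \<cdot>\<^bsub>X\<^esub> ia_basis u (z i)) i (z i)"
        using True i(1) x inj by (simp add: \<Lambda>_ext X.act_closed)
      also have "\<dots> = g x i u"
        using i x by (simp add: mhom_act[OF gm] conv_mod_simps(4) coord_simps if_distrib[of "\<lambda>t. _ * t"] cong: if_cong)
      finally show ?thesis .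
    next
      case False
      then show ?thesis using mhom_closed[OF gm x] by simp
    qed
  qed
  show "\<exists>h\<in>mod_hom Y ?I. compose (carrier X) h f = g"
  proof (rule bexI)
    show "restrict ?h (carrier Y) \<in> mod_hom Y ?I" by (rule restrict_mod_hom[OF Y.right_module_axioms hm])
    show "compose (carrier X) (restrict ?h (carrier Y)) f = g"
    proof
      fix x
      show "compose (carrier X) (restrict ?h (carrier Y)) f x = g x"
        using g hf[of x] mhom_closed[OF fm, of x]
        by (cases "x \<in> carrier X") (auto simp: compose_def mod_hom_iff extensional_def)
    qed
  qed
qed

section \<open>Koszul complexes\<close>

subsection \<open>Signs and contractions\<close>

text \<open>An arbitrary numbering; its only purpose is a total order from which to form the signs
  of a simplicial complex.\<close>

definition index_of :: "'l::finite \<Rightarrow> nat" where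
  "index_of = (SOME f. inj f)"

lemma inj_index_of: "inj (index_of :: 'l::finite \<Rightarrow> nat)"
proof -
  obtain f :: "'l \<Rightarrow> nat" where "inj f"
    using finite_imp_inj_to_nat_seg[OF finite_UNIV[where 'a = 'l]] by metis
  then show ?thesis unfolding index_of_def by (rule someI[of inj])
qed

definition ksign :: "'l::finite \<Rightarrow> 'l set \<Rightarrow> 'k::field" where
  "ksign c T = (-1) ^ card {t \<in> T. index_of t < index_of c}"

lemma ksign_square: "ksign c T * ksign c T = 1"
  by (simp add: ksign_def flip: power_mult_distrib)

lemma ksign_square_left: "ksign c T * (ksign c T * x) = x"
  by (simp add: ksign_square flip: mult.assoc)

lemma ksign_insert:
  assumes "c' \<notin> U"
  shows "ksign c (insert c' U) = (if index_of c' < index_of c then - ksign c U else ksign c U)"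
proof (cases "index_of c' < index_of c")
  case True
  then have "{t \<in> insert c' U. index_of t < index_of c} = insert c' {t \<in> U. index_of t < index_of c}" by auto
  then show ?thesis using True assms by (simp add: ksign_def)
next
  case False
  then have "{t \<in> insert c' U. index_of t < index_of c} = {t \<in> U. index_of t < index_of c}" by auto
  then show ?thesis using False by (simp add: ksign_def)
qed

lemma index_of_neq: "c \<noteq> c' \<Longrightarrow> index_of c < index_of c' \<longleftrightarrow> \<not> index_of c' < index_of (c :: 'l::finite)"
  using inj_index_of[THEN injD, of c c'] by linarith

text \<open>Exactly one of the two elements precedes the other, so interchanging the order of
  insertion alters exactly one of the signs.\<close>

lemma ksign_anticommute:
  assumes "c \<noteq> c'" "c \<notin> U" "c' \<notin> U"
  shows "ksign c (insert c' U) * ksign c' (insert c U) = - (ksign c' U * ksign c U :: 'k::field)"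
    and "ksign c (insert c' U) * ksign c' U = - (ksign c' (insert c U) * ksign c U :: 'k::field)"
  using assms index_of_neq[OF assms(1)] by (auto simp: ksign_insert)

text \<open>The augmented simplicial boundary of the full simplex on \<open>J\<close>, written for
  coefficient functions: the value at a face collects the coefficients of the faces one element
  larger. The empty face is included.\<close>

definition bd :: "'l::finite set \<Rightarrow> ('l set \<Rightarrow> 'k::field) \<Rightarrow> 'l set \<Rightarrow> 'k" where
  "bd J F T = (\<Sum>c\<in>J - T. ksign c T * F (insert c T))"

definition cobd :: "('l::finite set \<Rightarrow> 'k::field) \<Rightarrow> 'l set \<Rightarrow> 'k" where
  "cobd F T = (\<Sum>c\<in>T. ksign c (T - {c}) * F (T - {c}))"

text \<open>The cone with apex \<open>c\<close>; \<open>cocontr\<close> is its transpose,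
  contracting the coboundary.\<close>

definition contr :: "'l::finite \<Rightarrow> ('l set \<Rightarrow> 'k::field) \<Rightarrow> 'l set \<Rightarrow> 'k" where
  "contr c F T = (if c \<in> T then ksign c (T - {c}) * F (T - {c}) else 0)"

definition cocontr :: "'l::finite \<Rightarrow> ('l set \<Rightarrow> 'k::field) \<Rightarrow> 'l set \<Rightarrow> 'k" where
  "cocontr c F T = (if c \<notin> T then ksign c T * F (insert c T) else 0)"

text \<open>If the apex is not in \<open>T\<close>, only the term inserting it survives. If it is,
  the terms of the two summands cancel by anticommutation, except the one that removes the apex and
  inserts it again.\<close>

lemma bd_contr:
  fixes F :: "'l::finite set \<Rightarrow> 'k::field"
  assumes "c0 \<in> J"
  shows "bd J (contr c0 F) T + contr c0 (bd J F) T = F T"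
proof (cases "c0 \<in> T")
  case False
  have "bd J (contr c0 F) T = (\<Sum>c\<in>J - T. if c = c0 then F T else 0)"
    unfolding bd_def contr_def using False
    by (intro sum.cong refl) (auto simp: ksign_square_left)
  then show ?thesis using False assms by (simp add: contr_def)
next
  case True
  define U where "U = T - {c0}"
  have T: "T = insert c0 U" and U: "c0 \<notin> U" using True by (auto simp: U_def)
  have JU: "J - U = insert c0 (J - T)" using assms by (auto simp: T U)
  have "bd J (contr c0 F) T = (\<Sum>c\<in>J - T. - (ksign c0 U * (ksign c U * F (insert c U))))"
    unfolding bd_def
  proof (intro sum.cong refl)
    fix c assume c: "c \<in> J - T"
    then have "insert c T - {c0} = insert c U" using U by (auto simp: T)
    then have "ksign c T * contr c0 F (insert c T)
        = ksign c (insert c0 U) * ksign c0 (insert c U) * F (insert c U)"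
      using T by (simp add: contr_def mult.assoc)
    also have "\<dots> = - (ksign c0 U * (ksign c U * F (insert c U)))"
      using ksign_anticommute(1)[of c c0 U, where 'k = 'k] c U T by (simp flip: mult.assoc)
    finally show "ksign c T * contr c0 F (insert c T) = - (ksign c0 U * (ksign c U * F (insert c U)))" .
  qed
  moreover have "contr c0 (bd J F) T = ksign c0 U * (\<Sum>c\<in>insert c0 (J - T). ksign c U * F (insert c U))"
    using True by (simp add: contr_def bd_def JU flip: U_def)
  then have "contr c0 (bd J F) T = F T + (\<Sum>c\<in>J - T. ksign c0 U * (ksign c U * F (insert c U)))"
    using True by (simp add: distrib_left ksign_square_left sum_distrib_left flip: T)
  ultimately show ?thesis by (simp add: sum_negf)
qed

lemma cobd_cocontr:
  fixes F :: "'l::finite set \<Rightarrow> 'k::field"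
  shows "cobd (cocontr c0 F) T + cocontr c0 (cobd F) T = F T"
proof (cases "c0 \<in> T")
  case True
  have "cobd (cocontr c0 F) T = (\<Sum>c\<in>T. if c = c0 then F T else 0)"
    unfolding cobd_def cocontr_def using True
    by (intro sum.cong refl) (auto simp: ksign_square_left insert_absorb)
  then show ?thesis using True by (simp add: cocontr_def)
next
  case False
  have "cobd (cocontr c0 F) T = (\<Sum>c\<in>T. - (ksign c0 T * (ksign c (insert c0 T - {c}) * F (insert c0 T - {c}))))"
    unfolding cobd_def
  proof (intro sum.cong refl)
    fix c assume c: "c \<in> T"
    define U where "U = T - {c}"
    have T: "T = insert c U" and U: "c \<notin> U" "c0 \<notin> U" "c0 \<noteq> c" "insert c0 T - {c} = insert c0 U"
      using c False by (auto simp: U_def)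
    have "ksign c U * cocontr c0 F U = ksign c U * ksign c0 U * F (insert c0 U)"
      using U by (simp add: cocontr_def mult.assoc)
    also have "\<dots> = - (ksign c0 T * (ksign c (insert c0 U) * F (insert c0 U)))"
      using ksign_anticommute(1)[of c0 c U, where 'k = 'k] U T by (simp flip: mult.assoc)
    finally show "ksign c (T - {c}) * cocontr c0 F (T - {c})
      = - (ksign c0 T * (ksign c (insert c0 T - {c}) * F (insert c0 T - {c})))"
      by (simp add: U(4) flip: U_def)
  qed
  moreover have "cocontr c0 (cobd F) T = F T + (\<Sum>c\<in>T. ksign c0 T * (ksign c (insert c0 T - {c}) * F (insert c0 T - {c})))"
    using False by (simp add: cocontr_def cobd_def distrib_left ksign_square_left sum_distrib_left)
  ultimately show ?thesis by (simp add: sum_negf)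
qed

text \<open>The terms are paired off by interchanging \<open>c\<close> and \<open>c'\<close>; the sum is split first, because
  \<open>s = - s\<close> says nothing in characteristic two.\<close>

lemma bd_bd:
  fixes F :: "'l::finite set \<Rightarrow> 'k::field"
  shows "bd J (bd J F) T = 0"
proof -
  let ?g = "\<lambda>(c, c'). ksign c T * (ksign c' (insert c T) * F (insert c' (insert c T)))"
  define A where "A = {(c, c'). c \<in> J - T \<and> c' \<in> J - T \<and> c \<noteq> c'}"
  let ?L = "{(c, c') \<in> A. index_of c < index_of c'}" and ?G = "{(c, c') \<in> A. index_of c' < index_of c}"
  have "bd J (bd J F) T = (\<Sum>c\<in>J - T. \<Sum>c'\<in>J - insert c T. ?g (c, c'))"
    by (simp add: bd_def sum_distrib_left)
  also have "\<dots> = sum ?g (Sigma (J - T) (\<lambda>c. J - insert c T))"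
    by (simp add: sum.Sigma)
  also have "Sigma (J - T) (\<lambda>c. J - insert c T) = A" by (auto simp: A_def)
  also have "A = ?L \<union> ?G" using index_of_neq by (auto simp: A_def)
  also have "sum ?g (?L \<union> ?G) = sum ?g ?L + sum ?g ?G"
    by (rule sum.union_disjoint) auto
  also have "sum ?g ?G = (\<Sum>p\<in>?L. - ?g p)"
  proof (rule sum.reindex_bij_witness[of _ prod.swap prod.swap])
    fix p assume "p \<in> ?G"
    then obtain c c' where p: "p = (c, c')" "c \<notin> T" "c' \<notin> T" "c \<noteq> c'" by (auto simp: A_def)
    then have "ksign c T * ksign c' (insert c T) = - (ksign c' T * ksign c (insert c' T)   :: 'k)"
      using ksign_anticommute(2)[of c c' T, where 'k = 'k] by (simp add: mult.commute)
    then show "- ?g (prod.swap p) = ?g p"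
      using p by (simp add: insert_commute flip: mult.assoc)
  qed (auto simp: A_def)
  finally show ?thesis by (simp add: sum_negf)
qed

text \<open>Both sides sum over pairs of a face and an element added to it. This turns
  precomposition with the Koszul differential into the operator \<open>cobd\<close> on matrix
  rows.\<close>

lemma bd_cobd_adjoint:
  fixes J :: "'l::finite set"
  shows "(\<Sum>T\<in>Pow J. G T * bd J F T) = (\<Sum>T\<in>Pow J. cobd G T * F T)"
proof -
  have "(\<Sum>T\<in>Pow J. G T * bd J F T)
      = (\<Sum>(T, c)\<in>Sigma (Pow J) (\<lambda>T. J - T). G T * (ksign c T * F (insert c T)))"
    by (simp add: bd_def sum_distrib_left sum.Sigma)
  also have "\<dots> = (\<Sum>(T, c)\<in>Sigma (Pow J) (\<lambda>T. T). ksign c (T - {c}) * G (T - {c}) * F T)"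
    by (rule sum.reindex_bij_witness[of _ "\<lambda>(T, c). (T - {c}, c)" "\<lambda>(T, c). (insert c T, c)"])
      (auto simp: insert_absorb)
  also have "\<dots> = (\<Sum>T\<in>Pow J. cobd G T * F T)"
    by (simp add: cobd_def sum_distrib_right sum.Sigma)
  finally show ?thesis .
qed

text \<open>Pairing with the indicator function of \<open>T\<close> and moving both operators across
  the adjunction reduces the claim to \<open>bd_bd\<close>.\<close>

lemma cobd_cobd: "cobd (cobd F) T = (0 :: 'k::field)"
proof -
  let ?u = "\<lambda>T'. if T' = T then 1 else 0 :: 'k"
  have "cobd (cobd F) T = (\<Sum>T'\<in>UNIV. cobd (cobd F) T' * ?u T')"
    by (simp add: if_distrib[of "\<lambda>t. _ * t"] cong: if_cong)
  also have "\<dots> = (\<Sum>T'\<in>UNIV. F T' * bd UNIV (bd UNIV ?u) T')"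
    using bd_cobd_adjoint[of "cobd F" UNIV ?u] bd_cobd_adjoint[of F UNIV "bd UNIV ?u"] by simp
  finally show ?thesis by (simp add: bd_bd)
qed

subsection \<open>A projective resolution\<close>

text \<open>The index \<open>w\<close> allows a direct sum of Koszul complexes: a single one with
  base x and the covers of x for the simple module, and one for each w in the lattice, with the
  least element as base, for D(A).\<close>

definition kz_rel :: "('w \<Rightarrow> 'l::order) \<Rightarrow> ('w \<Rightarrow> 'l set) \<Rightarrow> nat \<Rightarrow> (('w \<times> 'l set) \<times> 'l) set" where
  "kz_rel b J l = {((w, T), y). T \<subseteq> J w \<and> card T = l \<and> b w \<le> y \<and> (\<forall>t\<in>T. t \<le> y)}"

definition kz_target :: "('w \<Rightarrow> 'l::order) \<Rightarrow> ('w \<Rightarrow> 'l set) \<Rightarrow> ('w \<times> 'l) set" where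
  "kz_target b J = {(w, y). b w \<le> y \<and> (\<forall>j\<in>J w. \<not> j \<le> y)}"

definition kz_d :: "('w \<Rightarrow> 'l::{finite,order}) \<Rightarrow> ('w \<Rightarrow> 'l set) \<Rightarrow> nat \<Rightarrow> ('w \<times> 'l set \<Rightarrow> 'l \<Rightarrow> 'k::field) \<Rightarrow>
    'w \<times> 'l set \<Rightarrow> 'l \<Rightarrow> 'k" where
  "kz_d b J l q = (\<lambda>i y. if (i, y) \<in> kz_rel b J l
    then \<Sum>c\<in>J (fst i) - snd i. ksign c (snd i) * q (fst i, insert c (snd i)) y else 0)"

text \<open>The augmentation, projecting to the summand of the empty set. The sum over a singleton
  only gives it the shape required by \<open>mhom_matrix\<close>.\<close>

definition kz_e :: "('w \<Rightarrow> 'l::{finite,order}) \<Rightarrow> ('w \<Rightarrow> 'l set) \<Rightarrow> ('w \<times> 'l set \<Rightarrow> 'l \<Rightarrow> 'k::field) \<Rightarrow> 'w \<Rightarrow> 'l \<Rightarrow> 'k" where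
  "kz_e b J q = (\<lambda>w y. if (w, y) \<in> kz_target b J then \<Sum>c\<in>{()}. 1 * q (w, {}) y else 0)"

definition kz_gen :: "('w \<Rightarrow> 'l) \<Rightarrow> 'w \<times> 'l set \<Rightarrow> 'l::{finite,lattice}" where
  "kz_gen b i = Sup_fin (insert (b (fst i)) (snd i))"

lemma kz_gen_le_iff: "kz_gen b (w, T) \<le> y \<longleftrightarrow> b w \<le> y \<and> (\<forall>t\<in>T. t \<le> y)"
  by (simp add: kz_gen_def Sup_fin.bounded_iff)

definition kz_index :: "('w \<Rightarrow> 'l set) \<Rightarrow> nat \<Rightarrow> ('w \<times> 'l set) set" where
  "kz_index J l = {(w, T). T \<subseteq> J w \<and> card T = l}"

lemma kz_rel_iff: "(i, y) \<in> kz_rel b J l \<longleftrightarrow> i \<in> kz_index J l \<and> kz_gen b i \<le> y"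
  by (cases i) (auto simp: kz_rel_def kz_index_def kz_gen_le_iff)

lemma convex_kz_target: "convex_rel (kz_target b J)"
  by (auto simp: convex_rel_def kz_target_def intro: order_trans)

text \<open>The truncation in \<open>kz_d\<close> costs nothing: a vertex not above the base and all
  of \<open>T\<close> is not above those of a larger set either, so the boundary vanishes there
  anyway.\<close>

lemma kz_d_bd:
  assumes "q \<in> carrier (conv_mod (kz_rel b J (Suc l)))" "T \<subseteq> J w" "card T = l"
  shows "kz_d b J l q (w, T) y = bd (J w) (\<lambda>T. q (w, T) y) T"
proof (cases "((w, T), y) \<in> kz_rel b J l")
  case True
  then show ?thesis by (simp add: kz_d_def bd_def)
next
  case False
  then have "((w, insert c T), y) \<notin> kz_rel b J (Suc l)" for c
    using assms(2,3) by (auto simp: kz_rel_def)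
  then have "bd (J w) (\<lambda>T. q (w, T) y) T = 0" using assms(1) by (simp add: bd_def)
  then show ?thesis using False by (simp add: kz_d_def)
qed

lemma mhom_kz_d: "mhom (conv_mod (kz_rel b J (Suc l))) (conv_mod (kz_rel b J l)) (kz_d b J l)"
  unfolding kz_d_def
  by (rule mhom_matrix[where C = "\<lambda>i. J (fst i) - snd i" and m = "\<lambda>i c. ksign c (snd i)"
      and \<sigma> = "\<lambda>i c. (fst i, insert c (snd i))"])
    (simp add: kz_rel_def split: prod.splits)

lemma mhom_kz_e: "mhom (conv_mod (kz_rel b J 0)) (conv_mod (kz_target b J)) (kz_e b J)"
  unfolding kz_e_def
  by (rule mhom_matrix[where C = "\<lambda>_. {()}" and m = "\<lambda>_ _. 1" and \<sigma> = "\<lambda>w _. (w, {})"])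
    (auto simp: kz_rel_def kz_target_def intro: order_trans)

text \<open>The apex is any element of \<open>J w\<close> below the vertex y. It varies with y, so
  this is no homomorphism of modules; exactness needs preimages only.\<close>

definition kz_h :: "('w \<Rightarrow> 'l set) \<Rightarrow> ('w \<times> 'l set \<Rightarrow> 'l \<Rightarrow> 'k::field) \<Rightarrow> 'w \<times> 'l set \<Rightarrow> 'l::{finite,order} \<Rightarrow> 'k" where
  "kz_h J q = (\<lambda>(w, T) y. if \<exists>c\<in>J w. c \<le> y then contr (SOME c. c \<in> J w \<and> c \<le> y) (\<lambda>T. q (w, T) y) T else 0)"

lemma kz_h_closed:
  assumes "q \<in> carrier (conv_mod (kz_rel b J l))"
  shows "kz_h J q \<in> carrier (conv_mod (kz_rel b J (Suc l)))"
proof -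
  have "((w, T), y) \<in> kz_rel b J (Suc l)" if nz: "kz_h J q (w, T) y \<noteq> 0" for w T y
  proof -
    define c where "c = (SOME c. c \<in> J w \<and> c \<le> y)"
    have ex: "\<exists>c\<in>J w. c \<le> y" using nz by (auto simp: kz_h_def split: if_splits)
    then have c: "c \<in> J w" "c \<le> y" using someI_ex[of "\<lambda>c. c \<in> J w \<and> c \<le> y"] unfolding c_def by auto
    have "contr c (\<lambda>T. q (w, T) y) T \<noteq> 0" using nz ex by (simp add: kz_h_def c_def)
    then have cT: "c \<in> T" and "q (w, T - {c}) y \<noteq> 0" by (auto simp: contr_def split: if_splits)
    from this(2) have "((w, T - {c}), y) \<in> kz_rel b J l" using assms by auto
    then have "T - {c} \<subseteq> J w" "card (T - {c}) = l" "b w \<le> y" "\<forall>t\<in>T - {c}. t \<le> y"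
      by (simp_all add: kz_rel_def)
    moreover have "card T = Suc (card (T - {c}))" using card_Suc_Diff1[OF _ cT] by simp
    ultimately show ?thesis using c unfolding kz_rel_def by blast
  qed
  then show ?thesis by auto
qed

text \<open>The two kernel hypotheses serve all degrees at once: for l > 0 the first says that q is
  a cycle; for l = 0 it is void, and the second handles the vertices without an apex, where only the
  empty face exists.\<close>

lemma kz_h_homotopy:
  fixes q :: "'w \<times> 'l set \<Rightarrow> 'l::{finite,order} \<Rightarrow> 'k::field"
  assumes q: "q \<in> carrier (conv_mod (kz_rel b J l))"
    and ker: "\<And>w T y. T \<subseteq> J w \<Longrightarrow> Suc (card T) = l \<Longrightarrow> bd (J w) (\<lambda>T. q (w, T) y) T = 0"
    and ker0: "\<And>w y. l = 0 \<Longrightarrow> (\<forall>j\<in>J w. \<not> j \<le> y) \<Longrightarrow> q (w, {}) y = 0"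
  shows "kz_d b J l (kz_h J q) = q"
proof (intro ext)
  fix i :: "'w \<times> 'l set" and y :: 'l
  obtain w T where i: "i = (w, T)" by force
  show "kz_d b J l (kz_h J q) i y = q i y"
  proof (cases "((w, T), y) \<in> kz_rel b J l")
    case False
    then show ?thesis using q by (auto simp: i kz_d_def)
  next
    case True
    then have T: "T \<subseteq> J w" "card T = l" "\<And>t. t \<in> T \<Longrightarrow> t \<le> y" by (auto simp: kz_rel_def)
    have d: "kz_d b J l (kz_h J q) i y = bd (J w) (\<lambda>T. kz_h J q (w, T) y) T"
      unfolding i by (rule kz_d_bd[OF kz_h_closed[OF q] T(1,2)])
    show ?thesis
    proof (cases "\<exists>c\<in>J w. c \<le> y")
      case ex: True
      define c where "c = (SOME c. c \<in> J w \<and> c \<le> y)"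
      have c: "c \<in> J w" "c \<le> y" using ex someI_ex[of "\<lambda>c. c \<in> J w \<and> c \<le> y"] unfolding c_def by auto
      have "contr c (bd (J w) (\<lambda>T. q (w, T) y)) T = 0"
      proof (cases "c \<in> T")
        case True
        then have "Suc (card (T - {c})) = l" using card_Suc_Diff1[OF _ True] T(2) by simp
        then have "bd (J w) (\<lambda>T. q (w, T) y) (T - {c}) = 0" using T(1) by (intro ker) auto
        then show ?thesis by (simp add: contr_def)
      qed (simp add: contr_def)
      moreover have "(\<lambda>T. kz_h J q (w, T) y) = contr c (\<lambda>T. q (w, T) y)"
        using ex by (simp add: kz_h_def c_def)
      ultimately show ?thesis
        using bd_contr[OF c(1), of "\<lambda>T. q (w, T) y" T] unfolding d by (simp add: i)
    next
      case nex: False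
      then have "T = {}" using T by auto
      then have "q (w, T) y = 0" using ker0[of w y] nex T(2) by auto
      then show ?thesis using nex unfolding d by (simp add: i kz_h_def bd_def)
    qed
  qed
qed

lemma proj_res_kz:
  fixes b :: "'w::finite \<Rightarrow> 'l::{finite,lattice}"
  shows "proj_res (conv_mod (kz_target b J) :: (('l, 'k::field) incidence_algebra, 'w \<Rightarrow> 'l \<Rightarrow> 'k) right_mod)
    (\<lambda>l. conv_mod (kz_rel b J l)) (kz_d b J) (kz_e b J)"
  unfolding proj_res_def
proof (intro conjI allI)
  let ?M = "conv_mod (kz_target b J) :: (('l, 'k) incidence_algebra, 'w \<Rightarrow> 'l \<Rightarrow> 'k) right_mod"
  let ?P = "\<lambda>l. conv_mod (kz_rel b J l) :: (('l, 'k) incidence_algebra, 'w \<times> 'l set \<Rightarrow> 'l \<Rightarrow> 'k) right_mod"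
  show "right_module ?M" by (rule right_module_conv[OF convex_kz_target])
  show "projective (?P l)" for l by (rule projective_conv[OF kz_rel_iff])
  show "mhom (?P (Suc l)) (?P l) (kz_d b J l)" for l by (rule mhom_kz_d)
  show "mhom (?P 0) ?M (kz_e b J)" by (rule mhom_kz_e)
  show "kz_e b J ` carrier (?P 0) = carrier ?M"
  proof (intro equalityI subsetI)
    fix f assume f: "f \<in> carrier ?M"
    let ?q = "\<lambda>i y. if snd i = {} then f (fst i) y else 0"
    have qc: "?q \<in> carrier (?P 0)" using f by (auto simp: kz_rel_def kz_target_def)
    have "f = kz_e b J ?q" using f by (auto simp: kz_e_def fun_eq_iff)
    then show "f \<in> kz_e b J ` carrier (?P 0)" by (rule rev_image_eqI[OF qc])
  qed (use mhom_closed[OF mhom_kz_e] in blast)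
  show "kz_d b J 0 ` carrier (?P (Suc 0)) = {q \<in> carrier (?P 0). kz_e b J q = \<zero>\<^bsub>?M\<^esub>}"
  proof (intro equalityI subsetI)
    fix p assume "p \<in> kz_d b J 0 ` carrier (?P (Suc 0))"
    then obtain q where q: "q \<in> carrier (?P (Suc 0))" "p = kz_d b J 0 q" by blast
    have "kz_e b J (kz_d b J 0 q) w y = 0" for w y
    proof (cases "(w, y) \<in> kz_target b J")
      case True
      then have "q (w, {c}) y = 0" if "c \<in> J w" for c
        using q(1) that by (auto simp: kz_rel_def kz_target_def)
      then show ?thesis by (simp add: kz_e_def kz_d_def)
    qed (simp add: kz_e_def)
    then show "p \<in> {q \<in> carrier (?P 0). kz_e b J q = \<zero>\<^bsub>?M\<^esub>}"
      unfolding q(2) using mhom_closed[OF mhom_kz_d q(1)] by (simp add: fun_eq_iff)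
  next
    fix q assume q: "q \<in> {q \<in> carrier (?P 0). kz_e b J q = \<zero>\<^bsub>?M\<^esub>}"
    have "q (w, {}) y = 0" if "\<forall>j\<in>J w. \<not> j \<le> y" for w y
    proof (cases "b w \<le> y")
      case True
      have "kz_e b J q w y = 0" using q by simp
      then show ?thesis using True that by (simp add: kz_e_def kz_target_def)
    next
      case False
      then show ?thesis using q by (auto simp: kz_rel_def)
    qed
    then have eq: "kz_d b J 0 (kz_h J q) = q" using q by (intro kz_h_homotopy) auto
    have "kz_h J q \<in> carrier (?P (Suc 0))" using q by (intro kz_h_closed) simp
    then show "q \<in> kz_d b J 0 ` carrier (?P (Suc 0))" by (rule rev_image_eqI) (simp only: eq)
  qed
  show "kz_d b J (Suc l) ` carrier (?P (Suc (Suc l))) = {q \<in> carrier (?P (Suc l)). kz_d b J l q = \<zero>\<^bsub>?P l\<^esub>}" for l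
  proof (intro equalityI subsetI)
    fix p assume "p \<in> kz_d b J (Suc l) ` carrier (?P (Suc (Suc l)))"
    then obtain q where q: "q \<in> carrier (?P (Suc (Suc l)))" "p = kz_d b J (Suc l) q" by blast
    have pc: "p \<in> carrier (?P (Suc l))" unfolding q(2) by (rule mhom_closed[OF mhom_kz_d q(1)])
    have "kz_d b J l p (w, T) y = 0" for w T y
    proof (cases "T \<subseteq> J w \<and> card T = l")
      case True
      have eq: "p (w, insert c T) y = bd (J w) (\<lambda>T. q (w, T) y) (insert c T)" if "c \<in> J w - T" for c
        unfolding q(2) using that True by (intro kz_d_bd[OF q(1)]) auto
      have "kz_d b J l p (w, T) y = bd (J w) (\<lambda>T. p (w, T) y) T" using True by (intro kz_d_bd[OF pc]) auto
      also have "\<dots> = bd (J w) (bd (J w) (\<lambda>T. q (w, T) y)) T"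
        unfolding bd_def[of "J w" _ T] using eq by (intro sum.cong) auto
      finally show ?thesis by (simp add: bd_bd)
    next
      case False
      then show ?thesis by (auto simp: kz_d_def kz_rel_def)
    qed
    then show "p \<in> {q \<in> carrier (?P (Suc l)). kz_d b J l q = \<zero>\<^bsub>?P l\<^esub>}" using pc by (auto simp: fun_eq_iff)
  next
    fix q assume "q \<in> {q \<in> carrier (?P (Suc l)). kz_d b J l q = \<zero>\<^bsub>?P l\<^esub>}"
    then have q: "q \<in> carrier (?P (Suc l))" "kz_d b J l q = (\<lambda>_ _. 0)" by auto
    have eq: "kz_d b J (Suc l) (kz_h J q) = q"
      using q(2) by (intro kz_h_homotopy[OF q(1)]) (auto simp flip: kz_d_bd[OF q(1)])
    show "q \<in> kz_d b J (Suc l) ` carrier (?P (Suc (Suc l)))"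
      by (rule rev_image_eqI[OF kz_h_closed[OF q(1)]]) (simp only: eq)
  qed
qed

lemma kz_zero:
  assumes "\<And>w. card (J w) < l"
  shows "carrier (conv_mod (kz_rel b J l)) = {\<zero>\<^bsub>conv_mod (kz_rel b J l)\<^esub>}"
proof -
  have "(i, y) \<notin> kz_rel b J l" for i y
    using assms[of "fst i"] card_mono[of "J (fst i)" "snd i"] by (auto simp: kz_rel_def)
  then show ?thesis by (auto simp: fun_eq_iff)
qed

subsection \<open>An injective resolution\<close>

text \<open>The dual complex: the summand of \<open>T\<close> is the constant representation on the
  down-set of the meet of x and \<open>T\<close>. Only one simple module is resolved, so no further
  index occurs.\<close>

definition ck_rel :: "'l::order \<Rightarrow> 'l set \<Rightarrow> nat \<Rightarrow> ('l set \<times> 'l) set" where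
  "ck_rel x J l = {(T, y). T \<subseteq> J \<and> card T = l \<and> y \<le> x \<and> (\<forall>t\<in>T. y \<le> t)}"

definition ck_source :: "'l::order \<Rightarrow> 'l set \<Rightarrow> (unit \<times> 'l) set" where
  "ck_source x J = {(i, y). y \<le> x \<and> (\<forall>j\<in>J. \<not> y \<le> j)}"

definition ck_d :: "'l::{finite,order} \<Rightarrow> 'l set \<Rightarrow> nat \<Rightarrow> ('l set \<Rightarrow> 'l \<Rightarrow> 'k::field) \<Rightarrow> 'l set \<Rightarrow> 'l \<Rightarrow> 'k" where
  "ck_d x J l q = (\<lambda>T y. if (T, y) \<in> ck_rel x J (Suc l)
    then \<Sum>c\<in>T. ksign c (T - {c}) * q (T - {c}) y else 0)"

definition ck_e :: "'l::{finite,order} \<Rightarrow> 'l set \<Rightarrow> (unit \<Rightarrow> 'l \<Rightarrow> 'k::field) \<Rightarrow> 'l set \<Rightarrow> 'l \<Rightarrow> 'k" where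
  "ck_e x J f = (\<lambda>T y. if (T, y) \<in> ck_rel x J 0 then \<Sum>c\<in>{()}. 1 * f c y else 0)"

definition ck_k :: "'l set \<Rightarrow> ('l set \<Rightarrow> 'l \<Rightarrow> 'k::field) \<Rightarrow> 'l set \<Rightarrow> 'l::{finite,order} \<Rightarrow> 'k" where
  "ck_k J q = (\<lambda>T y. if \<exists>c\<in>J. y \<le> c then cocontr (SOME c. c \<in> J \<and> y \<le> c) (\<lambda>T. q T y) T else 0)"

lemma ck_d_cobd: "(T, y) \<in> ck_rel x J (Suc l) \<Longrightarrow> ck_d x J l q T y = cobd (\<lambda>T. q T y) T"
  by (simp add: ck_d_def cobd_def)

lemma mhom_ck_d: "mhom (conv_mod (ck_rel x J l)) (conv_mod (ck_rel x J (Suc l))) (ck_d x J l)"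
  unfolding ck_d_def
  by (rule mhom_matrix[where C = "\<lambda>T. T" and m = "\<lambda>T c. ksign c (T - {c})" and \<sigma> = "\<lambda>T c. T - {c}"])
    (simp add: ck_rel_def, clarify, auto)

lemma mhom_ck_e: "mhom (conv_mod (ck_source x J)) (conv_mod (ck_rel x J 0)) (ck_e x J)"
  unfolding ck_e_def
  by (rule mhom_matrix[where C = "\<lambda>_. {()}" and m = "\<lambda>_ _. 1" and \<sigma> = "\<lambda>_ i. i"])
    (simp add: ck_rel_def ck_source_def, blast intro: order_trans)

lemma ck_k_closed:
  assumes "q \<in> carrier (conv_mod (ck_rel x J (Suc l)))"
  shows "ck_k J q \<in> carrier (conv_mod (ck_rel x J l))"
proof -
  have "(T, y) \<in> ck_rel x J l" if nz: "ck_k J q T y \<noteq> 0" for T y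
  proof -
    define c where "c = (SOME c. c \<in> J \<and> y \<le> c)"
    have "cocontr c (\<lambda>T. q T y) T \<noteq> 0" using nz by (auto simp: ck_k_def c_def split: if_splits)
    then have "c \<notin> T" "q (insert c T) y \<noteq> 0" by (auto simp: cocontr_def split: if_splits)
    moreover from this(2) have "(insert c T, y) \<in> ck_rel x J (Suc l)" using assms by auto
    ultimately show ?thesis by (auto simp: ck_rel_def)
  qed
  then show ?thesis by auto
qed

lemma inj_res_ck:
  fixes x :: "'l::{finite,lattice}"
  shows "inj_res (conv_mod (ck_source x J) :: (('l, 'k::field) incidence_algebra, unit \<Rightarrow> 'l \<Rightarrow> 'k) right_mod)
    (\<lambda>l. conv_mod (ck_rel x J l)) (ck_d x J) (ck_e x J)"
  unfolding inj_res_def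
proof (intro conjI allI)
  let ?M = "conv_mod (ck_source x J) :: (('l, 'k) incidence_algebra, unit \<Rightarrow> 'l \<Rightarrow> 'k) right_mod"
  let ?I = "\<lambda>l. conv_mod (ck_rel x J l) :: (('l, 'k) incidence_algebra, 'l set \<Rightarrow> 'l \<Rightarrow> 'k) right_mod"
  show "right_module ?M"
    by (rule right_module_conv) (auto simp: convex_rel_def ck_source_def intro: order_trans)
  have "(T, y) \<in> ck_rel x J l \<longleftrightarrow> T \<in> {T. T \<subseteq> J \<and> card T = l} \<and> y \<le> Inf_fin (insert x T)" for T y l
    by (auto simp: ck_rel_def Inf_fin.bounded_iff)
  then show "injective (?I l)" for l by (rule injective_conv)
  show "mhom (?I l) (?I (Suc l)) (ck_d x J l)" for l by (rule mhom_ck_d)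
  show "mhom ?M (?I 0) (ck_e x J)" by (rule mhom_ck_e)
  have e: "ck_e x J f {} y = f () y" if "f \<in> carrier ?M" for f y
    using that by (auto simp: ck_e_def ck_rel_def ck_source_def)
  show "inj_on (ck_e x J) (carrier ?M)"
  proof (rule inj_onI)
    fix f g assume "f \<in> carrier ?M" "g \<in> carrier ?M" "ck_e x J f = ck_e x J g"
    then have "f () y = g () y" for y using e by metis
    then show "f = g" by (auto simp: fun_eq_iff)
  qed
  show "ck_e x J ` carrier ?M = {q \<in> carrier (?I 0). ck_d x J 0 q = \<zero>\<^bsub>?I (Suc 0)\<^esub>}"
  proof (intro equalityI subsetI)
    fix p assume "p \<in> ck_e x J ` carrier ?M"
    then obtain f where f: "f \<in> carrier ?M" "p = ck_e x J f" by blast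
    have "ck_d x J 0 p T y = 0" for T y
    proof (cases "(T, y) \<in> ck_rel x J (Suc 0)")
      case True
      then obtain c where "T = {c}" "c \<in> J" "y \<le> c" by (auto simp: ck_rel_def card_Suc_eq)
      moreover from this have "f () y = 0" using f(1) by (auto simp: ck_source_def)
      ultimately show ?thesis by (simp add: ck_d_def f(2) e[OF f(1)])
    qed (simp add: ck_d_def)
    then show "p \<in> {q \<in> carrier (?I 0). ck_d x J 0 q = \<zero>\<^bsub>?I (Suc 0)\<^esub>}"
      using mhom_closed[OF mhom_ck_e f(1)] by (simp add: fun_eq_iff f(2))
  next
    fix q assume "q \<in> {q \<in> carrier (?I 0). ck_d x J 0 q = \<zero>\<^bsub>?I (Suc 0)\<^esub>}"
    then have q: "q \<in> carrier (?I 0)" "ck_d x J 0 q = (\<lambda>_ _. 0)" by auto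
    have q0: "q {} y = 0" if ny: "\<not> (y \<le> x \<and> (\<forall>j\<in>J. \<not> y \<le> j))" for y
    proof (cases "y \<le> x")
      case True
      then obtain c where c: "c \<in> J" "y \<le> c" using ny by blast
      then have "({c}, y) \<in> ck_rel x J (Suc 0)" using True by (auto simp: ck_rel_def)
      then have "cobd (\<lambda>T. q T y) {c} = 0" using q(2) by (simp flip: ck_d_cobd)
      then have "ksign c {} * q {} y = 0" by (simp add: cobd_def)
      then show ?thesis by (simp add: ksign_def)
    next
      case False
      then show ?thesis using q(1) by (auto simp: ck_rel_def)
    qed
    have qc: "(\<lambda>_. q {}) \<in> carrier ?M" using q0 by (auto simp: ck_source_def)
    have "q = ck_e x J (\<lambda>_. q {})"
      using q(1) by (auto simp: ck_e_def ck_rel_def fun_eq_iff)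
    then show "q \<in> ck_e x J ` carrier ?M" by (rule rev_image_eqI[OF qc])
  qed
  show "ck_d x J l ` carrier (?I l) = {q \<in> carrier (?I (Suc l)). ck_d x J (Suc l) q = \<zero>\<^bsub>?I (Suc (Suc l))\<^esub>}" for l
  proof (intro equalityI subsetI)
    fix p assume "p \<in> ck_d x J l ` carrier (?I l)"
    then obtain q where q: "q \<in> carrier (?I l)" "p = ck_d x J l q" by blast
    have "ck_d x J (Suc l) p T y = 0" for T y
    proof (cases "(T, y) \<in> ck_rel x J (Suc (Suc l))")
      case True
      then have "(T - {c}, y) \<in> ck_rel x J (Suc l)" if "c \<in> T" for c
        using that by (auto simp: ck_rel_def card_Diff_singleton_if)
      then have "cobd (\<lambda>T. p T y) T = cobd (cobd (\<lambda>T. q T y)) T"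
        unfolding cobd_def[of _ T] q(2) by (intro sum.cong refl) (simp add: ck_d_cobd)
      then show ?thesis using True by (simp add: ck_d_cobd cobd_cobd)
    qed (simp add: ck_d_def)
    then show "p \<in> {q \<in> carrier (?I (Suc l)). ck_d x J (Suc l) q = \<zero>\<^bsub>?I (Suc (Suc l))\<^esub>}"
      using mhom_closed[OF mhom_ck_d q(1)] by (simp add: fun_eq_iff q(2))
  next
    fix q assume "q \<in> {q \<in> carrier (?I (Suc l)). ck_d x J (Suc l) q = \<zero>\<^bsub>?I (Suc (Suc l))\<^esub>}"
    then have q: "q \<in> carrier (?I (Suc l))" "ck_d x J (Suc l) q = (\<lambda>_ _. 0)" by auto
    have "ck_d x J l (ck_k J q) T y = q T y" for T y
    proof (cases "(T, y) \<in> ck_rel x J (Suc l)")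
      case True
      then have T: "T \<subseteq> J" "card T = Suc l" "y \<le> x" "\<And>t. t \<in> T \<Longrightarrow> y \<le> t" by (auto simp: ck_rel_def)
      then have "T \<noteq> {}" by auto
      \<comment> \<open>In positive degree \<open>T\<close> is nonempty and each of its elements can
        serve as apex, so unlike in the projective case every vertex of the support is contractible
        here.\<close>
      then have ex: "\<exists>c\<in>J. y \<le> c" using T by blast
      define c where "c = (SOME c. c \<in> J \<and> y \<le> c)"
      have c: "c \<in> J" "y \<le> c" using ex someI_ex[of "\<lambda>c. c \<in> J \<and> y \<le> c"] unfolding c_def by auto
      have "cocontr c (cobd (\<lambda>T. q T y)) T = 0"
      proof (cases "c \<in> T")
        case False
        then have "(insert c T, y) \<in> ck_rel x J (Suc (Suc l))" using T c by (auto simp: ck_rel_def)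
        then have "cobd (\<lambda>T. q T y) (insert c T) = 0" using q(2) by (simp flip: ck_d_cobd)
        then show ?thesis by (simp add: cocontr_def)
      qed (simp add: cocontr_def)
      moreover have "(\<lambda>T. ck_k J q T y) = cocontr c (\<lambda>T. q T y)"
        using ex by (simp add: ck_k_def c_def)
      ultimately show ?thesis
        using cobd_cocontr[of c "\<lambda>T. q T y" T] True by (simp add: ck_d_cobd)
    next
      case False
      then show ?thesis using q(1) by (simp add: ck_d_def)
    qed
    then have "q = ck_d x J l (ck_k J q)" by (simp add: fun_eq_iff)
    then show "q \<in> ck_d x J l ` carrier (?I l)" by (rule rev_image_eqI[OF ck_k_closed[OF q(1)]])
  qed
qed

lemma ck_zero:
  assumes "card J < l"
  shows "carrier (conv_mod (ck_rel x J l)) = {\<zero>\<^bsub>conv_mod (ck_rel x J l)\<^esub>}"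
proof -
  have "(T, y) \<notin> ck_rel x J l" for T y
    using assms card_mono[of J T] by (auto simp: ck_rel_def)
  then show ?thesis by (auto simp: fun_eq_iff)
qed

section \<open>Identification of the modules in the statement\<close>

lemma coord_idem_mult: "coord (ia_idem x * a) u y = (if u = x then coord a x y else 0)"
  by (simp add: ia_idem_def coord_simps if_distrib[of "\<lambda>t. t * _"] cong: if_cong)

text \<open>Only z = x satisfies x \<le> z \<le> x. Diagonal coordinates are thus characters of A,
  and the one at x is how A acts on the simple module.\<close>

lemma coord_mult_diag:
  fixes a b :: "('l::{finite,order}, 'k::field) incidence_algebra"
  shows "coord (a * b) x x = coord a x x * coord b x x"
proof -
  have eq: "coord a x z * coord b z x = (if z = x then coord a x x * coord b x x else 0)" for z
  proof (cases "z = x")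
    case False
    then have "coord a x z = 0 \<or> coord b z x = 0"
      using coord_eq_0[of x z a] coord_eq_0[of z x b] by (metis order_antisym)
    then show ?thesis using False by auto
  qed simp
  have "coord (a * b) x x = (\<Sum>z\<in>UNIV. if z = x then coord a x x * coord b x x else 0)"
    unfolding times_incidence_algebra.rep_eq by (rule sum.cong[OF refl eq])
  then show ?thesis by simp
qed

context
  fixes x :: "'l::{finite,order}"
begin

private abbreviation "P \<equiv> right_ideal_mod (ia_idem x) :: (('l, 'k::field) incidence_algebra, ('l, 'k) incidence_algebra) right_mod"

lemma right_ideal_idem_simps:
  fixes a b :: "('l, 'k::field) incidence_algebra"
  shows "carrier P = {a :: ('l, 'k) incidence_algebra. \<forall>u y. u \<noteq> x \<longrightarrow> coord a u y = 0}"
  "\<zero>\<^bsub>P\<^esub> = (0 :: ('l, 'k) incidence_algebra)" "a \<oplus>\<^bsub>P\<^esub> b = a + b" "a \<cdot>\<^bsub>P\<^esub> b = a * b"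
proof -
  have "range ((*) (ia_idem x)) = {a :: ('l, 'k) incidence_algebra. \<forall>u y. u \<noteq> x \<longrightarrow> coord a u y = 0}"
  proof (intro equalityI subsetI)
    fix a :: "('l, 'k) incidence_algebra" assume "a \<in> {a. \<forall>u y. u \<noteq> x \<longrightarrow> coord a u y = 0}"
    then have "a = ia_idem x * a" by (intro ia_eqI) (simp add: coord_idem_mult)
    then show "a \<in> range ((*) (ia_idem x))" by (rule range_eqI)
  qed (auto simp: coord_idem_mult)
  then show "carrier P = {a :: ('l, 'k) incidence_algebra. \<forall>u y. u \<noteq> x \<longrightarrow> coord a u y = 0}"
    by (simp add: right_ideal_mod_def)
qed (simp_all add: right_ideal_mod_def regular_mod_def make_mod_def)

lemma right_module_right_ideal:
  "right_module (P :: (_, ('l, 'k::field) incidence_algebra) right_mod)"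
proof -
  interpret abelian_group P
  proof (rule abelian_groupI)
    fix a assume "a \<in> carrier P"
    then show "\<exists>b\<in>carrier P. b \<oplus>\<^bsub>P\<^esub> a = \<zero>\<^bsub>P\<^esub>"
      by (intro bexI[of _ "- a"]) (auto simp: right_ideal_idem_simps uminus_incidence_algebra.rep_eq)
  qed (auto simp: right_ideal_idem_simps coord_simps add.assoc add.commute)
  show ?thesis
    by unfold_locales (auto simp: right_ideal_idem_simps coord_simps distrib_left distrib_right mult.assoc)
qed

text \<open>Any element of the ideal outside the submodule of those with vanishing coordinate at \<open>(x, x)\<close>
  generates it.\<close>

lemma radical_right_ideal:
  "radical (P :: (_, ('l, 'k::field) incidence_algebra) right_mod) = {a \<in> carrier P. coord a x x = 0}" (is "_ = ?N")
proof -
  have N: "submod ?N P"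
    by (rule submodI[OF right_module_right_ideal])
      (auto simp: right_ideal_idem_simps coord_simps(1,3) coord_mult_diag, auto simp: coord_simps)
  have le: "H \<subseteq> ?N" if H: "submod H P" "H \<noteq> carrier P" for H
  proof (rule ccontr)
    note H' = submodD[OF H(1)]
    assume "\<not> H \<subseteq> ?N"
    then obtain a where a: "a \<in> H" "coord a x x \<noteq> 0" using H'(1) by auto
    have "b \<in> H" if b: "b \<in> carrier P" for b
    proof -
      have "a * (ia_scale (inverse (coord a x x)) (ia_idem x * b)) \<in> H"
        using H'(4)[OF a(1)] by (simp add: right_ideal_idem_simps)
      also have "a * (ia_scale (inverse (coord a x x)) (ia_idem x * b)) = b"
      proof (rule ia_eqI)
        fix u y
        have "coord a u z = 0" if "u \<noteq> x" for z
          using that a(1) H'(1) by (auto simp: right_ideal_idem_simps)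
        moreover have "coord b u z = 0" if "u \<noteq> x" for z
          using that b by (simp add: right_ideal_idem_simps)
        ultimately show "coord (a * (ia_scale (inverse (coord a x x)) (ia_idem x * b))) u y = coord b u y"
          unfolding times_incidence_algebra.rep_eq[of a] ia_scale.rep_eq coord_idem_mult
          using a(2) by (cases "u = x") (simp_all add: if_distrib[of "\<lambda>t. _ * t"] mult.assoc[symmetric] cong: if_cong)
      qed
      finally show ?thesis .
    qed
    then show False using H H'(1) by blast
  qed
  have ne: "?N \<noteq> carrier P"
  proof -
    have "ia_idem x \<in> carrier P - ?N" unfolding right_ideal_idem_simps by (simp add: ia_idem_def coord_simps)
    then show ?thesis by blast
  qed
  have "maximal_submod H P \<longleftrightarrow> H = ?N" for H
  proof
    assume H: "maximal_submod H P"
    then have "H \<subseteq> ?N" using le by (auto simp: maximal_submod_def)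
    then show "H = ?N" using H N ne by (auto simp: maximal_submod_def)
  next
    assume "H = ?N"
    then show "maximal_submod H P" using N ne le unfolding maximal_submod_def by blast
  qed
  then have "{H. maximal_submod H P} = {?N}" by blast
  then show ?thesis by (auto simp: radical_def)
qed

text \<open>The cosets of the radical, labelled by scalars; this is the identification of the simple
  module with the field.\<close>

private definition K :: "'k::field \<Rightarrow> ('l, 'k) incidence_algebra set" where
  "K c = {a \<in> carrier P. coord a x x = c}"

private lemma K_nonempty: "ia_scale c (ia_idem x) \<in> K c"
  unfolding K_def right_ideal_idem_simps by (simp add: ia_idem_def coord_simps)

private lemma K_inj: "K c = K d \<longleftrightarrow> c = d"
  using K_nonempty[of c] by (auto simp: K_def)

private lemma K_coset:
  assumes "a \<in> carrier P"
  shows "K 0 +>\<^bsub>P\<^esub> a = K (coord a x x)"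
proof (intro equalityI subsetI)
  fix b assume "b \<in> K (coord a x x)"
  then have "b - a \<in> K 0" "b = (b - a) \<oplus>\<^bsub>P\<^esub> a"
    using assms by (auto simp: K_def right_ideal_idem_simps minus_incidence_algebra.rep_eq)
  then show "b \<in> K 0 +>\<^bsub>P\<^esub> a" unfolding a_r_coset_def' by blast
qed (use assms in \<open>auto simp: a_r_coset_def' K_def right_ideal_idem_simps coord_simps\<close>)

lemma simple_mod_simps:
  "carrier (simple_mod x) = range (K :: 'k::field \<Rightarrow> _)"
  "\<zero>\<^bsub>simple_mod x\<^esub> = K (0 :: 'k)"
  "K c \<oplus>\<^bsub>simple_mod x\<^esub> K d = K (c + d :: 'k)"
  "K c \<cdot>\<^bsub>simple_mod x\<^esub> a = K (c * coord a x x :: 'k)"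
proof -
  have N: "radical (P :: (_, ('l, 'k) incidence_algebra) right_mod) = K 0" by (simp add: radical_right_ideal K_def)
  have "carrier (simple_mod x) = (\<lambda>a. K (coord a x x)) ` carrier (P :: (_, ('l, 'k) incidence_algebra) right_mod)"
    by (auto simp: simple_mod_def top_mod_def quotient_mod_def make_mod_def N A_RCOSETS_def' K_coset)
  also have "\<dots> = range K"
  proof (intro equalityI subsetI)
    fix k assume "k \<in> range (K :: 'k \<Rightarrow> _)"
    then obtain c where "k = K c" by blast
    then show "k \<in> (\<lambda>a. K (coord a x x)) ` carrier P"
      using K_nonempty[of c] by (intro image_eqI[of _ _ "ia_scale c (ia_idem x)"]) (auto simp: K_def)
  qed blast
  finally show "carrier (simple_mod x) = range (K :: 'k \<Rightarrow> _)" .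
  show "\<zero>\<^bsub>simple_mod x\<^esub> = K (0 :: 'k)"
    by (simp add: simple_mod_def top_mod_def quotient_mod_def make_mod_def N)
  have "K c <+>\<^bsub>P\<^esub> K d = K (c + d)" for c d :: 'k
  proof (intro equalityI subsetI)
    fix b assume b: "b \<in> K (c + d)"
    have "b - ia_scale d (ia_idem x) \<in> K c"
      using b K_nonempty[of d] by (auto simp: K_def right_ideal_idem_simps minus_incidence_algebra.rep_eq)
    moreover have "b = (b - ia_scale d (ia_idem x)) \<oplus>\<^bsub>P\<^esub> ia_scale d (ia_idem x)"
      by (simp add: right_ideal_idem_simps)
    ultimately show "b \<in> K c <+>\<^bsub>P\<^esub> K d" using K_nonempty[of d] unfolding set_add_def' by blast
  qed (auto simp: set_add_def' K_def right_ideal_idem_simps coord_simps)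
  then show "K c \<oplus>\<^bsub>simple_mod x\<^esub> K d = K (c + d :: 'k)"
    by (simp add: simple_mod_def top_mod_def quotient_mod_def make_mod_def)
  interpret P: right_module P by (rule right_module_right_ideal)
  have "K 0 +>\<^bsub>P\<^esub> (b \<cdot>\<^bsub>P\<^esub> a) = K (c * coord a x x)" if "b \<in> K c" for b
    using that P.act_closed[of b a] by (subst K_coset) (auto simp: K_def right_ideal_idem_simps(4) coord_mult_diag)
  then have "(\<Union>b\<in>K c. K 0 +>\<^bsub>P\<^esub> (b \<cdot>\<^bsub>P\<^esub> a)) = K (c * coord a x x)"
    using K_nonempty[of c] by blast
  then show "K c \<cdot>\<^bsub>simple_mod x\<^esub> a = K (c * coord a x x)"
    by (simp add: simple_mod_def top_mod_def quotient_mod_def make_mod_def N)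
qed

lemma right_module_simple:
  "right_module (simple_mod x :: (('l, 'k::field) incidence_algebra, ('l, 'k) incidence_algebra set) right_mod)"
  (is "right_module ?S")
proof -
  interpret abelian_group ?S
  proof (rule abelian_groupI)
    fix k assume "k \<in> carrier ?S"
    then obtain c where "k = K c" by (auto simp: simple_mod_simps)
    then show "\<exists>k'\<in>carrier ?S. k' \<oplus>\<^bsub>?S\<^esub> k = \<zero>\<^bsub>?S\<^esub>"
      by (intro bexI[of _ "K (- c)"]) (simp_all add: simple_mod_simps)
  qed (auto simp: simple_mod_simps algebra_simps)
  show ?thesis
    by unfold_locales (auto simp: simple_mod_simps coord_simps(2,3) coord_mult_diag algebra_simps)
qed

lemma simple_mod_iso:
  obtains f g where "mod_iso (conv_mod {((), x)}) (simple_mod x ::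
    (('l, 'k::field) incidence_algebra, ('l, 'k) incidence_algebra set) right_mod) f g"
proof -
  let ?S = "simple_mod x :: (('l, 'k) incidence_algebra, ('l, 'k) incidence_algebra set) right_mod"
  let ?f = "\<lambda>v :: unit \<Rightarrow> 'l \<Rightarrow> 'k. K (v () x)"
  have f: "mhom (conv_mod {((), x)}) ?S ?f"
  proof (rule mhomI)
    fix v :: "unit \<Rightarrow> 'l \<Rightarrow> 'k" and a assume v: "v \<in> carrier (conv_mod {((), x)})"
    then have "(\<Sum>u\<in>UNIV. v () u * coord a u x) = (\<Sum>u\<in>UNIV. if u = x then v () x * coord a x x else 0)"
      by (intro sum.cong) auto
    then show "?f (v \<cdot>\<^bsub>conv_mod {((), x)}\<^esub> a) = ?f v \<cdot>\<^bsub>?S\<^esub> a"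
      by (simp add: simple_mod_simps conv_mod_simps(4))
  qed (auto simp: simple_mod_simps)
  have bij: "bij_betw ?f (carrier (conv_mod {((), x)})) (carrier ?S)"
  proof (rule bij_betwI')
    fix v w :: "unit \<Rightarrow> 'l \<Rightarrow> 'k"
    assume vw: "v \<in> carrier (conv_mod {((), x)})" "w \<in> carrier (conv_mod {((), x)})"
    have "v = w" if eq: "v () x = w () x"
    proof (intro ext)
      show "v i y = w i y" for i y using vw eq by (cases "y = x") auto
    qed
    then show "?f v = ?f w \<longleftrightarrow> v = w" by (auto simp: K_inj)
  next
    fix k assume "k \<in> carrier ?S"
    then obtain c where "k = K c" by (auto simp: simple_mod_simps)
    then show "\<exists>v\<in>carrier (conv_mod {((), x)}). k = ?f v"
      by (intro bexI[of _ "\<lambda>_ y. if y = x then c else 0"]) auto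
  qed (auto simp: simple_mod_simps)
  have "convex_rel {((), x)}" by (auto simp: convex_rel_def)
  from mod_isoI_bij[OF right_module_conv[OF this] f bij] show thesis by (rule that)
qed

end

section \<open>The regular module and its dual\<close>

lemma right_module_regular: "right_module (regular_mod :: ('a::ring_1, 'a) right_mod)"
proof -
  have simps: "carrier regular_mod = UNIV" "\<zero>\<^bsub>regular_mod\<^esub> = (0 :: 'a)"
    "a \<oplus>\<^bsub>regular_mod\<^esub> b = a + b" "a \<cdot>\<^bsub>regular_mod\<^esub> b = a * b" for a b :: 'a
    by (simp_all add: regular_mod_def make_mod_def)
  interpret abelian_group "regular_mod :: ('a, 'a) right_mod"
  proof (rule abelian_groupI)
    show "\<exists>b\<in>carrier regular_mod. b \<oplus>\<^bsub>regular_mod\<^esub> a = \<zero>\<^bsub>regular_mod\<^esub>" for a :: 'a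
      by (intro bexI[of _ "- a"]) (simp_all add: simps)
  qed (simp_all add: simps algebra_simps)
  show ?thesis by unfold_locales (simp_all add: simps algebra_simps)
qed

text \<open>The rows of an element are its components in the right ideals of the vertex idempotents,
  so the morphisms of the type definition are already the isomorphism.\<close>

lemma regular_mod_iso:
  "mod_iso (conv_mod {(w, y). w \<le> y}) (regular_mod :: (_, ('l::{finite,order}, 'k::field) incidence_algebra) right_mod) Abs_ia coord"
proof -
  have simps: "carrier regular_mod = UNIV" "a \<oplus>\<^bsub>regular_mod\<^esub> b = a + b" "a \<cdot>\<^bsub>regular_mod\<^esub> b = a * b"
    for a b :: "('l, 'k) incidence_algebra"
    by (simp_all add: regular_mod_def make_mod_def)
  have cA: "coord (Abs_ia v) = v" if "v \<in> carrier (conv_mod {(w, y). w \<le> y})" for v :: "'l \<Rightarrow> 'l \<Rightarrow> 'k"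
    using that by (intro Abs_ia_inverse) auto
  have coord: "mhom (regular_mod :: (_, ('l, 'k) incidence_algebra) right_mod) (conv_mod {(w, y). w \<le> y}) coord"
  proof (rule mhomI)
    fix a b :: "('l, 'k) incidence_algebra"
    show "coord (a \<cdot>\<^bsub>regular_mod\<^esub> b) = coord a \<cdot>\<^bsub>conv_mod {(w, y). w \<le> y}\<^esub> b"
    proof (intro ext)
      show "coord (a \<cdot>\<^bsub>regular_mod\<^esub> b) w y = (coord a \<cdot>\<^bsub>conv_mod {(w, y). w \<le> y}\<^esub> b) w y" for w y
        using coord_eq_0[of w y "a * b"] by (auto simp: simps conv_mod_simps(4) times_incidence_algebra.rep_eq)
    qed
  qed (auto simp: simps coord_simps coord_eq_0 fun_eq_iff)
  have inj: "a = b" if "coord a = coord b" for a b :: "('l, 'k) incidence_algebra"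
    using that by (simp add: coord_inject)
  have "convex_rel {(w :: 'l, y). w \<le> y}" by (auto simp: convex_rel_def)
  then interpret right_module "conv_mod {(w, y). w \<le> y} :: (('l, 'k) incidence_algebra, _) right_mod"
    by (rule right_module_conv)
  have "mhom (conv_mod {(w, y). w \<le> y}) (regular_mod :: (_, ('l, 'k) incidence_algebra) right_mod) Abs_ia"
  proof (rule mhomI)
    fix v v' :: "'l \<Rightarrow> 'l \<Rightarrow> 'k" and a
    assume v: "v \<in> carrier (conv_mod {(w, y). w \<le> y})"
    show "Abs_ia (v \<cdot>\<^bsub>conv_mod {(w, y). w \<le> y}\<^esub> a) = Abs_ia v \<cdot>\<^bsub>regular_mod\<^esub> a"
      using v mhom_act[OF coord, of "Abs_ia v" a] by (intro inj) (simp only: cA act_closed simps UNIV_I)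
    assume v': "v' \<in> carrier (conv_mod {(w, y). w \<le> y})"
    show "Abs_ia (v \<oplus>\<^bsub>conv_mod {(w, y). w \<le> y}\<^esub> v') = Abs_ia v \<oplus>\<^bsub>regular_mod\<^esub> Abs_ia v'"
      using v v' mhom_add[OF coord, of "Abs_ia v" "Abs_ia v'"] by (intro inj) (simp only: cA a_closed simps UNIV_I)
  qed (simp add: simps)
  then show ?thesis
    using coord cA by (simp only: mod_iso_def simps coord_inverse) blast
qed

lemma linear_ia_iff:
  fixes \<phi> :: "('l::{finite,order}, 'k::field) incidence_algebra \<Rightarrow> 'k"
  shows "Vector_Spaces.linear ia_scale (*) \<phi> \<longleftrightarrow>
    (\<forall>a b. \<phi> (a + b) = \<phi> a + \<phi> b) \<and> (\<forall>c a. \<phi> (ia_scale c a) = c * \<phi> a)"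
proof -
  have "vector_space ((*) :: 'k \<Rightarrow> 'k \<Rightarrow> 'k)" by unfold_locales (auto simp: algebra_simps)
  then show ?thesis by (auto simp: Vector_Spaces.linear_iff vector_space_ia)
qed

lemma dual_mod_simps:
  "carrier dual_mod = {\<phi>. (\<forall>a b. \<phi> (a + b) = \<phi> a + \<phi> b) \<and> (\<forall>c a. \<phi> (ia_scale c a) = c * \<phi> a)}"
  "\<zero>\<^bsub>dual_mod\<^esub> = (\<lambda>_. 0)" "\<phi> \<oplus>\<^bsub>dual_mod\<^esub> \<psi> = (\<lambda>b. \<phi> b + \<psi> b)" "\<phi> \<cdot>\<^bsub>dual_mod\<^esub> a = (\<lambda>b. \<phi> (a * b))"
  by (simp_all add: dual_mod_def make_mod_def linear_ia_iff)

lemma right_module_dual: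
  "right_module (dual_mod :: (('l::{finite,order}, 'k::field) incidence_algebra, _) right_mod)"
proof -
  let ?D = "dual_mod :: (('l, 'k) incidence_algebra, _) right_mod"
  interpret abelian_group ?D
  proof (rule abelian_groupI)
    show "\<exists>\<psi>\<in>carrier ?D. \<psi> \<oplus>\<^bsub>?D\<^esub> \<phi> = \<zero>\<^bsub>?D\<^esub>" if "\<phi> \<in> carrier ?D" for \<phi>
      using that by (intro bexI[of _ "\<lambda>b. - \<phi> b"]) (auto simp: dual_mod_simps)
  qed (auto simp: dual_mod_simps algebra_simps)
  show ?thesis
    by unfold_locales (auto simp: dual_mod_simps algebra_simps ia_scale_mult(2)[symmetric])
qed

text \<open>A functional is determined by its values on the basis. Those on basis elements ending in
  a fixed w form D(A e_w), the constant representation on the down-set of w.\<close>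

lemma dual_mod_iso:
  obtains f g where "mod_iso (conv_mod {(w, y). y \<le> w})
    (dual_mod :: (('l::{finite,order}, 'k::field) incidence_algebra, _) right_mod) f g"
proof -
  let ?D = "dual_mod :: (('l, 'k) incidence_algebra, _) right_mod"
  let ?C = "conv_mod {(w, y). y \<le> w} :: (('l, 'k) incidence_algebra, 'l \<Rightarrow> 'l \<Rightarrow> 'k) right_mod"
  let ?g = "\<lambda>\<phi> w y. \<phi> (ia_basis y w)"
  have zero: "\<phi> 0 = 0" if "\<phi> \<in> carrier ?D" for \<phi>
  proof -
    have "\<phi> (ia_scale 0 0) = 0 * \<phi> 0" using that unfolding dual_mod_simps(1) by blast
    moreover have "ia_scale 0 0 = (0 :: ('l, 'k) incidence_algebra)" by (rule ia_eqI) (simp add: coord_simps)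
    ultimately show ?thesis by simp
  qed
  have sum: "\<phi> (\<Sum>i\<in>I. f i) = (\<Sum>i\<in>I. \<phi> (f i))" if "\<phi> \<in> carrier ?D" for \<phi> f and I :: "'i set"
    using that zero[OF that] by (induction I rule: infinite_finite_induct) (auto simp: dual_mod_simps)
  have basis0: "ia_basis y w = (0 :: ('l, 'k) incidence_algebra)" if "\<not> y \<le> w" for y w
    using that by (intro ia_eqI) (simp add: coord_simps)
  have g: "mhom ?D ?C ?g"
  proof (rule mhomI)
    fix \<phi> and a :: "('l, 'k) incidence_algebra" assume \<phi>: "\<phi> \<in> carrier ?D"
    show "?g \<phi> \<in> carrier ?C" using zero[OF \<phi>] by (auto simp: basis0)
    show "?g (\<phi> \<cdot>\<^bsub>?D\<^esub> a) = ?g \<phi> \<cdot>\<^bsub>?C\<^esub> a"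
    proof (intro ext)
      fix w y
      show "?g (\<phi> \<cdot>\<^bsub>?D\<^esub> a) w y = (?g \<phi> \<cdot>\<^bsub>?C\<^esub> a) w y"
      proof (cases "y \<le> w")
        case True
        have "\<phi> (a * ia_basis y w) = (\<Sum>u\<in>UNIV. coord a u y * \<phi> (ia_basis u w))"
          unfolding mult_ia_basis[OF True] sum[OF \<phi>] using \<phi> by (simp add: dual_mod_simps)
        then show ?thesis using True by (simp add: dual_mod_simps(4) conv_mod_simps(4) mult.commute)
      qed (use zero[OF \<phi>] in \<open>simp add: dual_mod_simps(4) conv_mod_simps(4) basis0\<close>)
    qed
  qed (simp add: dual_mod_simps)
  have expand: "\<phi> a = (\<Sum>(y, w) | y \<le> w. coord a y w * \<phi> (ia_basis y w))" if "\<phi> \<in> carrier ?D" for \<phi> a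
  proof -
    have "\<phi> a = \<phi> (\<Sum>(y, w) | y \<le> w. ia_scale (coord a y w) (ia_basis y w))"
      using ia_basis_expansion[of a] by simp
    also have "\<dots> = (\<Sum>p\<in>{(y, w). y \<le> w}. \<phi> (case p of (y, w) \<Rightarrow> ia_scale (coord a y w) (ia_basis y w)))"
      by (rule sum[OF that])
    also have "\<dots> = (\<Sum>(y, w) | y \<le> w. coord a y w * \<phi> (ia_basis y w))"
      using that by (intro sum.cong) (auto simp: dual_mod_simps)
    finally show ?thesis .
  qed
  have "bij_betw ?g (carrier ?D) (carrier ?C)"
  proof (rule bij_betwI')
    fix \<phi> \<psi> assume \<phi>: "\<phi> \<in> carrier ?D" and \<psi>: "\<psi> \<in> carrier ?D"
    have "\<phi> = \<psi>" if "?g \<phi> = ?g \<psi>"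
    proof
      have "\<phi> (ia_basis y w) = \<psi> (ia_basis y w)" for y w using that by (simp add: fun_eq_iff)
      then show "\<phi> a = \<psi> a" for a unfolding expand[OF \<phi>, of a] expand[OF \<psi>, of a] by simp
    qed
    then show "?g \<phi> = ?g \<psi> \<longleftrightarrow> \<phi> = \<psi>" by blast
  next
    fix v assume v: "v \<in> carrier ?C"
    let ?\<phi> = "\<lambda>a. \<Sum>y\<in>UNIV. \<Sum>w\<in>UNIV. coord a y w * v w y"
    have "?\<phi> \<in> carrier ?D"
      by (simp add: dual_mod_simps coord_simps sum.distrib algebra_simps sum_distrib_left)
    moreover have "?\<phi> (ia_basis y w) = v w y" for w y
    proof -
      have "y \<le> w \<or> v w y = 0" using v by auto
      then have "coord (ia_basis y w) y' w' * v w' y' = (if w' = w then if y' = y then v w y else 0 else 0)" for y' w'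
        by (auto simp: coord_simps)
      then show ?thesis by simp
    qed
    then have "v = ?g ?\<phi>" by (simp add: fun_eq_iff)
    ultimately show "\<exists>\<phi>\<in>carrier ?D. v = ?g \<phi>" by (intro bexI[of _ ?\<phi>])
  qed (use mhom_closed[OF g] in simp)
  then show thesis using that mod_iso_sym[OF mod_isoI_bij[OF right_module_dual g]] by blast
qed

section \<open>Computing Ext and the dimensions\<close>

text \<open>Any resolution, on whatever type, yields one on the standard type, so the choice in
  \<open>Ext\<close> does pick a resolution. Since \<open>hom_exact\<close> transfers between
  resolutions, vanishing can be tested on the given one.\<close>

lemma trivial_Ext_iff:
  fixes Q :: "nat \<Rightarrow> ('a::ring_1, 'p) right_mod"
  assumes Q: "proj_res M Q d e" and N: "right_module N"
  shows "trivial_group (Ext l M N) \<longleftrightarrow> hom_exact Q d N l"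
proof -
  let ?R = "\<lambda>(P :: nat \<Rightarrow> 'a std_mod, d, \<epsilon>). projective_resolution M P d \<epsilon>"
  obtain P0 :: "nat \<Rightarrow> 'a std_mod" and d0 e0 where "projective_resolution M P0 d0 e0"
    by (rule proj_res_std[OF Q])
  then have "?R (P0, d0, e0)" by simp
  then have some: "?R (SOME r. ?R r)" by (rule someI)
  obtain P d' e' where eq: "(SOME r. ?R r) = (P, d', e')" by (rule prod_cases3)
  have "projective_resolution M P d' e'" using some unfolding eq by simp
  then have P: "proj_res M P d' e'" by (rule projective_resolution_proj_res[OF proj_resD(1)[OF Q]])
  have "trivial_group (Ext l M N) \<longleftrightarrow> hom_exact P d' N l"
    by (simp add: Ext_def eq trivial_hom_cohomology_iff[OF P N])
  then show ?thesis using hom_exact_transfer[OF P Q N] hom_exact_transfer[OF Q P N] by blast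
qed

lemma Inf_enat_eq:
  assumes "R n" "\<And>l. l < n \<Longrightarrow> \<not> R l"
  shows "Inf {enat l |l. R l} = enat n"
proof (rule antisym)
  show "Inf {enat l |l. R l} \<le> enat n" using assms(1) by (auto intro: Inf_lower)
  show "enat n \<le> Inf {enat l |l. R l}"
    using assms(2) by (intro Inf_greatest) (auto simp flip: not_less)
qed

lemma hom_exact_source_zero:
  assumes "proj_res M P d e" "right_module N" "carrier (P l) = {\<zero>\<^bsub>P l\<^esub>}"
  shows "hom_exact P d N l"
  unfolding hom_exact_def
proof (intro allI impI, elim conjE)
  note P = proj_resD[OF assms(1)]
  fix f assume "mhom (P l) N f"
  then have f0: "f p = \<zero>\<^bsub>N\<^esub>" if "p \<in> carrier (P l)" for p
    using that assms(3) mhom_zero[OF P(3) assms(2)] by simp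
  show "case l of 0 \<Rightarrow> \<forall>p\<in>carrier (P 0). f p = \<zero>\<^bsub>N\<^esub>
    | Suc i \<Rightarrow> \<exists>g. mhom (P i) N g \<and> (\<forall>p\<in>carrier (P (Suc i)). f p = g (d i p))"
  proof (cases l)
    case (Suc i)
    have "mhom (P i) N (\<lambda>_. \<zero>\<^bsub>N\<^esub>)" by (rule mhom_const_zero[OF assms(2)])
    then show ?thesis unfolding Suc nat.case using f0 Suc by blast
  qed (use f0 in simp)
qed

text \<open>A resolution ending before degree n has zero term there, hence no cohomology in degree n
  for any coefficients; by transfer this would contradict the nonvanishing on
  \<open>Q\<close>.\<close>

lemma pdim_eqI:
  assumes Q: "proj_res M Q d e" and zero: "\<And>i. i > n \<Longrightarrow> carrier (Q i) = {\<zero>\<^bsub>Q i\<^esub>}"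
    and N: "right_module N" and ex: "\<not> hom_exact Q d N n"
  shows "pdim M = enat n"
  unfolding pdim_def
proof (rule Inf_enat_eq)
  show "\<exists>P d \<epsilon>. projective_resolution M P d \<epsilon> \<and> (\<forall>i>n. carrier (P i) = {\<zero>\<^bsub>P i\<^esub>})"
    using proj_res_std[OF Q] zero by metis
  fix l assume "l < n"
  show "\<not> (\<exists>P d \<epsilon>. projective_resolution M P d \<epsilon> \<and> (\<forall>i>l. carrier (P i) = {\<zero>\<^bsub>P i\<^esub>}))"
  proof
    assume "\<exists>P d \<epsilon>. projective_resolution M P d \<epsilon> \<and> (\<forall>i>l. carrier (P i) = {\<zero>\<^bsub>P i\<^esub>})"
    then obtain P d' e' where "projective_resolution M P d' e'" "\<forall>i>l. carrier (P i) = {\<zero>\<^bsub>P i\<^esub>}"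
      by blast
    then have P: "proj_res M P d' e'" "carrier (P n) = {\<zero>\<^bsub>P n\<^esub>}"
      using projective_resolution_proj_res[OF proj_resD(1)[OF Q]] \<open>l < n\<close> by blast+
    then show False using ex hom_exact_transfer[OF P(1) Q N hom_exact_source_zero[OF P(1) N P(2)]] by blast
  qed
qed

text \<open>The lower bound uses a test module \<open>X\<close> with nonvanishing Ext into
  \<open>N\<close> in degree n, since a shorter injective resolution kills Ext there for every
  \<open>X\<close>.\<close>

lemma idim_eqI:
  assumes I: "inj_res N I \<delta> \<eta>" and zero: "\<And>i. i > n \<Longrightarrow> carrier (I i) = {\<zero>\<^bsub>I i\<^esub>}"
    and P: "proj_res X P d e" and ex: "\<not> hom_exact P d N n"
  shows "idim N = enat n"
  unfolding idim_def
proof (rule Inf_enat_eq)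
  show "\<exists>I d \<eta>. injective_resolution N I d \<eta> \<and> (\<forall>i>n. carrier (I i) = {\<zero>\<^bsub>I i\<^esub>})"
    using inj_res_std[OF I] zero by metis
  fix l assume l: "l < n"
  show "\<not> (\<exists>I d \<eta>. injective_resolution N I d \<eta> \<and> (\<forall>i>l. carrier (I i) = {\<zero>\<^bsub>I i\<^esub>}))"
  proof
    assume "\<exists>I d \<eta>. injective_resolution N I d \<eta> \<and> (\<forall>i>l. carrier (I i) = {\<zero>\<^bsub>I i\<^esub>})"
    then obtain J \<delta>' \<eta>' where "injective_resolution N J \<delta>' \<eta>'" and J0: "\<forall>i>l. carrier (J i) = {\<zero>\<^bsub>J i\<^esub>}"
      by blast
    then have J: "inj_res N J \<delta>' \<eta>'" using injective_resolution_inj_res[OF inj_resD(1)[OF I]] by blast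
    have "hom_exact P d N n" by (rule hom_exact_ge[OF P J, of "Suc l"]) (use J0 l in auto)
    then show False using ex by blast
  qed
qed

section \<open>Covers in finite distributive lattices\<close>

lemma ex_cov_le:
  fixes x y :: "'l::{finite,order}"
  assumes "x < y"
  shows "\<exists>c\<in>cov x. c \<le> y"
proof -
  obtain c where c: "c \<in> {z. x < z \<and> z \<le> y}" "\<And>z. z \<in> {z. x < z \<and> z \<le> y} \<Longrightarrow> z \<le> c \<Longrightarrow> c = z"
    using finite_has_minimal[of "{z. x < z \<and> z \<le> y}"] assms by auto
  have "c \<in> cov x" unfolding cov_def
  proof (intro CollectI conjI notI)
    assume "\<exists>z. x < z \<and> z < c"
    then obtain z where "x < z" "z < c" by blast
    moreover from this have "z \<le> y" using c(1) by (auto intro: order_trans less_imp_le)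
    ultimately show False using c(2)[of z] less_imp_le[of z c] by auto
  qed (use c(1) in simp)
  then show ?thesis using c(1) by auto
qed

lemma ex_cocov_ge:
  fixes x y :: "'l::{finite,order}"
  assumes "y < x"
  shows "\<exists>c\<in>cocov x. y \<le> c"
proof -
  obtain c where c: "c \<in> {z. z < x \<and> y \<le> z}" "\<And>z. z \<in> {z. z < x \<and> y \<le> z} \<Longrightarrow> c \<le> z \<Longrightarrow> c = z"
    using finite_has_maximal[of "{z. z < x \<and> y \<le> z}"] assms by auto
  have "c \<in> cocov x" unfolding cocov_def
  proof (intro CollectI conjI notI)
    assume "\<exists>z. c < z \<and> z < x"
    then obtain z where "c < z" "z < x" by blast
    moreover from this have "y \<le> z" using c(1) by (auto intro: order_trans less_imp_le)
    ultimately show False using c(2)[of z] less_imp_le[of c z] by auto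
  qed (use c(1) in simp)
  then show ?thesis using c(1) by auto
qed

lemma inf_cov_le:
  fixes x :: "'l::{finite,lattice}"
  assumes "c \<in> cov x" "c' \<in> cov x" "c \<noteq> c'"
  shows "inf c c' \<le> x"
proof -
  have "x \<le> inf c c'" "inf c c' \<le> c" "inf c c' \<le> c'" using assms by (auto simp: cov_def)
  moreover have "\<not> (x < inf c c' \<and> inf c c' < c)" "\<not> (x < inf c c' \<and> inf c c' < c')"
    using assms by (auto simp: cov_def)
  ultimately show ?thesis using assms(3) by (metis order.order_iff_strict)
qed

lemma sup_cocov_ge:
  fixes x :: "'l::{finite,lattice}"
  assumes "c \<in> cocov x" "c' \<in> cocov x" "c \<noteq> c'"
  shows "x \<le> sup c c'"
proof -
  have "sup c c' \<le> x" "c \<le> sup c c'" "c' \<le> sup c c'" using assms by (auto simp: cocov_def)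
  moreover have "\<not> (c < sup c c' \<and> sup c c' < x)" "\<not> (c' < sup c c' \<and> sup c c' < x)"
    using assms by (auto simp: cocov_def)
  ultimately show ?thesis using assms(3) by (metis order.order_iff_strict)
qed

lemma sup_cocov_ge':
  fixes x :: "'l::{finite,lattice}"
  assumes "c \<in> cocov x" "t \<le> x" "\<not> t \<le> c"
  shows "x \<le> sup c t"
proof -
  have "c < sup c t" using assms(3) by (metis sup.cobounded1 sup.cobounded2 order.order_iff_strict)
  moreover have "sup c t \<le> x" using assms by (auto simp: cocov_def)
  ultimately show ?thesis using assms(1) by (auto simp: cocov_def order.order_iff_strict)
qed

lemma kz_gen_upper:
  fixes b :: "'w \<Rightarrow> 'l::{finite,lattice}"
  shows "b w \<le> kz_gen b (w, T)" "t \<in> T \<Longrightarrow> t \<le> kz_gen b (w, T)"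
  using kz_gen_le_iff[of b w T "kz_gen b (w, T)"] by auto

lemma kz_gen_insert:
  fixes b :: "'w \<Rightarrow> 'l::{finite,lattice}"
  shows "kz_gen b (w, insert t T) = sup t (kz_gen b (w, T))"
proof (rule order.antisym)
  show "kz_gen b (w, insert t T) \<le> sup t (kz_gen b (w, T))"
    using kz_gen_upper(1)[where b = b and w = w and T = T] kz_gen_upper(2)[where b = b and w = w and T = T] by (auto simp: kz_gen_le_iff intro: le_supI2)
  show "sup t (kz_gen b (w, T)) \<le> kz_gen b (w, insert t T)"
    using kz_gen_upper(1)[where b = b and w = w and T = "insert t T"] kz_gen_upper(2)[where b = b and w = w and T = "insert t T"] by (auto simp: kz_gen_le_iff)
qed

subsection \<open>Grade\<close>

context
  fixes x :: "'l::{finite,distrib_lattice}"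
begin

private abbreviation "z T \<equiv> kz_gen (\<lambda>_::unit. x) ((), T)"

text \<open>Distributivity splits the meet of c with a join of other covers into meets of two
  distinct covers, each of which is at most x.\<close>

lemma inf_cov_kz_gen_le:
  assumes "c \<in> cov x"
  shows "U \<subseteq> cov x - {c} \<Longrightarrow> inf c (z U) \<le> x"
  using finite[of U]
proof (induction U rule: finite_induct)
  case empty
  then show ?case by (simp add: kz_gen_def)
next
  case (insert u U)
  then have "inf c u \<le> x" "inf c (z U) \<le> x" using inf_cov_le[OF assms, of u] by auto
  then show ?case by (simp add: kz_gen_insert inf_sup_distrib1)
qed

lemma kz_gen_mono: "T \<subseteq> T' \<Longrightarrow> z T \<le> z T'"
  using kz_gen_upper(1)[where b = "\<lambda>_. x" and w = "()" and T = T'] kz_gen_upper(2)[where b = "\<lambda>_. x" and w = "()" and T = T'] by (auto simp: kz_gen_le_iff)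

text \<open>This is closure under intersection for the sets with join above j, in the form needed
  for a contraction: if c can be removed from the full set of covers, then it can be removed from
  every set in the family. By distributivity the two joins meet in the join of
  \<open>T\<close>.\<close>

lemma le_kz_gen_delete:
  assumes "c \<in> cov x" "T \<subseteq> cov x" "c \<notin> T" "j \<le> z (insert c T)" "j \<le> z (cov x - {c})"
  shows "j \<le> z T"
proof -
  have le: "z T \<le> z (cov x - {c})" using assms by (intro kz_gen_mono) auto
  have "j \<le> inf (sup c (z T)) (z (cov x - {c}))" using assms by (simp add: kz_gen_insert)
  also have "\<dots> = sup (inf c (z (cov x - {c}))) (inf (z T) (z (cov x - {c})))"
    by (simp add: inf_sup_distrib2)
  also have "\<dots> \<le> z T"
  proof -
    have "inf c (z (cov x - {c})) \<le> x" by (rule inf_cov_kz_gen_le[OF assms(1)]) simp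
    moreover have "x \<le> z T" by (rule kz_gen_upper(1))
    ultimately show ?thesis by (auto intro: order_trans le_infI1)
  qed
  finally show ?thesis .
qed

lemma kz_gen_cov_less:
  assumes "T \<subseteq> cov x" "T \<noteq> cov x"
  shows "\<not> z (cov x) \<le> z T"
proof
  assume le: "z (cov x) \<le> z T"
  obtain c where c: "c \<in> cov x" "c \<notin> T" using assms by blast
  have "z T \<le> z (cov x - {c})" using c assms by (intro kz_gen_mono) auto
  then have "c \<le> z (cov x - {c})"
    using le kz_gen_upper(2)[OF c(1), where b = "\<lambda>_. x" and w = "()"] by (auto intro: order_trans)
  then have "c \<le> x" using inf_cov_kz_gen_le[OF c(1), of "cov x - {c}"] by (simp add: inf_absorb1)
  then show False using c(1) by (auto simp: cov_def)
qed

private abbreviation "Q l \<equiv> conv_mod (kz_rel (\<lambda>_::unit. x) (\<lambda>_. cov x) l)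
  :: (('l, 'k::field) incidence_algebra, unit \<times> 'l set \<Rightarrow> 'l \<Rightarrow> 'k) right_mod"
private abbreviation "\<delta> l \<equiv> kz_d (\<lambda>_::unit. x) (\<lambda>_. cov x) l"
private abbreviation "N \<equiv> conv_mod {(w, y). w \<le> y}
  :: (('l, 'k::field) incidence_algebra, 'l \<Rightarrow> 'l \<Rightarrow> 'k) right_mod"

private lemma convex_le: "convex_rel {(w :: 'l, y). w \<le> y}"
  by (auto simp: convex_rel_def)

private lemma unit_vec_closed:
  assumes "T \<subseteq> cov x" "card T = l"
  shows "unit_vec ((), T) (z T) \<in> carrier (Q l)"
proof -
  have "(((), T), z T) \<in> kz_rel (\<lambda>_::unit. x) (\<lambda>_. cov x) l"
    using assms by (simp add: kz_rel_iff kz_index_def)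
  then show ?thesis by (auto simp: unit_vec_def)
qed

text \<open>Homomorphisms from \<open>Q l\<close> to \<open>A\<close> are matrices \<open>\<phi>\<close>, and composition with the differential
  becomes \<^const>\<open>cobd\<close>.\<close>

private lemma hom_matrix:
  fixes f :: "(unit \<times> 'l set \<Rightarrow> 'l \<Rightarrow> 'k::field) \<Rightarrow> 'l \<Rightarrow> 'l \<Rightarrow> 'k"
  assumes f: "mhom (Q l) N f"
  shows "\<exists>\<phi>. (\<forall>j T. \<phi> j T \<noteq> 0 \<longrightarrow> T \<subseteq> cov x \<and> card T = l \<and> j \<le> z T) \<and>
    (\<forall>q j y. q \<in> carrier (Q l) \<longrightarrow> f q j y = (if j \<le> y then \<Sum>T\<in>Pow (cov x). \<phi> j T * q ((), T) y else 0))"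
proof -
  define \<phi> where "\<phi> j T = (if T \<subseteq> cov x \<and> card T = l then f (unit_vec ((), T) (z T)) j (z T) else 0)" for j T
  show ?thesis
  proof (intro exI[of _ \<phi>] conjI allI impI)
    show "T \<subseteq> cov x" "card T = l" "j \<le> z T" if "\<phi> j T \<noteq> 0" for j T
    proof -
      have T: "T \<subseteq> cov x" "card T = l" "f (unit_vec ((), T) (z T)) j (z T) \<noteq> 0"
        using that by (auto simp: \<phi>_def split: if_splits)
      then show "T \<subseteq> cov x" "card T = l" "j \<le> z T"
        using mhom_closed[OF f unit_vec_closed[OF T(1,2)]] by auto
    qed
    fix q :: "unit \<times> 'l set \<Rightarrow> 'l \<Rightarrow> 'k" and j y assume q: "q \<in> carrier (Q l)"
    have "(\<Sum>i\<in>kz_index (\<lambda>_. cov x) l. f (unit_vec i (kz_gen (\<lambda>_. x) i)) j (kz_gen (\<lambda>_. x) i) * q i y)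
        = (\<Sum>T\<in>{T. T \<subseteq> cov x \<and> card T = l}. \<phi> j T * q ((), T) y)"
      by (rule sum.reindex_bij_witness[of _ "\<lambda>T. ((), T)" snd]) (auto simp: kz_index_def \<phi>_def)
    also have "\<dots> = (\<Sum>T\<in>Pow (cov x). \<phi> j T * q ((), T) y)"
      by (rule sum.mono_neutral_left) (auto simp: \<phi>_def)
    finally show "f q j y = (if j \<le> y then \<Sum>T\<in>Pow (cov x). \<phi> j T * q ((), T) y else 0)"
      using mhom_conv_expand[OF kz_rel_iff convex_le f q] by simp
  qed
qed

private lemma sum_kz_d:
  fixes q :: "unit \<times> 'l set \<Rightarrow> 'l \<Rightarrow> 'k::field"
  assumes q: "q \<in> carrier (Q (Suc l))" and \<phi>: "\<And>T. \<phi> T \<noteq> 0 \<Longrightarrow> card T = l"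
  shows "(\<Sum>T\<in>Pow (cov x). \<phi> T * \<delta> l q ((), T) y) = (\<Sum>T\<in>Pow (cov x). cobd \<phi> T * q ((), T) y)"
proof -
  have "(\<Sum>T\<in>Pow (cov x). \<phi> T * \<delta> l q ((), T) y) = (\<Sum>T\<in>Pow (cov x). \<phi> T * bd (cov x) (\<lambda>T. q ((), T) y) T)"
  proof (intro sum.cong refl)
    fix T assume "T \<in> Pow (cov x)"
    then show "\<phi> T * \<delta> l q ((), T) y = \<phi> T * bd (cov x) (\<lambda>T. q ((), T) y) T"
      using \<phi>[of T] kz_d_bd[OF q, of T] by (cases "\<phi> T = 0") auto
  qed
  then show ?thesis by (simp add: bd_cobd_adjoint)
qed

text \<open>The argument runs separately for each row j of the matrix. If some cover can be removed
  with the join staying above j, contracting with it solves the coboundary equation; otherwise the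
  row vanishes in this degree.\<close>

lemma hom_exact_regular_less:
  assumes l: "l < card (cov x)"
  shows "hom_exact Q \<delta> (N :: (('l, 'k::field) incidence_algebra, _) right_mod) l"
  unfolding hom_exact_def
proof (intro allI impI, elim conjE)
  fix f assume f: "mhom (Q l) (N :: (('l, 'k) incidence_algebra, _) right_mod) f"
    and f0: "\<forall>q\<in>carrier (Q (Suc l)). f (\<delta> l q) = \<zero>\<^bsub>N\<^esub>"
  obtain \<phi> where \<phi>: "\<And>j T. \<phi> j T \<noteq> 0 \<Longrightarrow> T \<subseteq> cov x \<and> card T = l \<and> j \<le> z T"
    and f\<phi>: "\<And>q j y. q \<in> carrier (Q l) \<Longrightarrow> f q j y = (if j \<le> y then \<Sum>T\<in>Pow (cov x). \<phi> j T * q ((), T) y else 0)"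
    using hom_matrix[OF f] by (elim exE conjE) blast
  \<comment> \<open>If j lies below the join of \<open>T\<close>, evaluating f on the differential
    of the generator of \<open>T\<close> reads off this entry. If not, the support condition kills
    all the terms of the entry.\<close>
  have cocycle: "cobd (\<phi> j) T = 0" if T: "T \<subseteq> cov x" for j T
  proof (cases "card T = Suc l \<and> j \<le> z T")
    case True
    let ?q = "unit_vec ((), T) (z T) :: unit \<times> 'l set \<Rightarrow> 'l \<Rightarrow> 'k"
    have q: "?q \<in> carrier (Q (Suc l))" using T True by (intro unit_vec_closed) auto
    have "0 = f (\<delta> l ?q) j (z T)" using f0 q by simp
    also have "\<dots> = (\<Sum>T'\<in>Pow (cov x). \<phi> j T' * \<delta> l ?q ((), T') (z T))"
      using f\<phi>[OF mhom_closed[OF mhom_kz_d q]] True by simp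
    also have "\<dots> = (\<Sum>T'\<in>Pow (cov x). cobd (\<phi> j) T' * ?q ((), T') (z T))"
      using \<phi> by (intro sum_kz_d q) blast
    also have "\<dots> = (\<Sum>T'\<in>Pow (cov x). if T' = T then cobd (\<phi> j) T else 0)"
      by (intro sum.cong refl) (auto simp: unit_vec_def)
    also have "\<dots> = cobd (\<phi> j) T" using T by simp
    finally show ?thesis by simp
  next
    case False
    have "\<phi> j (T - {c}) = 0" if "c \<in> T" for c
    proof (rule ccontr)
      assume "\<phi> j (T - {c}) \<noteq> 0"
      then have "card (T - {c}) = l" "j \<le> z (T - {c})" using \<phi> by blast+
      moreover have "card T = Suc (card (T - {c}))" using card_Suc_Diff1[OF _ that] by simp
      moreover have "z (T - {c}) \<le> z T" by (intro kz_gen_mono) auto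
      ultimately show False using False by (auto intro: order_trans)
    qed
    then show ?thesis by (simp add: cobd_def)
  qed
  define c0 where "c0 j = (SOME c. c \<in> cov x \<and> j \<le> z (cov x - {c}))" for j
  define \<gamma> where "\<gamma> j T = (if T \<subseteq> cov x \<and> (\<exists>c\<in>cov x. j \<le> z (cov x - {c})) then cocontr (c0 j) (\<phi> j) T else 0)" for j T
  have c0: "c0 j \<in> cov x" "j \<le> z (cov x - {c0 j})" if "\<exists>c\<in>cov x. j \<le> z (cov x - {c})" for j
    using someI_ex[of "\<lambda>c. c \<in> cov x \<and> j \<le> z (cov x - {c})"] that unfolding c0_def by auto
  have \<gamma>: "T \<subseteq> cov x \<and> Suc (card T) = l \<and> j \<le> z T" if "\<gamma> j T \<noteq> 0" for j T
  proof -
    from that have T: "T \<subseteq> cov x" and ex: "\<exists>c\<in>cov x. j \<le> z (cov x - {c})"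
      and "cocontr (c0 j) (\<phi> j) T \<noteq> 0" by (auto simp: \<gamma>_def split: if_splits)
    from this(3) have c: "c0 j \<notin> T" "\<phi> j (insert (c0 j) T) \<noteq> 0" by (auto simp: cocontr_def split: if_splits)
    then have "card (insert (c0 j) T) = l" "j \<le> z (insert (c0 j) T)" using \<phi> by blast+
    \<comment> \<open>The point of the choice of apex: removing it keeps the join above j, so
      \<gamma> satisfies the support condition that makes it the matrix of a homomorphism.\<close>
    then show ?thesis using T c(1) c0[OF ex] le_kz_gen_delete[of "c0 j" T j] by simp
  qed
  have cobd_\<gamma>: "cobd (\<gamma> j) T = \<phi> j T" if T: "T \<subseteq> cov x" for j T
  proof (cases "\<exists>c\<in>cov x. j \<le> z (cov x - {c})")
    case ex: True
    have "cobd (\<gamma> j) T = cobd (cocontr (c0 j) (\<phi> j)) T"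
      unfolding cobd_def using T ex by (intro sum.cong refl) (auto simp: \<gamma>_def)
    moreover have "cocontr (c0 j) (cobd (\<phi> j)) T = 0"
      using cocycle[of "insert (c0 j) T" j] T c0(1)[OF ex] by (auto simp: cocontr_def)
    ultimately show ?thesis using cobd_cocontr[of "c0 j" "\<phi> j" T] by simp
  next
    case False
    \<comment> \<open>Without an apex, only the set of all covers can have its join above j, and it
      has too many elements for this degree.\<close>
    have "\<phi> j T = 0"
    proof (rule ccontr)
      assume "\<phi> j T \<noteq> 0"
      then have jT: "card T = l" "j \<le> z T" using \<phi> by blast+
      then have "T \<noteq> cov x" using l by auto
      then obtain c where "c \<in> cov x" "T \<subseteq> cov x - {c}" using T by blast
      then show False using False jT(2) kz_gen_mono by (meson order_trans)
    qed
    then show ?thesis using False by (simp add: cobd_def \<gamma>_def)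
  qed
  show "case l of 0 \<Rightarrow> \<forall>q\<in>carrier (Q 0). f q = \<zero>\<^bsub>N\<^esub>
    | Suc i \<Rightarrow> \<exists>g. mhom (Q i) N g \<and> (\<forall>q\<in>carrier (Q (Suc i)). f q = g (\<delta> i q))"
  proof (cases l)
    case 0
    have "\<phi> j T = 0" for j T
    proof (rule ccontr)
      assume nz: "\<phi> j T \<noteq> 0"
      then have "T = {}" using \<phi>[OF nz] 0 by auto
      then show False using nz cobd_\<gamma>[of T j] by (simp add: cobd_def)
    qed
    then have "f q = \<zero>\<^bsub>N\<^esub>" if "q \<in> carrier (Q 0)" for q
      using f\<phi>[of q] that 0 by (auto simp: fun_eq_iff)
    then show ?thesis using 0 by simp
  next
    case (Suc i)
    let ?g = "\<lambda>q j y. if (j, y) \<in> {(w, y). w \<le> y} then \<Sum>T\<in>Pow (cov x). \<gamma> j T * q ((), T) y else 0"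
    have gm: "mhom (Q i) N ?g"
    proof (rule mhom_matrix)
      fix j T u y assume "\<gamma> j T \<noteq> 0" and u: "(((), T), u) \<in> kz_rel (\<lambda>_. x) (\<lambda>_. cov x) i"
        and y: "u \<le> y"
      then have "j \<le> z T" using \<gamma> by blast
      moreover have "z T \<le> u" using u by (simp add: kz_rel_iff)
      ultimately have "j \<le> u" by (rule order_trans)
      moreover have "(((), T), y) \<in> kz_rel (\<lambda>_. x) (\<lambda>_. cov x) i"
        using u y by (auto simp: kz_rel_iff intro: order_trans)
      ultimately show "(j, u) \<in> {(w, y). w \<le> y} \<longleftrightarrow> (((), T), y) \<in> kz_rel (\<lambda>_. x) (\<lambda>_. cov x) i" by simp
    qed
    moreover have "f q = ?g (\<delta> i q)" if q: "q \<in> carrier (Q (Suc i))" for q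
    proof (intro ext)
      fix j y
      have "(\<Sum>T\<in>Pow (cov x). \<gamma> j T * \<delta> i q ((), T) y) = (\<Sum>T\<in>Pow (cov x). cobd (\<gamma> j) T * q ((), T) y)"
        using \<gamma> Suc by (intro sum_kz_d q) blast
      also have "\<dots> = (\<Sum>T\<in>Pow (cov x). \<phi> j T * q ((), T) y)"
        by (intro sum.cong refl) (simp add: cobd_\<gamma>)
      finally show "f q j y = ?g (\<delta> i q) j y" using f\<phi>[of q j y] q Suc by simp
    qed
    ultimately show ?thesis unfolding Suc nat.case using gm by blast
  qed
qed

text \<open>The witness projects onto the summand of the full set of covers and includes it in the
  right ideal at w, the join of all covers. A preimage would need a proper subset of the covers
  whose join is also above w, contrary to \<open>kz_gen_cov_less\<close>.\<close>

lemma not_hom_exact_regular: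
  "\<not> hom_exact Q \<delta> (N :: (('l, 'k::field) incidence_algebra, _) right_mod) (card (cov x))"
proof
  let ?n = "card (cov x)" and ?w = "z (cov x)"
  assume ex: "hom_exact Q \<delta> (N :: (('l, 'k) incidence_algebra, _) right_mod) ?n"
  let ?f = "\<lambda>q j y. if (j, y) \<in> {(w, y). w \<le> y}
    then \<Sum>c\<in>{()}. (if j = ?w then 1 else 0) * q ((), cov x) y else 0 :: 'k"
  let ?u = "unit_vec ((), cov x) ?w :: unit \<times> 'l set \<Rightarrow> 'l \<Rightarrow> 'k"
  have u: "?u \<in> carrier (Q ?n)" by (rule unit_vec_closed) simp_all
  have fu: "?f ?u ?w ?w = 1" by (simp add: unit_vec_def)
  have f: "mhom (Q ?n) N ?f"
    by (rule mhom_matrix) (auto simp: kz_rel_iff intro: order_trans split: if_splits)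
  \<comment> \<open>No cover is left to insert, so the component of the differential at the full set
    is an empty sum.\<close>
  have "\<forall>q\<in>carrier (Q (Suc ?n)). ?f (\<delta> ?n q) = \<zero>\<^bsub>N\<^esub>" by (simp add: kz_d_def fun_eq_iff)
  then have *: "case ?n of 0 \<Rightarrow> \<forall>q\<in>carrier (Q 0). ?f q = \<zero>\<^bsub>N\<^esub>
    | Suc i \<Rightarrow> \<exists>g. mhom (Q i) N g \<and> (\<forall>q\<in>carrier (Q (Suc i)). ?f q = g (\<delta> i q))"
    using ex f unfolding hom_exact_def by blast
  show False
  proof (cases ?n)
    case 0
    then have "?f ?u = \<zero>\<^bsub>N\<^esub>" using * u unfolding 0 nat.case by blast
    from fun_cong[OF fun_cong[OF this, of ?w], of ?w] show False by (simp add: unit_vec_def)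
  next
    case (Suc i)
    then obtain g where g: "mhom (Q i) (N :: (('l, 'k) incidence_algebra, _) right_mod) g"
      and fg: "\<And>q. q \<in> carrier (Q (Suc i)) \<Longrightarrow> ?f q = g (\<delta> i q)"
      using * unfolding Suc nat.case by blast
    obtain \<phi> where \<phi>: "\<And>j T. \<phi> j T \<noteq> 0 \<Longrightarrow> T \<subseteq> cov x \<and> card T = i \<and> j \<le> z T"
      and g\<phi>: "\<And>q j y. q \<in> carrier (Q i) \<Longrightarrow> g q j y = (if j \<le> y then \<Sum>T\<in>Pow (cov x). \<phi> j T * q ((), T) y else 0)"
      using hom_matrix[OF g] by (elim exE conjE) blast
    have "\<phi> ?w T = 0" for T
    proof (rule ccontr)
      assume "\<phi> ?w T \<noteq> 0"
      then have "T \<subseteq> cov x" "card T = i" "?w \<le> z T" using \<phi> by blast+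
      moreover from this(2) have "T \<noteq> cov x" using Suc by auto
      ultimately show False using kz_gen_cov_less by blast
    qed
    moreover have uS: "?u \<in> carrier (Q (Suc i))" using u Suc by simp
    ultimately have "g (\<delta> i ?u) ?w ?w = 0" using g\<phi>[OF mhom_closed[OF mhom_kz_d uS], of ?w ?w] by simp
    then have "?f ?u ?w ?w = 0" using fun_cong[OF fun_cong[OF fg[OF uS], of ?w], of ?w] by (rule trans[rotated])
    then show False using fu by (simp add: unit_vec_def)
  qed
qed

end

subsection \<open>Cograde\<close>

text \<open>As base of the Koszul complex it makes the condition of lying above the base
  vacuous.\<close>

definition bot_elt :: "'l::{finite,lattice}" where
  "bot_elt = Inf_fin UNIV"

lemma bot_elt_le: "bot_elt \<le> (y :: 'l::{finite,lattice})"
  unfolding bot_elt_def by (rule Inf_fin.coboundedI) simp_all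

text \<open>An element is below w exactly if it is above none of these, so they are the right
  generators for the complex resolving the injective at w. In a distributive lattice each of them is
  join-prime.\<close>

definition min_not_le :: "'l::order \<Rightarrow> 'l set" where
  "min_not_le w = {j. \<not> j \<le> w \<and> (\<forall>u<j. u \<le> w)}"

lemma ex_min_not_le:
  fixes w y :: "'l::{finite,order}"
  assumes "\<not> y \<le> w"
  shows "\<exists>j\<in>min_not_le w. j \<le> y"
proof -
  obtain j where j: "j \<in> {z. z \<le> y \<and> \<not> z \<le> w}" "\<And>z. z \<in> {z. z \<le> y \<and> \<not> z \<le> w} \<Longrightarrow> z \<le> j \<Longrightarrow> j = z"
    using finite_has_minimal[of "{z. z \<le> y \<and> \<not> z \<le> w}"] assms by auto
  have "u \<le> w" if "u < j" for u
  proof (rule ccontr)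
    assume "\<not> u \<le> w"
    then show False using j(1) j(2)[of u] that less_imp_le[OF that] by (auto intro: order_trans)
  qed
  then show ?thesis using j(1) by (auto simp: min_not_le_def)
qed

text \<open>If t is below neither a nor b, its meets with them are strictly below t, hence below w
  by minimality. By distributivity t is their join, hence below w, a contradiction.\<close>

lemma min_not_le_prime:
  fixes w :: "'l::{finite,distrib_lattice}"
  assumes "t \<in> min_not_le w" "t \<le> sup a b"
  shows "t \<le> a \<or> t \<le> b"
proof (rule ccontr)
  assume "\<not> ?thesis"
  then have "inf t a < t" "inf t b < t" by (auto simp: less_le_not_le)
  then have "inf t a \<le> w" "inf t b \<le> w" using assms(1) by (auto simp: min_not_le_def)
  then have "inf t (sup a b) \<le> w" by (simp add: inf_sup_distrib1)
  then show False using assms by (auto simp: min_not_le_def inf_absorb1)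
qed

lemma min_not_le_antichain:
  assumes "t \<in> min_not_le w" "t' \<in> min_not_le w" "t \<le> t'"
  shows "t = t'"
  using assms by (auto simp: min_not_le_def order.order_iff_strict)

lemma min_not_le_prime_kz_gen:
  fixes w :: "'l::{finite,distrib_lattice}"
  assumes t: "t \<in> min_not_le w"
  shows "t \<le> kz_gen (\<lambda>_. bot_elt) (v, U) \<Longrightarrow> \<exists>u\<in>U. t \<le> u"
  using finite[of U]
proof (induction U rule: finite_induct)
  case empty
  then have "t \<le> bot_elt" by (simp add: kz_gen_def)
  then have "t \<le> w" using bot_elt_le[of w] by (rule order_trans)
  then show ?case using t by (simp add: min_not_le_def)
next
  case (insert u U)
  then show ?case using min_not_le_prime[OF t, of u] by (auto simp: kz_gen_insert)
qed

text \<open>Each coatom \<open>c\<close> of the interval below \<open>x\<close> fails to dominate exactly one element \<open>t\<close> of an irredundant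
  decomposition of \<open>x\<close> into join-primes, and each \<open>t\<close> is dominated by all coatoms but one.\<close>

lemma card_decomposition:
  fixes w x :: "'l::{finite,distrib_lattice}"
  assumes T: "T \<subseteq> min_not_le w" and x: "kz_gen (\<lambda>_. bot_elt) (v, T) = x"
  shows "card T = card (cocov x)"
proof -
  have le_x: "t \<le> x" if "t \<in> T" for t
    using kz_gen_upper(2)[OF that, where b = "\<lambda>_. bot_elt" and w = v] x by simp
  have 1: "\<exists>!c. c \<in> cocov x \<and> \<not> t \<le> c" if t: "t \<in> T" for t
  proof -
    \<comment> \<open>The join of the remaining elements. Primeness and the antichain property keep
      t from lying below it, so it is strictly below x; a lower cover of x above it cannot also
      contain t, or it would contain the whole join x.\<close>
    let ?s = "kz_gen (\<lambda>_. bot_elt) (v, T - {t})"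
    have tw: "t \<in> min_not_le w" using t T by blast
    have "\<not> t \<le> ?s"
    proof
      assume "t \<le> ?s"
      then obtain u where "u \<in> T - {t}" "t \<le> u" using min_not_le_prime_kz_gen[OF tw, of v "T - {t}"] by auto
      moreover from this have "u \<in> min_not_le w" using T by auto
      ultimately show False using min_not_le_antichain[OF tw, of u] by auto
    qed
    moreover have "?s \<le> x" using le_x bot_elt_le by (auto simp: kz_gen_le_iff)
    ultimately have "?s < x" using le_x[OF t] by (metis order.order_iff_strict)
    then obtain c where c: "c \<in> cocov x" "?s \<le> c" using ex_cocov_ge by blast
    have "\<not> t \<le> c"
    proof
      assume "t \<le> c"
      then have "kz_gen (\<lambda>_. bot_elt) (v, T) \<le> c"
        using c(2) by (auto simp: kz_gen_le_iff)
      then show False using c(1) x by (auto simp: cocov_def)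
    qed
    moreover have "c' = c''" if "c' \<in> cocov x" "\<not> t \<le> c'" "c'' \<in> cocov x" "\<not> t \<le> c''" for c' c''
    proof (rule ccontr)
      assume "c' \<noteq> c''"
      then have "t \<le> sup c' c''" using sup_cocov_ge[of c' x c''] that le_x[OF t] by (auto intro: order_trans)
      then show False using min_not_le_prime[OF tw] that by blast
    qed
    ultimately show ?thesis using c(1) by blast
  qed
  have 2: "\<exists>!t. t \<in> T \<and> \<not> t \<le> c" if c: "c \<in> cocov x" for c
  proof -
    have "\<exists>t\<in>T. \<not> t \<le> c"
    proof (rule ccontr)
      assume "\<not> (\<exists>t\<in>T. \<not> t \<le> c)"
      then have "kz_gen (\<lambda>_. bot_elt) (v, T) \<le> c" using bot_elt_le by (auto simp: kz_gen_le_iff)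
      then show False using c x by (auto simp: cocov_def)
    qed
    moreover have "t = t'" if t: "t \<in> T" "\<not> t \<le> c" and t': "t' \<in> T" "\<not> t' \<le> c" for t t'
    proof -
      \<comment> \<open>The lower cover c and an element t of \<open>T\<close> not below it join to
        x, so primeness of t' leaves only t' \<le> t.\<close>
      have "t' \<le> sup c t" using sup_cocov_ge'[OF c le_x[OF t(1)] t(2)] le_x[OF t'(1)] by (rule order_trans[rotated])
      then have "t' \<le> t" using min_not_le_prime[of t' w c t] t' T by blast
      then show ?thesis using min_not_le_antichain[of t' w t] t t' T by blast
    qed
    ultimately show ?thesis by blast
  qed
  have "bij_betw (\<lambda>t. THE c. c \<in> cocov x \<and> \<not> t \<le> c) T (cocov x)"
  proof (rule bij_betw_byWitness[where f' = "\<lambda>c. THE t. t \<in> T \<and> \<not> t \<le> c"])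
    show "\<forall>t\<in>T. (THE t'. t' \<in> T \<and> \<not> t' \<le> (THE c. c \<in> cocov x \<and> \<not> t \<le> c)) = t"
      using theI'[OF 1] 2 by (auto intro!: the1_equality)
    show "\<forall>c\<in>cocov x. (THE c'. c' \<in> cocov x \<and> \<not> (THE t. t \<in> T \<and> \<not> t \<le> c) \<le> c') = c"
      using theI'[OF 2] 1 by (auto intro!: the1_equality)
    show "(\<lambda>t. THE c. c \<in> cocov x \<and> \<not> t \<le> c) ` T \<subseteq> cocov x" using theI'[OF 1] by auto
    show "(\<lambda>c. THE t. t \<in> T \<and> \<not> t \<le> c) ` cocov x \<subseteq> T" using theI'[OF 2] by auto
  qed
  then show ?thesis by (rule bij_betw_same_card)
qed

text \<open>With w the meet of x and its lower covers, the elements of \<open>min_not_le w\<close>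
  below x have join x. Otherwise their join meets x below some lower cover c; a minimal element
  below x but not below c turns out to belong to the set, although it is not below c.\<close>

lemma ex_decomposition:
  fixes x :: "'l::{finite,distrib_lattice}"
  obtains w T where "T \<subseteq> min_not_le w" "kz_gen (\<lambda>_. bot_elt) (w, T) = x"
proof -
  define w where "w = Inf_fin (insert x (cocov x))"
  have w_iff: "y \<le> w \<longleftrightarrow> y \<le> x \<and> (\<forall>c\<in>cocov x. y \<le> c)" for y
    unfolding w_def by (subst Inf_fin.bounded_iff) auto
  let ?T = "{t \<in> min_not_le w. t \<le> x}"
  have "x \<le> kz_gen (\<lambda>_. bot_elt) (w, ?T)" (is "x \<le> ?y")
  proof (rule ccontr)
    assume "\<not> x \<le> ?y"
    then have "inf x ?y < x" by (auto simp: less_le_not_le)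
    then obtain c where c: "c \<in> cocov x" "inf x ?y \<le> c" using ex_cocov_ge by blast
    have "x \<in> {t. t \<le> x \<and> \<not> t \<le> c}" using c(1) by (auto simp: cocov_def)
    then have "{t. t \<le> x \<and> \<not> t \<le> c} \<noteq> {}" by (intro notI) simp
    from finite_has_minimal[OF finite this]
    obtain t where t: "t \<in> {t. t \<le> x \<and> \<not> t \<le> c}"
      and min: "\<forall>u\<in>{t. t \<le> x \<and> \<not> t \<le> c}. u \<le> t \<longrightarrow> t = u" by (elim bexE)
    \<comment> \<open>By distributivity t is the join of its meets with c and c', so the latter meet
      is not below c; minimality of t makes it equal to t.\<close>
    have tc': "t \<le> c'" if c': "c' \<in> cocov x" "c' \<noteq> c" for c'
    proof -
      have "\<not> inf t c' \<le> c"
      proof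
        assume le: "inf t c' \<le> c"
        have "x \<le> sup c c'" using sup_cocov_ge[OF c(1) c'(1)] c'(2) by blast
        then have "t \<le> sup c c'" using t by (auto intro: order_trans)
        then have "t = sup (inf t c) (inf t c')" by (simp add: inf_absorb1 flip: inf_sup_distrib1)
        also have "\<dots> \<le> c" using le by simp
        finally show False using t by simp
      qed
      then have "t = inf t c'" using t by (intro min[rule_format]) (auto intro: le_infI1)
      then show ?thesis by (metis inf.cobounded2)
    qed
    have "u \<le> w" if u: "u < t" for u
    proof -
      have "u \<le> x" using u t by (auto intro: order_trans less_imp_le)
      moreover have "u \<le> c" using min[rule_format, of u] u \<open>u \<le> x\<close> by (auto simp: less_imp_le)
      moreover have "u \<le> c'" if "c' \<in> cocov x" "c' \<noteq> c" for c'
        using tc'[OF that] u by (auto intro: order_trans less_imp_le)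
      ultimately show ?thesis unfolding w_iff by blast
    qed
    moreover have "\<not> t \<le> w" using t c(1) by (auto simp: w_iff)
    ultimately have "t \<in> ?T" using t by (auto simp: min_not_le_def)
    then have "t \<le> ?y" by (rule kz_gen_upper(2))
    then show False using t c(2) by (auto intro: order_trans[OF le_infI])
  qed
  moreover have "?y \<le> x" using bot_elt_le by (auto simp: kz_gen_le_iff)
  ultimately show thesis using that[of ?T w] by (auto intro: order.antisym)
qed

context
  fixes x :: "'l::{finite,distrib_lattice}"
begin

private abbreviation "QD l \<equiv> conv_mod (kz_rel (\<lambda>_::'l. bot_elt) min_not_le l)
  :: (('l, 'k::field) incidence_algebra, 'l \<times> 'l set \<Rightarrow> 'l \<Rightarrow> 'k) right_mod"
private abbreviation "\<delta>D l \<equiv> kz_d (\<lambda>_::'l. bot_elt) min_not_le l"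
private abbreviation "ND \<equiv> conv_mod {((), x)}
  :: (('l, 'k::field) incidence_algebra, unit \<Rightarrow> 'l \<Rightarrow> 'k) right_mod"

private lemma convex_single: "convex_rel {((), x)}"
  by (auto simp: convex_rel_def)

text \<open>A generator at a vertex other than x can only go to zero in the simple module, and by
  \<open>card_decomposition\<close> generators at x occur in a single degree. The Hom complex is
  therefore concentrated there.\<close>

private lemma hom_simple_zero:
  assumes f: "mhom (QD l) (ND :: (('l, 'k::field) incidence_algebra, _) right_mod) f"
    and l: "l \<noteq> card (cocov x)" and q: "q \<in> carrier (QD l)"
  shows "f q = \<zero>\<^bsub>ND\<^esub>"
proof -
  have "f (unit_vec i (kz_gen (\<lambda>_. bot_elt) i)) j (kz_gen (\<lambda>_. bot_elt) i) = 0"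
    if i: "i \<in> kz_index min_not_le l" for i j
  proof -
    obtain w T where wT: "i = (w, T)" by force
    have T: "T \<subseteq> min_not_le w" "card T = l" using i by (auto simp: wT kz_index_def)
    then have "kz_gen (\<lambda>_. bot_elt) i \<noteq> x" using card_decomposition[of T w w x] l wT by blast
    moreover have "(unit_vec i (kz_gen (\<lambda>_. bot_elt) i) :: _ \<Rightarrow> 'l \<Rightarrow> 'k) \<in> carrier (QD l)"
      using i by (auto simp: unit_vec_def kz_rel_iff)
    then have "f (unit_vec i (kz_gen (\<lambda>_. bot_elt) i)) \<in> carrier ND" by (rule mhom_closed[OF f])
    ultimately show ?thesis by auto
  qed
  then show ?thesis
    by (subst mhom_conv_expand[OF kz_rel_iff convex_single f q]) (auto simp: fun_eq_iff intro!: sum.neutral)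
qed

lemma hom_exact_simple:
  assumes l: "l \<noteq> card (cocov x)"
  shows "hom_exact QD \<delta>D (ND :: (('l, 'k::field) incidence_algebra, _) right_mod) l"
  unfolding hom_exact_def
proof (intro allI impI, elim conjE)
  let ?N = "ND :: (('l, 'k) incidence_algebra, _) right_mod"
  fix f assume f: "mhom (QD l) ?N f"
  show "case l of 0 \<Rightarrow> \<forall>q\<in>carrier (QD 0). f q = \<zero>\<^bsub>?N\<^esub>
    | Suc i \<Rightarrow> \<exists>g. mhom (QD i) ?N g \<and> (\<forall>q\<in>carrier (QD (Suc i)). f q = g (\<delta>D i q))"
  proof (cases l)
    case 0
    then show ?thesis using hom_simple_zero[OF f l] by simp
  next
    case (Suc i)
    have "mhom (QD i) ?N (\<lambda>_. \<zero>\<^bsub>?N\<^esub>)" by (rule mhom_const_zero[OF right_module_conv[OF convex_single]])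
    then show ?thesis unfolding Suc nat.case using hom_simple_zero[OF f l] Suc by blast
  qed
qed

text \<open>As the neighbouring Hom spaces vanish, it is enough to have a nonzero homomorphism in
  this degree: the coordinate of a summand generated at x, supplied by a decomposition.\<close>

lemma not_hom_exact_simple:
  "\<not> hom_exact QD \<delta>D (ND :: (('l, 'k::field) incidence_algebra, _) right_mod) (card (cocov x))"
proof
  let ?N = "ND :: (('l, 'k) incidence_algebra, _) right_mod" and ?n = "card (cocov x)"
  assume ex: "hom_exact QD \<delta>D ?N ?n"
  obtain w T where T: "T \<subseteq> min_not_le w" and x: "kz_gen (\<lambda>_. bot_elt) (w, T) = x"
    by (rule ex_decomposition)
  have n: "card T = ?n" by (rule card_decomposition[OF T x])
  let ?f = "\<lambda>q j y. if (j, y) \<in> {((), x)} then \<Sum>c\<in>{()}. 1 * q (w, T) y else 0 :: 'k"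
  let ?u = "unit_vec (w, T) x :: 'l \<times> 'l set \<Rightarrow> 'l \<Rightarrow> 'k"
  have i: "(w, T) \<in> kz_index min_not_le ?n" using T n by (simp add: kz_index_def)
  then have u: "?u \<in> carrier (QD ?n)" using x by (auto simp: unit_vec_def kz_rel_iff)
  have fu: "?f ?u () x = 1" by (simp add: unit_vec_def)
  have f: "mhom (QD ?n) ?N ?f"
    by (rule mhom_matrix[where C = "\<lambda>_. {()}" and m = "\<lambda>_ _. 1" and \<sigma> = "\<lambda>_ _. (w, T)"])
      (use x in \<open>auto simp: kz_rel_iff\<close>)
  \<comment> \<open>The composite is itself a homomorphism from degree \<open>Suc ?n\<close> to the
    simple module, hence zero.\<close>
  have "\<forall>q\<in>carrier (QD (Suc ?n)). ?f (\<delta>D ?n q) = \<zero>\<^bsub>?N\<^esub>"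
    using hom_simple_zero[OF mhom_comp[OF mhom_kz_d f]] by simp
  then have *: "case ?n of 0 \<Rightarrow> \<forall>q\<in>carrier (QD 0). ?f q = \<zero>\<^bsub>?N\<^esub>
    | Suc i \<Rightarrow> \<exists>g. mhom (QD i) ?N g \<and> (\<forall>q\<in>carrier (QD (Suc i)). ?f q = g (\<delta>D i q))"
    using ex f unfolding hom_exact_def by blast
  have "?f ?u = \<zero>\<^bsub>?N\<^esub>"
  proof (cases ?n)
    case 0
    then show ?thesis using * u unfolding 0 nat.case by blast
  next
    case (Suc i)
    then obtain g where g: "mhom (QD i) ?N g" and fg: "\<And>q. q \<in> carrier (QD (Suc i)) \<Longrightarrow> ?f q = g (\<delta>D i q)"
      using * unfolding Suc nat.case by blast
    have uS: "?u \<in> carrier (QD (Suc i))" using u Suc by simp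
    have "g (\<delta>D i ?u) = \<zero>\<^bsub>?N\<^esub>"
      by (rule hom_simple_zero[OF g _ mhom_closed[OF mhom_kz_d uS]]) (use Suc in simp)
    then show ?thesis using fg[OF uS] by (rule trans[rotated])
  qed
  from fun_cong[OF fun_cong[OF this, of "()"], of x] show False by (simp add: unit_vec_def)
qed

end

theorem corollary3p3:
  fixes x :: "'l::{finite,distrib_lattice}"
    and S :: "(('l, 'k::field) incidence_algebra, ('l, 'k) incidence_algebra set) right_mod"
  assumes "card (UNIV :: 'l set) \<ge> 2"
    and "S = simple_mod x"
  shows "grade S = pdim S \<and> pdim S = enat (card (cov x)) \<and>
    cograde S = idim S \<and> idim S = enat (card (cocov x))"
proof -
  let ?C = "conv_mod {((), x)} :: (('l, 'k) incidence_algebra, unit \<Rightarrow> 'l \<Rightarrow> 'k) right_mod"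
  let ?A = "regular_mod :: (_, ('l, 'k) incidence_algebra) right_mod"
  let ?DA = "dual_mod :: (('l, 'k) incidence_algebra, _) right_mod"
  let ?A' = "conv_mod {(w, y). w \<le> y} :: (('l, 'k) incidence_algebra, 'l \<Rightarrow> 'l \<Rightarrow> 'k) right_mod"
  have S: "right_module S" unfolding assms(2) by (rule right_module_simple)
  have C: "right_module ?C" by (rule right_module_conv) (auto simp: convex_rel_def)
  have A': "right_module ?A'" by (rule right_module_conv) (auto simp: convex_rel_def)
  note A = right_module_regular
  obtain f g where iso: "mod_iso ?C S f g" unfolding assms(2) by (rule simple_mod_iso)
  obtain f' g' where iso': "mod_iso (conv_mod {(w, y). y \<le> w}) ?DA f' g'" by (rule dual_mod_iso)

  \<comment> \<open>An element above x but above no cover of x is x itself, so the complex resolves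
    the simple module.\<close>
  have "kz_target (\<lambda>_::unit. x) (\<lambda>_. cov x) = {((), x)}"
  proof -
    have "y = x" if "x \<le> y" "\<forall>j\<in>cov x. \<not> j \<le> y" for y
      using that ex_cov_le[of x y] by (auto simp: order.order_iff_strict)
    moreover have "\<not> j \<le> x" if "j \<in> cov x" for j using that by (auto simp: cov_def)
    ultimately show ?thesis by (auto simp: kz_target_def)
  qed
  from proj_res_kz[of "\<lambda>_::unit. x" "\<lambda>_. cov x", where 'k = 'k, unfolded this]
  have P: "proj_res S (\<lambda>l. conv_mod (kz_rel (\<lambda>_::unit. x) (\<lambda>_. cov x) l)) (kz_d (\<lambda>_. x) (\<lambda>_. cov x))
      (\<lambda>q. f (kz_e (\<lambda>_. x) (\<lambda>_. cov x) q))"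
    by (rule proj_res_iso[OF _ iso S])
  have P_less: "hom_exact (\<lambda>l. conv_mod (kz_rel (\<lambda>_::unit. x) (\<lambda>_. cov x) l)) (kz_d (\<lambda>_. x) (\<lambda>_. cov x)) ?A l"
    if "l < card (cov x)" for l
    by (rule hom_exact_iso[OF regular_mod_iso A' A hom_exact_regular_less[OF that]])
  have P_eq: "\<not> hom_exact (\<lambda>l. conv_mod (kz_rel (\<lambda>_::unit. x) (\<lambda>_. cov x) l)) (kz_d (\<lambda>_. x) (\<lambda>_. cov x)) ?A (card (cov x))"
    using hom_exact_iso[OF mod_iso_sym[OF regular_mod_iso] A A'] not_hom_exact_regular by blast
  have pdim: "pdim S = enat (card (cov x))"
    by (rule pdim_eqI[OF P kz_zero A P_eq]) simp
  have grade: "grade S = enat (card (cov x))"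
    unfolding grade_def by (rule Inf_enat_eq) (use P_less P_eq in \<open>simp_all add: trivial_Ext_iff[OF P A]\<close>)

  \<comment> \<open>Being above no minimal element outside the down-set of w means being below w;
    the sum over all w is D(A).\<close>
  have "kz_target (\<lambda>_::'l. bot_elt) min_not_le = {(w, y). y \<le> w}"
  proof -
    have "(\<forall>j\<in>min_not_le w. \<not> j \<le> y) \<longleftrightarrow> y \<le> w" for w y :: 'l
    proof
      show "y \<le> w" if "\<forall>j\<in>min_not_le w. \<not> j \<le> y"
        using ex_min_not_le[of y w] that by blast
      show "\<forall>j\<in>min_not_le w. \<not> j \<le> y" if "y \<le> w"
        using that by (auto simp: min_not_le_def intro: order_trans)
    qed
    then show ?thesis by (simp add: kz_target_def bot_elt_le)
  qed
  from proj_res_kz[of "\<lambda>_::'l. bot_elt" min_not_le, where 'k = 'k, unfolded this]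
  have DP: "proj_res ?DA (\<lambda>l. conv_mod (kz_rel (\<lambda>_::'l. bot_elt) min_not_le l)) (kz_d (\<lambda>_. bot_elt) min_not_le)
      (\<lambda>q. f' (kz_e (\<lambda>_. bot_elt) min_not_le q))"
    by (rule proj_res_iso[OF _ iso' right_module_dual])
  have D_ne: "hom_exact (\<lambda>l. conv_mod (kz_rel (\<lambda>_::'l. bot_elt) min_not_le l)) (kz_d (\<lambda>_. bot_elt) min_not_le) S l"
    if "l \<noteq> card (cocov x)" for l
    by (rule hom_exact_iso[OF iso C S hom_exact_simple[OF that]])
  have D_eq: "\<not> hom_exact (\<lambda>l. conv_mod (kz_rel (\<lambda>_::'l. bot_elt) min_not_le l)) (kz_d (\<lambda>_. bot_elt) min_not_le) S (card (cocov x))"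
    using hom_exact_iso[OF mod_iso_sym[OF iso] S C] not_hom_exact_simple by blast
  have cograde: "cograde S = enat (card (cocov x))"
    unfolding cograde_def by (rule Inf_enat_eq) (use D_ne D_eq in \<open>simp_all add: trivial_Ext_iff[OF DP S]\<close>)
  have "ck_source x (cocov x) = {((), x)}"
  proof -
    have "y = x" if "y \<le> x" "\<forall>j\<in>cocov x. \<not> y \<le> j" for y
      using that ex_cocov_ge[of y x] by (auto simp: order.order_iff_strict)
    moreover have "\<not> x \<le> j" if "j \<in> cocov x" for j using that by (auto simp: cocov_def)
    ultimately show ?thesis by (auto simp: ck_source_def)
  qed
  from inj_res_ck[of x "cocov x", where 'k = 'k, unfolded this]
  have I: "inj_res S (\<lambda>l. conv_mod (ck_rel x (cocov x) l)) (ck_d x (cocov x)) (\<lambda>m. ck_e x (cocov x) (g m))"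
    by (rule inj_res_iso[OF _ iso S])
  \<comment> \<open>The complex \<open>I\<close> gives the upper bound; nonvanishing of Ext from
    D(A) in this degree, used above for the cograde, gives the lower one.\<close>
  have "idim S = enat (card (cocov x))"
    by (rule idim_eqI[OF I ck_zero DP D_eq])
  then show ?thesis using pdim grade cograde by simp
qed

end
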